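(* Let $L$ be a language, i.e. a set of finite strings (equivalently, via a standard coding, $L\subseteq\mathbb{N}$). Then $L$ is recognized by some Turing machine with the fast-growing sequence oracle if and only if $L$ is (lightface) $\Pi^1_1$.
   Context: A Turing machine $M$ with the fast-growing sequence oracle is an oracle Turing machine whose oracle is a total function $\mathbb{N}\to\mathbb{N}$. The language $L$ is recognized by $M$ with the fast-growing sequence oracle iff there is a total function $A:\mathbb{N}\to\mathbb{N}$ such that for every $B:\mathbb{N}\to\mathbb{N}$ with $B(n)\ge A(n)$ for all $n$, and for every input $S$: $M$ using $B$ as an oracle halts on input $S$ iff $S\in L$. *)

theory Defs
  imports Main "HOL-Library.Nat_Bijection"
begin

section \<open>Oracle Turing machines\<close>

text \<open>
  A machine has finitely many tapes, each infinite to the right only (a left move in cell 0 leaves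
  the head where it is).  States are the numbers below \<^term>\<open>num_states\<close>, tape symbols the numbers
  below \<^term>\<open>num_symbols\<close>; 0 is the blank, and the input letter \<^term>\<open>a\<close> is written as
  \<^term>\<open>Suc a\<close>.  Tape 0 carries the input, tape 1 is the oracle tape.

  In a state \<^term>\<open>q\<close> of \<^term>\<open>query_states\<close> the machine consults its oracle: if the oracle tape
  holds exactly \<^term>\<open>n\<close> consecutive symbols 1 from cell 0 on, its contents are replaced by
  \<^term>\<open>B n\<close> symbols 1 followed by blanks, its head is put on cell 0, and the machine goes to state
  \<^term>\<open>answer_state M q\<close>.
\<close>

datatype move = Go_Left | Stay | Go_Right

record oracle_machine =
  num_tapes :: nat
  num_states :: nat
  num_symbols :: nat
  start_state :: nat
  halt_state :: nat
  query_states :: "nat set"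
  answer_state :: "nat \<Rightarrow> nat"
  delta :: "nat \<Rightarrow> nat list \<Rightarrow> nat \<times> (nat \<times> move) list"

text \<open>Only the values of \<^term>\<open>delta\<close> on the finitely many arguments considered here are ever used.\<close>

definition oracle_TM :: "nat set \<Rightarrow> oracle_machine \<Rightarrow> bool" where
  "oracle_TM \<Sigma> M \<longleftrightarrow>
     2 \<le> num_tapes M \<and> 2 \<le> num_symbols M \<and> (\<forall>a\<in>\<Sigma>. Suc a < num_symbols M) \<and>
     start_state M < num_states M \<and> halt_state M < num_states M \<and>
     (\<forall>q\<in>query_states M. q < num_states M \<and> answer_state M q < num_states M) \<and>
     (\<forall>q xs. q < num_states M \<and> length xs = num_tapes M \<and> set xs \<subseteq> {..<num_symbols M} \<longrightarrow>
        fst (delta M q xs) < num_states M \<and>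
        length (snd (delta M q xs)) = num_tapes M \<and>
        (\<forall>(s, d)\<in>set (snd (delta M q xs)). s < num_symbols M))"

type_synonym tape = "(nat \<Rightarrow> nat) \<times> nat"  \<comment> \<open>cell contents and head position\<close>

type_synonym configuration = "nat \<times> tape list"

fun read_symbol :: "tape \<Rightarrow> nat" where
  "read_symbol (c, h) = c h"

fun move_head :: "move \<Rightarrow> nat \<Rightarrow> nat" where
  "move_head Go_Left h = h - 1"
| "move_head Stay h = h"
| "move_head Go_Right h = h + 1"

fun act :: "nat \<times> move \<Rightarrow> tape \<Rightarrow> tape" where
  "act (s, d) (c, h) = (c(h := s), move_head d h)"

definition query_number :: "tape \<Rightarrow> nat" where
  "query_number t = (LEAST i. fst t i \<noteq> 1)"

definition unary_tape :: "nat \<Rightarrow> tape" where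
  "unary_tape n = ((\<lambda>i. if i < n then 1 else 0), 0)"

definition input_tape :: "nat list \<Rightarrow> tape" where
  "input_tape w = ((\<lambda>i. if i < length w then Suc (w ! i) else 0), 0)"

definition blank_tape :: tape where
  "blank_tape = ((\<lambda>i. 0), 0)"

definition initial_config :: "oracle_machine \<Rightarrow> nat list \<Rightarrow> configuration" where
  "initial_config M w = (start_state M, input_tape w # replicate (num_tapes M - 1) blank_tape)"

fun step :: "oracle_machine \<Rightarrow> (nat \<Rightarrow> nat) \<Rightarrow> configuration \<Rightarrow> configuration" where
  "step M B (q, ts) =
     (if q = halt_state M then (q, ts)
      else if q \<in> query_states M then
        (answer_state M q, ts[1 := unary_tape (B (query_number (ts ! 1)))])
      else let (q', acts) = delta M q (map read_symbol ts) in (q', map2 act acts ts))"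

definition halts_on :: "oracle_machine \<Rightarrow> (nat \<Rightarrow> nat) \<Rightarrow> nat list \<Rightarrow> bool" where
  "halts_on M B w \<longleftrightarrow> (\<exists>t. fst ((step M B ^^ t) (initial_config M w)) = halt_state M)"

definition recognizes_with_fast_growing_oracle ::
    "nat set \<Rightarrow> oracle_machine \<Rightarrow> nat list set \<Rightarrow> bool" where
  "recognizes_with_fast_growing_oracle \<Sigma> M L \<longleftrightarrow>
     (\<exists>A. \<forall>B. (\<forall>n. B n \<ge> A n) \<longrightarrow> (\<forall>S\<in>lists \<Sigma>. halts_on M B S \<longleftrightarrow> S \<in> L))"


section \<open>Second-order arithmetic and lightface $\Pi^1_1$\<close>

text \<open>
  The usual two-sorted language with number variables and set variables, interpreted in the full
  standard model: set quantifiers range over all sets of natural numbers.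
\<close>

datatype nterm = Var nat | Zero | One | Plus nterm nterm | Times nterm nterm

datatype form =
    Eq nterm nterm
  | Less nterm nterm
  | Mem nterm nat
  | Neg form
  | Conj form form
  | All_num nat form
  | All_set nat form

fun eval_term :: "(nat \<Rightarrow> nat) \<Rightarrow> nterm \<Rightarrow> nat" where
  "eval_term e (Var x) = e x"
| "eval_term e Zero = 0"
| "eval_term e One = 1"
| "eval_term e (Plus s t) = eval_term e s + eval_term e t"
| "eval_term e (Times s t) = eval_term e s * eval_term e t"

fun sat :: "(nat \<Rightarrow> nat) \<Rightarrow> (nat \<Rightarrow> nat set) \<Rightarrow> form \<Rightarrow> bool" where
  "sat e V (Eq s t) \<longleftrightarrow> eval_term e s = eval_term e t"
| "sat e V (Less s t) \<longleftrightarrow> eval_term e s < eval_term e t"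
| "sat e V (Mem t X) \<longleftrightarrow> eval_term e t \<in> V X"
| "sat e V (Neg \<phi>) \<longleftrightarrow> \<not> sat e V \<phi>"
| "sat e V (Conj \<phi> \<psi>) \<longleftrightarrow> sat e V \<phi> \<and> sat e V \<psi>"
| "sat e V (All_num x \<phi>) \<longleftrightarrow> (\<forall>n. sat (e(x := n)) V \<phi>)"
| "sat e V (All_set X \<phi>) \<longleftrightarrow> (\<forall>Y. sat e (V(X := Y)) \<phi>)"

fun term_vars :: "nterm \<Rightarrow> nat set" where
  "term_vars (Var x) = {x}"
| "term_vars Zero = {}"
| "term_vars One = {}"
| "term_vars (Plus s t) = term_vars s \<union> term_vars t"
| "term_vars (Times s t) = term_vars s \<union> term_vars t"

fun free_num :: "form \<Rightarrow> nat set" where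
  "free_num (Eq s t) = term_vars s \<union> term_vars t"
| "free_num (Less s t) = term_vars s \<union> term_vars t"
| "free_num (Mem t X) = term_vars t"
| "free_num (Neg \<phi>) = free_num \<phi>"
| "free_num (Conj \<phi> \<psi>) = free_num \<phi> \<union> free_num \<psi>"
| "free_num (All_num x \<phi>) = free_num \<phi> - {x}"
| "free_num (All_set X \<phi>) = free_num \<phi>"

fun free_set :: "form \<Rightarrow> nat set" where
  "free_set (Eq s t) = {}"
| "free_set (Less s t) = {}"
| "free_set (Mem t X) = {X}"
| "free_set (Neg \<phi>) = free_set \<phi>"
| "free_set (Conj \<phi> \<psi>) = free_set \<phi> \<union> free_set \<psi>"
| "free_set (All_num x \<phi>) = free_set \<phi>"
| "free_set (All_set X \<phi>) = free_set \<phi> - {X}"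

fun arithmetical :: "form \<Rightarrow> bool" where
  "arithmetical (Eq s t) \<longleftrightarrow> True"
| "arithmetical (Less s t) \<longleftrightarrow> True"
| "arithmetical (Mem t X) \<longleftrightarrow> True"
| "arithmetical (Neg \<phi>) \<longleftrightarrow> arithmetical \<phi>"
| "arithmetical (Conj \<phi> \<psi>) \<longleftrightarrow> arithmetical \<phi> \<and> arithmetical \<psi>"
| "arithmetical (All_num x \<phi>) \<longleftrightarrow> arithmetical \<phi>"
| "arithmetical (All_set X \<phi>) \<longleftrightarrow> False"

inductive Pi11_form :: "form \<Rightarrow> bool" where
  matrix: "arithmetical \<phi> \<Longrightarrow> Pi11_form \<phi>"
| prefix: "Pi11_form \<phi> \<Longrightarrow> Pi11_form (All_set X \<phi>)"

text \<open>Lightface: the defining formula has no set parameters; its only free variable is number variable 0.\<close>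

definition Pi11 :: "nat set \<Rightarrow> bool" where
  "Pi11 N \<longleftrightarrow>
     (\<exists>\<phi>. Pi11_form \<phi> \<and> free_num \<phi> \<subseteq> {0} \<and> free_set \<phi> = {} \<and>
          (\<forall>e V. e 0 \<in> N \<longleftrightarrow> sat e V \<phi>))"

text \<open>Strings are coded by numbers through the library bijection \<^term>\<open>list_encode\<close>.\<close>

definition Pi11_language :: "nat list set \<Rightarrow> bool" where
  "Pi11_language L \<longleftrightarrow> Pi11 (list_encode ` L)"

end

theory Submission
  imports Defs
begin

text \<open>
  Suppose that \<open>A\<close> witnesses the recognition of \<open>L\<close> by \<open>M\<close>. Since every \<open>A'\<close> lies below some
  \<open>B \<ge> A\<close>, a string \<open>S\<close> is in \<open>L\<close> iff for every \<open>A'\<close> there is \<open>B \<ge> A'\<close> for which \<open>M\<close> halts on \<open>S\<close>.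
  A halting run uses only finitely many values of \<open>B\<close>, so only the quantifier over \<open>A'\<close> is of second
  order. To avoid coding finite functions and runs by numbers, the formula says that every set of
  facts contains a halting fact if it is closed under the rules of computation and describes a family
  of oracles each of which can be changed at any argument to any large enough value, keeping the
  values at smaller arguments.

  Conversely, let \<open>N\<close> consist of the numbers \<open>s\<close> such that \<open>\<phi>(s, X)\<close> holds for all sets \<open>X\<close>, where
  \<open>\<phi>\<close> is arithmetical. In the negation of \<open>\<phi>\<close> let the existential number quantifiers be bounded by
  values of \<open>B\<close>. If \<open>B\<close> dominates the least witnesses for one fixed counterexample \<open>X\<close> for each
  \<open>s \<notin> N\<close>, this does not change the truth for that \<open>X\<close>, while for every \<open>X\<close> the formula can only
  become stronger. It is now a closed condition on \<open>X\<close>, so by compactness it is unsatisfiable iff this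
  shows at some finite stage, and a machine with oracle \<open>B\<close> can search for that stage.
\<close>

section \<open>Structured programs for oracle machines\<close>

text \<open>In the first direction the formula cannot name \<open>A\<close>, and the oracle
  \<open>B\<close> extracted from a closed set need not be one of those that the set describes. It
  is a diagonal limit: each extension keeps the smaller arguments, so every finite part of
  \<open>B\<close> belongs to a single run. For a string outside \<open>L\<close> the refuting
  closed set holds the true facts about the countably many finite upward changes of
  \<open>A\<close>; all of them lie above \<open>A\<close>, so none makes \<open>M\<close> halt.

  In the other direction compactness requires each existential quantifier to range over a finite set
  that does not depend on the stage, and this is what the oracle provides. Its argument is one
  number while a witness depends on several parameters; asking at their sum leaves finitely many
  cases for each argument. The two halves use \<open>B\<close> differently: for
  \<open>s \<in> N\<close> the search succeeds with any oracle at all, and domination is needed only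
  to keep the search from stopping when \<open>s \<notin> N\<close>.\<close>

datatype prog =
    Act nat "nat \<Rightarrow> nat \<times> move"
  | Ask
  | Seq prog prog
  | While nat "nat \<Rightarrow> bool" prog

text \<open>Programs act on a family of tapes indexed by all numbers, so that a fresh counter is
  always at hand; the number of tapes is fixed only on compilation, by
  \<open>within\<close>.\<close>

inductive exec :: "(nat \<Rightarrow> nat) \<Rightarrow> prog \<Rightarrow> (nat \<Rightarrow> tape) \<Rightarrow> (nat \<Rightarrow> tape) \<Rightarrow> bool" for B where
  exec_Act: "T' = T(k := act (f (read_symbol (T k))) (T k)) \<Longrightarrow> exec B (Act k f) T T'"
| exec_Ask: "T' = T(1 := unary_tape (B (query_number (T 1)))) \<Longrightarrow> exec B Ask T T'"
| exec_Seq: "exec B c T T' \<Longrightarrow> exec B d T' T'' \<Longrightarrow> exec B (Seq c d) T T''"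
| exec_While_done: "\<not> P (read_symbol (T k)) \<Longrightarrow> exec B (While k P c) T T"
| exec_While_step: "P (read_symbol (T k)) \<Longrightarrow> exec B c T T' \<Longrightarrow> exec B (While k P c) T' T'' \<Longrightarrow>
    exec B (While k P c) T T''"

fun within :: "nat \<Rightarrow> prog \<Rightarrow> bool" where
  "within K (Act k f) \<longleftrightarrow> k < K"
| "within K Ask \<longleftrightarrow> 1 < K"
| "within K (Seq c d) \<longleftrightarrow> within K c \<and> within K d"
| "within K (While k P c) \<longleftrightarrow> k < K \<and> 0 < K \<and> within K c"

lemma within_mono: "within K c \<Longrightarrow> K \<le> K' \<Longrightarrow> within K' c"
  by (induction c) auto

lemma within_exists: "\<exists>K. within K c"
proof (induction c)
  case (Act k f)
  then show ?case by (auto intro: exI[of _ "Suc k"])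
next
  case Ask
  then show ?case by (auto intro: exI[of _ 2])
next
  case (Seq c d)
  then obtain K K' where "within K c" "within K' d" by auto
  then have "within (max K K') (Seq c d)" by (auto intro: within_mono)
  then show ?case by blast
next
  case (While k P c)
  then obtain K where "within K c" by auto
  then have "within (max K (Suc k)) (While k P c)" by (auto intro: within_mono)
  then show ?case by blast
qed

text \<open>The bound keeps the written symbols below the size of every alphabet with at least two symbols.\<close>

fun modest :: "prog \<Rightarrow> bool" where
  "modest (Act k f) \<longleftrightarrow> (\<forall>a. fst (f a) \<le> max a 1)"
| "modest Ask \<longleftrightarrow> True"
| "modest (Seq c d) \<longleftrightarrow> modest c \<and> modest d"
| "modest (While k P c) \<longleftrightarrow> modest c"

section \<open>Compilation to machine code\<close>

datatype instr = Ins nat "nat \<Rightarrow> nat \<times> nat \<times> move" | Query nat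

fun plen :: "prog \<Rightarrow> nat" where
  "plen (Act k f) = 1"
| "plen Ask = 1"
| "plen (Seq c d) = plen c + plen d"
| "plen (While k P c) = plen c + 2"

text \<open>Jump targets are absolute, so the code depends on its start address \<open>q\<close>. A
  loop becomes a test, the body, and a jump back, the latter being an idle instruction on tape
  0.\<close>

fun code :: "nat \<Rightarrow> prog \<Rightarrow> instr list" where
  "code q (Act k f) = [Ins k (\<lambda>a. (q + 1, f a))]"
| "code q Ask = [Query (q + 1)]"
| "code q (Seq c d) = code q c @ code (q + plen c) d"
| "code q (While k P c) =
     Ins k (\<lambda>a. (if P a then q + 1 else q + plen c + 2, a, Stay)) # code (q + 1) c @
     [Ins 0 (\<lambda>a. (q, a, Stay))]"

lemma length_code [simp]: "length (code q c) = plen c"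
  by (induction c arbitrary: q) auto

fun good_instr :: "nat \<Rightarrow> instr \<Rightarrow> bool" where
  "good_instr n (Ins k f) \<longleftrightarrow> (\<forall>a. fst (f a) \<le> n \<and> fst (snd (f a)) \<le> max a 1)"
| "good_instr n (Query q) \<longleftrightarrow> q \<le> n"

lemma good_instr_code:
  "modest c \<Longrightarrow> q + plen c \<le> n \<Longrightarrow> i \<in> set (code q c) \<Longrightarrow> good_instr n i"
proof (induction c arbitrary: q)
  case (Seq c d)
  then show ?case using Seq.IH(1)[of q] Seq.IH(2)[of "q + plen c"] by auto
next
  case (While k P c)
  then show ?case using While.IH[of "q + 1"] by auto
qed auto

fun instr_delta :: "instr \<Rightarrow> nat list \<Rightarrow> nat \<times> (nat \<times> move) list" where
  "instr_delta (Ins k f) xs =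
     (fst (f (xs ! k)), map (\<lambda>i. if i = k then snd (f (xs ! k)) else (xs ! i, Stay)) [0..<length xs])"
| "instr_delta (Query q) xs = (0, map (\<lambda>x. (x, Stay)) xs)"

text \<open>A state is the index of the next instruction, and running off the end of the program is
  halting. The default branch of \<open>delta\<close> serves the halting state, where
  \<open>oracle_TM\<close> also asks for values within bounds.\<close>

definition machine :: "nat \<Rightarrow> nat \<Rightarrow> instr list \<Rightarrow> oracle_machine" where
  "machine K N P = \<lparr>num_tapes = K, num_states = Suc (length P), num_symbols = N, start_state = 0,
     halt_state = length P, query_states = {q. q < length P \<and> (\<exists>q'. P ! q = Query q')},
     answer_state = (\<lambda>q. case P ! q of Query q' \<Rightarrow> q' | _ \<Rightarrow> 0),
     delta = (\<lambda>q xs. if q < length P then instr_delta (P ! q) xs else (0, map (\<lambda>x. (x, Stay)) xs))\<rparr>"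

lemma machine_simps [simp]:
  "num_tapes (machine K N P) = K" "num_states (machine K N P) = Suc (length P)"
  "num_symbols (machine K N P) = N" "start_state (machine K N P) = 0"
  "halt_state (machine K N P) = length P"
  by (simp_all add: machine_def)

lemma oracle_TM_machine:
  assumes "2 \<le> K" "2 \<le> N" "\<forall>a\<in>\<Sigma>. Suc a < N" "\<forall>i\<in>set P. good_instr (length P) i"
    and w: "\<forall>i\<in>set P. \<forall>k f. i = Ins k f \<longrightarrow> k < K"
  shows "oracle_TM \<Sigma> (machine K N P)"
proof -
  have *: "fst (delta (machine K N P) q xs) < Suc (length P) \<and>
        length (snd (delta (machine K N P) q xs)) = K \<and>
        (\<forall>(s, d)\<in>set (snd (delta (machine K N P) q xs)). s < N)"
    if "q < Suc (length P)" "length xs = K" "set xs \<subseteq> {..<N}" for q xs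
  proof (cases "q < length P")
    case True
    then have g: "good_instr (length P) (P ! q)" using assms by auto
    show ?thesis
    proof (cases "P ! q")
      case (Ins k f)
      have k: "k < K" using w True Ins by (metis nth_mem)
      have "xs ! k < N" using k that by (metis lessThan_iff nth_mem subsetD)
      moreover have "fst (snd (f (xs ! k))) \<le> max (xs ! k) 1" and j: "fst (f (xs ! k)) \<le> length P"
        using g Ins by auto
      ultimately have "fst (snd (f (xs ! k))) < N" using \<open>2 \<le> N\<close> by linarith
      moreover have "xs ! i < N" if "i < K" for i
        using that \<open>length xs = K\<close> \<open>set xs \<subseteq> _\<close> by (metis lessThan_iff nth_mem subsetD)
      ultimately show ?thesis using True Ins that j
        by (auto simp: machine_def split: if_splits dest: arg_cong[of _ _ fst])
    next
      case (Query q')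
      then show ?thesis using True that by (auto simp: machine_def)
    qed
  next
    case False
    then show ?thesis using that by (auto simp: machine_def)
  qed
  have q: "q < Suc (length P) \<and> answer_state (machine K N P) q < Suc (length P)" if "q \<in> query_states (machine K N P)" for q
  proof -
    have "good_instr (length P) (P ! q)" using assms that by (auto simp: machine_def)
    then show ?thesis using that by (auto simp: machine_def)
  qed
  show ?thesis unfolding oracle_TM_def machine_simps
    using assms(1-3) * q by blast
qed

lemma within_code: "within K c \<Longrightarrow> Ins k f \<in> set (code q c) \<Longrightarrow> k < K"
  by (induction c arbitrary: q) auto

definition reaches :: "oracle_machine \<Rightarrow> (nat \<Rightarrow> nat) \<Rightarrow> configuration \<Rightarrow> configuration \<Rightarrow> bool" where
  "reaches M B c c' \<longleftrightarrow> (\<exists>t. (step M B ^^ t) c = c')"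

lemma reaches_trans: "reaches M B c c' \<Longrightarrow> reaches M B c' c'' \<Longrightarrow> reaches M B c c''"
  unfolding reaches_def by (metis comp_apply funpow_add)

lemma reaches_step: "step M B c = c' \<Longrightarrow> reaches M B c c'"
  unfolding reaches_def by (metis funpow_0 funpow_simps_right(2) comp_apply)

lemma act_Stay [simp]: "act (read_symbol t, Stay) t = t"
  by (cases t) auto

declare step.simps [simp del]

lemma step_Ins:
  assumes "q < length P" "P ! q = Ins k f" "k < K"
  shows "step (machine K N P) B (q, map T [0..<K]) =
    (fst (f (read_symbol (T k))), map (T(k := act (snd (f (read_symbol (T k)))) (T k))) [0..<K])"
  using assms by (auto simp: machine_def Let_def step.simps intro!: nth_equalityI)

lemma step_Query:
  assumes "q < length P" "P ! q = Query q'" "1 < K"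
  shows "step (machine K N P) B (q, map T [0..<K]) =
    (q', map (T(1 := unary_tape (B (query_number (T 1))))) [0..<K])"
proof -
  have "(map T [0..<K])[1 := x] = map (T(1 := x)) [0..<K]" for x
    by (auto intro!: nth_equalityI simp: nth_list_update)
  then show ?thesis using assms by (auto simp: machine_def step.simps)
qed

text \<open>The jumps around the body cost a step, so an endless loop gives an endless run.\<close>

lemma compile_iteration:
  assumes P: "P = us @ code (length us) (While k Q c) @ vs"
    and K: "within K (While k Q c)" and Q: "Q (read_symbol (T k))"
    and body: "reaches (machine K N P) B (length us + 1, map T [0..<K])
      (length us + 1 + plen c, map T' [0..<K])"
  shows "\<exists>t. (step (machine K N P) B ^^ Suc t) (length us, map T [0..<K]) = (length us, map T' [0..<K])"
proof -
  let ?M = "machine K N P"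
  have "P ! length us = Ins k (\<lambda>a. (if Q a then length us + 1 else length us + plen c + 2, a, Stay))"
    "length us < length P" using P by auto
  then have 1: "step ?M B (length us, map T [0..<K]) = (length us + 1, map T [0..<K])"
    using K Q by (simp add: step_Ins)
  have "P ! (length us + 1 + plen c) = Ins 0 (\<lambda>a. (length us, a, Stay))"
    unfolding P by (simp add: nth_append)
  moreover have "length us + 1 + plen c < length P" unfolding P by simp
  ultimately have 2: "step ?M B (length us + 1 + plen c, map T' [0..<K]) = (length us, map T' [0..<K])"
    using K by (simp add: step_Ins)
  obtain t where "(step ?M B ^^ t) (length us + 1, map T [0..<K]) = (length us + 1 + plen c, map T' [0..<K])"
    using body unfolding reaches_def by blast
  then have "(step ?M B ^^ Suc (Suc t)) (length us, map T [0..<K]) = (length us, map T' [0..<K])"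
    using 1 2 by (simp add: funpow_swap1)
  then show ?thesis by blast
qed

text \<open>The code may stand anywhere inside \<open>P\<close>, so that the induction hypotheses
  apply to subprograms at their own addresses. Only terminating executions are covered, since
  \<open>exec\<close> says nothing about divergence.\<close>

lemma compile_correct:
  assumes "exec B c T T'" "within K c" "P = us @ code (length us) c @ vs"
  shows "reaches (machine K N P) B (length us, map T [0..<K]) (length us + plen c, map T' [0..<K])"
  using assms
proof (induction arbitrary: us vs rule: exec.induct)
  case (exec_Act T' T k f)
  have "P ! length us = Ins k (\<lambda>a. (length us + 1, f a))" "length us < length P"
    using exec_Act by auto
  then show ?case using exec_Act by (intro reaches_step) (simp add: step_Ins)
next
  case (exec_Ask T' T)
  have "P ! length us = Query (length us + 1)" "length us < length P"
    using exec_Ask by auto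
  then show ?case using exec_Ask by (intro reaches_step) (simp add: step_Query)
next
  case (exec_Seq c T T' d T'')
  show ?case
    using exec_Seq.IH(1)[of us "code (length us + plen c) d @ vs"]
      exec_Seq.IH(2)[of "us @ code (length us) c" vs] exec_Seq.prems
    by (auto intro: reaches_trans simp: add.assoc)
next
  case (exec_While_done Q T k c)
  have "P ! length us = Ins k (\<lambda>a. (if Q a then length us + 1 else length us + plen c + 2, a, Stay))"
    "length us < length P"
    using exec_While_done by auto
  then show ?case using exec_While_done by (intro reaches_step) (simp add: step_Ins)
next
  case (exec_While_step Q T k c T' T'')
  let ?hd = "Ins k (\<lambda>a. (if Q a then length us + 1 else length us + plen c + 2, a, Stay))"
  have "reaches (machine K N P) B (length us + 1, map T [0..<K]) (length us + 1 + plen c, map T' [0..<K])"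
    using exec_While_step.IH(1)[of "us @ [?hd]"] exec_While_step.prems by simp
  from compile_iteration[where Q = Q, OF exec_While_step.prems(2,1) exec_While_step.hyps(1) this]
  have "reaches (machine K N P) B (length us, map T [0..<K]) (length us, map T' [0..<K])"
    unfolding reaches_def by blast
  then show ?case
    using exec_While_step.IH(2)[OF exec_While_step.prems] by (blast intro: reaches_trans)
qed

section \<open>Halting and divergence of runs\<close>

lemma halted_stays:
  assumes "fst ((step M B ^^ t) c) = halt_state M" "t \<le> t'"
  shows "fst ((step M B ^^ t') c) = halt_state M"
  using assms(2)
proof (induction t' rule: dec_induct)
  case base
  then show ?case using assms by simp
next
  case (step n)
  then show ?case by (cases "(step M B ^^ n) c") (auto simp: step.simps)
qed

text \<open>Proves divergence, which \<open>exec\<close> cannot express. The run returns to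
  \<open>G\<close> after at least one step each time, hence at arbitrarily late times, whereas a
  halting state would stay for ever.\<close>

lemma recurrent_never_halts:
  assumes G: "\<And>c. c \<in> G \<Longrightarrow> fst c \<noteq> halt_state M \<and> (\<exists>t. (step M B ^^ Suc t) c \<in> G)"
    and "c \<in> G"
  shows "fst ((step M B ^^ t) c) \<noteq> halt_state M"
proof -
  have "\<exists>t'\<ge>t. (step M B ^^ t') c \<in> G"
  proof (induction t)
    case 0
    then show ?case using \<open>c \<in> G\<close> by (metis funpow_0 le0)
  next
    case (Suc t)
    then obtain t' where t': "t' \<ge> t" "(step M B ^^ t') c \<in> G" by auto
    then obtain u where "(step M B ^^ Suc u) ((step M B ^^ t') c) \<in> G" using G by blast
    then have "(step M B ^^ (Suc u + t')) c \<in> G" by (simp only: funpow_add o_apply)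
    then show ?case using t' by (metis Suc_le_mono add_Suc le_add2 order_trans)
  qed
  then show ?thesis using G halted_stays by blast
qed

section \<open>Computing with counters\<close>

declare split_paired_Ex [simp del] split_paired_All [simp del]

definition mark :: "nat \<Rightarrow> nat" where
  "mark = (\<lambda>i. if i = 0 then 1 else 0)"

text \<open>A tape \<open>k \<ge> 2\<close> is a counter: only its cell 0 is marked, and its value is the head position.\<close>

definition conf :: "(nat \<Rightarrow> nat) \<Rightarrow> tape \<Rightarrow> (nat \<Rightarrow> nat) \<Rightarrow> nat \<Rightarrow> tape" where
  "conf w u s k = (if k = 0 then (w, s 0) else if k = 1 then u else (mark, s k))"

lemma read_symbol_conf [simp]:
  "2 \<le> k \<Longrightarrow> read_symbol (conf w u s k) = (if s k = 0 then 1 else 0)"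
  "read_symbol (conf w u s 0) = w (s 0)"
  "read_symbol (conf w u s (Suc 0)) = read_symbol u"
  by (auto simp: conf_def mark_def)

definition inc where "inc k = Act k (\<lambda>a. (a, Go_Right))"
definition dec where "dec k = Act k (\<lambda>a. (a, Go_Left))"
definition skip where "skip = Act 0 (\<lambda>a. (a, Stay))"
text \<open>On a counter the symbol 1 is seen exactly at cell 0, so the test
  \<open>a \<noteq> 1\<close> says that the value is positive.\<close>

definition Loop where "Loop k c = While k (\<lambda>a. a \<noteq> 1) (Seq (dec k) c)"
definition clear where "clear k = Loop k skip"
definition transfer where "transfer k l = Loop k (inc l)"
text \<open>Counting a counter down destroys its value, so it is recorded twice, and the record in
  the scratch counter \<open>t\<close> is used to restore \<open>k\<close>.\<close>

definition copy where
  "copy k l t = Seq (clear l) (Seq (clear t) (Seq (Loop k (Seq (inc l) (inc t))) (transfer t k)))"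

lemma modest_simps [simp]:
  "modest (inc k)" "modest (dec k)" "modest skip" "modest (Loop k c) \<longleftrightarrow> modest c"
  "modest (clear k)" "modest (transfer k l)" "modest (copy k l t)"
  by (auto simp: inc_def dec_def skip_def Loop_def clear_def transfer_def copy_def)

lemma exec_inc: "k \<noteq> 1 \<Longrightarrow> exec B (inc k) (conf w u s) (conf w u (s(k := Suc (s k))))"
  unfolding inc_def by (rule exec_Act) (auto simp: conf_def)

lemma exec_dec: "k \<noteq> 1 \<Longrightarrow> exec B (dec k) (conf w u s) (conf w u (s(k := s k - 1)))"
  unfolding dec_def by (rule exec_Act) (auto simp: conf_def)

lemma exec_skip: "exec B skip T T"
  unfolding skip_def by (rule exec_Act) auto

lemma exec_oracle_tape: "exec B (Act 1 f) (conf w u s) (conf w (act (f (read_symbol u)) u) s)"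
  by (rule exec_Act) (auto simp: conf_def)

text \<open>\<open>J i\<close> is the invariant after \<open>i\<close> rounds and \<open>n\<close>
  the initial value of the counter. \<open>Loop\<close> decreases the counter before the body runs,
  hence \<open>n - Suc i\<close> in the premise about the body.\<close>

lemma exec_Loop:
  assumes k: "2 \<le> k"
    and J0: "J 0 u s"
    and val: "\<And>i u s. J i u s \<Longrightarrow> s k = n - i"
    and step: "\<And>i u s. i < n \<Longrightarrow> J i u s \<Longrightarrow>
      \<exists>u' s'. exec B c (conf w u (s(k := n - Suc i))) (conf w u' s') \<and> J (Suc i) u' s'"
  shows "\<exists>u' s'. exec B (Loop k c) (conf w u s) (conf w u' s') \<and> J n u' s'"
proof -
  have "i \<le> n \<Longrightarrow> J i u s \<Longrightarrow>
    \<exists>u' s'. exec B (Loop k c) (conf w u s) (conf w u' s') \<and> J n u' s'" for i u s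
  proof (induction "n - i" arbitrary: i u s)
    case 0
    then have "i = n" by simp
    then show ?case
      unfolding Loop_def using 0 val[of n u s] k
      by (intro exI[of _ u] exI[of _ s] conjI exec_While_done) auto
  next
    case (Suc m)
    then have i: "i < n" by simp
    obtain u' s' where 1: "exec B c (conf w u (s(k := n - Suc i))) (conf w u' s')" "J (Suc i) u' s'"
      using step[OF i Suc.prems(2)] by blast
    have "s k - 1 = n - Suc i" using val[OF Suc.prems(2)] by simp
    then have 2: "exec B (dec k) (conf w u s) (conf w u (s(k := n - Suc i)))"
      using exec_dec[of k B w u s] k by simp
    have "\<exists>u'' s''. exec B (Loop k c) (conf w u' s') (conf w u'' s'') \<and> J n u'' s''"
      by (rule Suc.hyps(1)[of "Suc i", OF _ _ 1(2)]) (use Suc.hyps(2) i in linarith)+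
    then obtain u'' s'' where 3: "exec B (Loop k c) (conf w u' s') (conf w u'' s'')" "J n u'' s''"
      by blast
    have "s k \<noteq> 0" using val[OF Suc.prems(2)] i by simp
    then have "exec B (Loop k c) (conf w u s) (conf w u'' s'')"
      unfolding Loop_def using k
      by (intro exec_While_step[OF _ exec_Seq[OF 2 1(1)] 3(1)[unfolded Loop_def]]) simp
    then show ?case using 3(2) by blast
  qed
  from this[of 0 u s] show ?thesis using J0 by blast
qed

lemma exec_clear:
  assumes "2 \<le> k"
  shows "exec B (clear k) (conf w u s) (conf w u (s(k := 0)))"
proof -
  have "\<exists>u' s'. exec B (clear k) (conf w u s) (conf w u' s') \<and> u' = u \<and> s' = s(k := s k - s k)"
    unfolding clear_def using assms
    by (intro exec_Loop[where J = "\<lambda>i u' s'. u' = u \<and> s' = s(k := s k - i)"]) (auto intro: exec_skip)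
  then show ?thesis by simp
qed

lemma exec_transfer:
  assumes "2 \<le> k" "2 \<le> l" "k \<noteq> l"
  shows "exec B (transfer k l) (conf w u s) (conf w u (s(l := s l + s k, k := 0)))"
proof -
  have "\<exists>u' s'. exec B (transfer k l) (conf w u s) (conf w u' s') \<and>
      u' = u \<and> s' = s(l := s l + s k, k := s k - s k)"
    unfolding transfer_def using assms
  proof (intro exec_Loop[where J = "\<lambda>i u' s'. u' = u \<and> s' = s(l := s l + i, k := s k - i)"], goal_cases)
    case (4 i u' s')
    then show ?case
      using exec_inc[of l B w u "s(l := s l + i, k := s k - Suc i)"]
      by (auto simp: fun_upd_twist)
  qed auto
  then show ?thesis by simp
qed

lemma exec_copy:
  assumes "2 \<le> k" "2 \<le> l" "2 \<le> t" "k \<noteq> l" "k \<noteq> t" "l \<noteq> t"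
  shows "exec B (copy k l t) (conf w u s) (conf w u (s(l := s k, t := 0)))"
proof -
  define s1 where "s1 = s(l := 0, t := 0)"
  have "\<exists>u' s'. exec B (Loop k (Seq (inc l) (inc t))) (conf w u s1) (conf w u' s') \<and>
      u' = u \<and> s' = s(l := s k, t := s k, k := s k - s k)"
    using assms
  proof (intro exec_Loop[where J = "\<lambda>i u' s'. u' = u \<and> s' = s(l := i, t := i, k := s k - i)"], goal_cases)
    case (4 i u' s')
    have "exec B (inc l) (conf w u (s(l := i, t := i, k := s k - Suc i)))
      (conf w u (s(l := Suc i, t := i, k := s k - Suc i)))"
      using exec_inc[of l B w u "s(l := i, t := i, k := s k - Suc i)"] 4
      by (auto simp: fun_upd_twist)
    moreover have "exec B (inc t) (conf w u (s(l := Suc i, t := i, k := s k - Suc i)))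
      (conf w u (s(l := Suc i, t := Suc i, k := s k - Suc i)))"
      using exec_inc[of t B w u "s(l := Suc i, t := i, k := s k - Suc i)"] 4
      by (auto simp: fun_upd_twist)
    ultimately show ?case using 4 by (auto intro: exec_Seq)
  qed (auto simp: s1_def)
  then have 1: "exec B (Loop k (Seq (inc l) (inc t))) (conf w u s1) (conf w u (s(l := s k, t := s k, k := 0)))"
    by simp
  have 2: "exec B (transfer t k) (conf w u (s(l := s k, t := s k, k := 0))) (conf w u (s(l := s k, t := 0)))"
    using exec_transfer[of t k B w u "s(l := s k, t := s k, k := 0)"] assms
    by (simp add: fun_upd_twist)
  have 3: "exec B (clear t) (conf w u (s(l := 0))) (conf w u s1)"
    using exec_clear[of t B w u "s(l := 0)"] assms by (simp add: s1_def)
  show ?thesis unfolding copy_def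
    using 1 2 3 exec_clear[of l B w u s] assms by (auto intro: exec_Seq)
qed

text \<open>Writing the question in unary empties \<open>k\<close>, which then collects the answer.
  The answer is erased while it is counted, and \<open>t\<close> counts it a second time so that the
  oracle head can walk back to cell 0; the oracle tape is blank again for the next query.\<close>

definition query :: "nat \<Rightarrow> nat \<Rightarrow> prog" where
  "query k t = Seq (clear t) (Seq (Loop k (Act 1 (\<lambda>a. (1, Go_Right)))) (Seq Ask
     (Seq (While 1 (\<lambda>a. a = 1) (Seq (Act 1 (\<lambda>a. (0, Go_Right))) (Seq (inc k) (inc t))))
       (Loop t (Act 1 (\<lambda>a. (a, Go_Left)))))))"

lemma modest_query [simp]: "modest (query k t)"
  by (simp add: query_def)

lemma exec_query:
  assumes "2 \<le> k" "2 \<le> t" "k \<noteq> t"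
  shows "exec B (query k t) (conf w blank_tape s) (conf w blank_tape (s(k := B (s k), t := 0)))"
proof -
  define s1 where "s1 = s(t := 0)"
  define ones where "ones i j = (if j < i then 1 else 0 :: nat)" for i j :: nat
  have upd: "(ones i)(i := Suc 0) = ones (Suc i)" for i by (auto simp: ones_def fun_eq_iff)
  have ones0: "ones 0 = (\<lambda>j. 0)" by (auto simp: ones_def fun_eq_iff)
  have "\<exists>u' s'. exec B (Loop k (Act 1 (\<lambda>a. (1, Go_Right)))) (conf w blank_tape s1) (conf w u' s') \<and>
      u' = (ones (s k), s k) \<and> s' = s1(k := s k - s k)"
    using assms
  proof (intro exec_Loop[where J = "\<lambda>i u' s'. u' = (ones i, i) \<and> s' = s1(k := s k - i)"], goal_cases)
    case (4 i u' s')
    then show ?case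
      using exec_oracle_tape[of B "\<lambda>a. (1, Go_Right)" w "(ones i, i)" "s1(k := s k - Suc i)"]
      by (auto simp: upd)
  qed (auto simp: s1_def blank_tape_def ones0)
  then have 1: "exec B (Loop k (Act 1 (\<lambda>a. (1, Go_Right)))) (conf w blank_tape s1)
      (conf w (ones (s k), s k) (s1(k := 0)))" by simp
  have qn: "query_number (ones n, n) = n" for n
    unfolding query_number_def by (rule Least_equality) (auto simp: ones_def split: if_splits)
  let ?b = "B (s k)"
  have 2: "exec B Ask (conf w (ones (s k), s k) (s1(k := 0))) (conf w (unary_tape ?b) (s1(k := 0)))"
    by (rule exec_Ask) (auto simp: conf_def qn)
  let ?W = "While 1 (\<lambda>a. a = 1) (Seq (Act 1 (\<lambda>a. (0, Go_Right))) (Seq (inc k) (inc t)))"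
  \<comment> \<open>The unary answer of length \<open>?b\<close> with its first \<open>i\<close>
    ones already erased.\<close>
  define rest where "rest i j = (if i \<le> j \<and> j < ?b then 1 else 0 :: nat)" for i j :: nat
  have rest_upd: "i < ?b \<Longrightarrow> (rest i)(i := 0) = rest (Suc i)" for i
    by (auto simp: rest_def fun_eq_iff)
  have 3: "i \<le> ?b \<Longrightarrow> exec B ?W (conf w (rest i, i) (s1(k := i, t := i)))
      (conf w (rest ?b, ?b) (s1(k := ?b, t := ?b)))" for i
  proof (induction "?b - i" arbitrary: i)
    case 0
    then have "i = ?b" by simp
    then show ?case by (auto intro!: exec_While_done simp: rest_def)
  next
    case (Suc m)
    then have i: "i < ?b" by simp
    have "exec B (Act 1 (\<lambda>a. (0, Go_Right))) (conf w (rest i, i) (s1(k := i, t := i)))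
        (conf w (rest (Suc i), Suc i) (s1(k := i, t := i)))"
      using exec_oracle_tape[of B "\<lambda>a. (0, Go_Right)" w "(rest i, i)" "s1(k := i, t := i)"]
      by (simp add: rest_upd i)
    moreover have "exec B (inc k) (conf w (rest (Suc i), Suc i) (s1(k := i, t := i)))
        (conf w (rest (Suc i), Suc i) (s1(k := Suc i, t := i)))"
      using exec_inc[of k B w "(rest (Suc i), Suc i)" "s1(k := i, t := i)"] assms
      by (simp add: fun_upd_twist)
    moreover have "exec B (inc t) (conf w (rest (Suc i), Suc i) (s1(k := Suc i, t := i)))
        (conf w (rest (Suc i), Suc i) (s1(k := Suc i, t := Suc i)))"
      using exec_inc[of t B w "(rest (Suc i), Suc i)" "s1(k := Suc i, t := i)"] assms
      by simp
    ultimately have body: "exec B (Seq (Act 1 (\<lambda>a. (0, Go_Right))) (Seq (inc k) (inc t)))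
        (conf w (rest i, i) (s1(k := i, t := i)))
        (conf w (rest (Suc i), Suc i) (s1(k := Suc i, t := Suc i)))"
      by (intro exec_Seq)
    have loop: "exec B ?W (conf w (rest (Suc i), Suc i) (s1(k := Suc i, t := Suc i)))
      (conf w (rest ?b, ?b) (s1(k := ?b, t := ?b)))"
      using Suc by (intro Suc.hyps(1)) auto
    show ?case
      by (rule exec_While_step[OF _ body loop]) (use i in \<open>simp add: rest_def\<close>)
  qed
  have r0: "unary_tape ?b = (rest 0, 0)" by (simp add: unary_tape_def rest_def fun_eq_iff)
  have s10: "s1(k := 0) = s1(k := 0, t := 0)" using assms by (auto simp: s1_def)
  have rb: "rest ?b = (\<lambda>j. 0)" by (auto simp: rest_def fun_eq_iff)
  have z: "(\<lambda>j. 0)(i := 0) = (\<lambda>j. 0 :: nat)" for i :: nat by auto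
  let ?s = "s1(k := ?b, t := ?b)"
  have "\<exists>u' s'. exec B (Loop t (Act 1 (\<lambda>a. (a, Go_Left)))) (conf w (rest ?b, ?b) ?s) (conf w u' s') \<and>
      u' = (\<lambda>j. 0, ?b - ?b) \<and> s' = ?s(t := ?b - ?b)"
    using assms
  proof (intro exec_Loop[where J = "\<lambda>i u' s'. u' = (\<lambda>j. 0, ?b - i) \<and> s' = ?s(t := ?b - i)"], goal_cases)
    case (4 i u' s')
    then show ?case
      using exec_oracle_tape[of B "\<lambda>a. (a, Go_Left)" w "(\<lambda>j. 0, ?b - i)" "?s(t := ?b - Suc i)"] z
      by auto
  qed (auto simp: rb)
  then have 4: "exec B (Loop t (Act 1 (\<lambda>a. (a, Go_Left)))) (conf w (rest ?b, ?b) ?s)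
      (conf w blank_tape (s(k := ?b, t := 0)))"
    using assms by (simp add: blank_tape_def s1_def fun_upd_twist)
  have 5: "exec B ?W (conf w (unary_tape ?b) (s1(k := 0))) (conf w (rest ?b, ?b) ?s)"
    using 3[of 0] by (simp add: s10[symmetric] r0)
  have 6: "exec B (clear t) (conf w blank_tape s) (conf w blank_tape s1)"
    using exec_clear[of t B w blank_tape s] assms by (simp add: s1_def)
  show ?thesis unfolding query_def
    by (rule exec_Seq[OF 6 exec_Seq[OF 1 exec_Seq[OF 2 exec_Seq[OF 5 4]]]])
qed

text \<open>A calling convention: variable \<open>v\<close> is kept in register
  \<open>\<rho> v\<close>, register \<open>n\<close> receives the result whatever it held before,
  those below \<open>n\<close> survive (register 0 is the head on the input tape), and those above
  \<open>n\<close> are scratch. The oracle tape is blank between calls.\<close>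

definition evaluates :: "prog \<Rightarrow> nat \<Rightarrow> (nat \<Rightarrow> nat) \<Rightarrow>
    ((nat \<Rightarrow> nat) \<Rightarrow> (nat \<Rightarrow> nat) \<Rightarrow> nat) \<Rightarrow> bool" where
  "evaluates c n \<rho> F \<longleftrightarrow> modest c \<and> (\<forall>B w s. \<exists>s'. exec B c (conf w blank_tape s) (conf w blank_tape s') \<and>
     (\<forall>r<n. s' r = s r) \<and> s' n = F B (\<lambda>v. s (\<rho> v)))"

text \<open>All register layouts are allowed, so that a function can be called from inside any other
  program. The program is uniform in the oracle.\<close>

definition computable :: "((nat \<Rightarrow> nat) \<Rightarrow> (nat \<Rightarrow> nat) \<Rightarrow> nat) \<Rightarrow> bool" where
  "computable F \<longleftrightarrow> (\<forall>\<rho> n. (\<forall>v. 2 \<le> \<rho> v \<and> \<rho> v < n) \<longrightarrow> (\<exists>c. evaluates c n \<rho> F))"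

lemma computableI:
  assumes "\<And>\<rho> n. (\<And>v. 2 \<le> \<rho> v \<and> \<rho> v < n) \<Longrightarrow> 2 < n \<Longrightarrow> \<exists>c. evaluates c n \<rho> F"
  shows "computable F"
  unfolding computable_def using assms
  by (metis le_less_trans)

lemma computableD:
  assumes "computable F" "\<And>v. 2 \<le> \<rho> v \<and> \<rho> v < n"
  shows "\<exists>c. evaluates c n \<rho> F"
  using assms unfolding computable_def by blast

lemma evaluatesD:
  assumes "evaluates c n \<rho> F"
  shows "\<exists>s'. exec B c (conf w blank_tape s) (conf w blank_tape s') \<and> (\<forall>r<n. s' r = s r) \<and>
    s' n = F B (\<lambda>v. s (\<rho> v))"
  using assms unfolding evaluates_def by blast

lemma evaluatesI:
  assumes "modest c" "\<And>B w s. \<exists>s'. exec B c (conf w blank_tape s) (conf w blank_tape s') \<and>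
     (\<forall>r<n. s' r = s r) \<and> s' n = F B (\<lambda>v. s (\<rho> v))"
  shows "\<exists>c. evaluates c n \<rho> F"
  using assms unfolding evaluates_def by blast

section \<open>Basic functions and closure under composition and recursion\<close>

lemma computable_var: "computable (\<lambda>B e. e x)"
proof (rule computableI)
  fix \<rho> :: "nat \<Rightarrow> nat" and n :: nat
  assume \<rho>: "\<And>v. 2 \<le> \<rho> v \<and> \<rho> v < n" and n: "2 < n"
  have *: "\<exists>s'. exec B (copy (\<rho> x) n (Suc n)) (conf w blank_tape s) (conf w blank_tape s') \<and>
     (\<forall>r<n. s' r = s r) \<and> s' n = s (\<rho> x)" for B w s
    by (rule exI, rule conjI, rule exec_copy[of "\<rho> x" n "Suc n"]) (use \<rho>[of x] n in auto)
  show "\<exists>c. evaluates c n \<rho> (\<lambda>B e. e x)" by (rule evaluatesI) (rule modest_simps *)+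
qed

lemma computable_zero: "computable (\<lambda>B e. 0)"
proof (rule computableI)
  fix \<rho> :: "nat \<Rightarrow> nat" and n :: nat
  assume n: "2 < n"
  have *: "\<exists>s'. exec B (clear n) (conf w blank_tape s) (conf w blank_tape s') \<and>
     (\<forall>r<n. s' r = s r) \<and> s' n = 0" for B w s
    by (rule exI, rule conjI, rule exec_clear) (use n in auto)
  show "\<exists>c. evaluates c n \<rho> (\<lambda>B e. 0)" by (rule evaluatesI) (rule modest_simps *)+
qed

lemma computable_Suc:
  assumes "computable f"
  shows "computable (\<lambda>B e. Suc (f B e))"
proof (rule computableI)
  fix \<rho> :: "nat \<Rightarrow> nat" and n :: nat
  assume \<rho>: "\<And>v. 2 \<le> \<rho> v \<and> \<rho> v < n" and n: "2 < n"
  obtain c where c: "evaluates c n \<rho> f" using computableD[OF assms, OF \<rho>] by (rule exE)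
  have *: "\<exists>s'. exec B (Seq c (inc n)) (conf w blank_tape s) (conf w blank_tape s') \<and>
     (\<forall>r<n. s' r = s r) \<and> s' n = Suc (f B (\<lambda>v. s (\<rho> v)))" for B w s
  proof -
    obtain s' where s': "exec B c (conf w blank_tape s) (conf w blank_tape s')" "\<And>r. r < n \<Longrightarrow> s' r = s r"
      "s' n = f B (\<lambda>v. s (\<rho> v))" using evaluatesD[OF c, of B w "s"] by blast
    show ?thesis
      by (rule exI[of _ "s'(n := Suc (s' n))"], intro conjI, rule exec_Seq[OF s'(1) exec_inc])
        (use s'(2,3) n in simp_all)
  qed
  have m: "modest (Seq c (inc n))" using c by (simp add: evaluates_def)
  show "\<exists>c. evaluates c n \<rho> (\<lambda>B e. Suc (f B e))"
    by (rule evaluatesI) (rule m *)+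
qed

lemma computable_query:
  assumes "computable f"
  shows "computable (\<lambda>B e. B (f B e))"
proof (rule computableI)
  fix \<rho> :: "nat \<Rightarrow> nat" and n :: nat
  assume \<rho>: "\<And>v. 2 \<le> \<rho> v \<and> \<rho> v < n" and n: "2 < n"
  obtain c where c: "evaluates c n \<rho> f" using computableD[OF assms, OF \<rho>] by (rule exE)
  have *: "\<exists>s'. exec B (Seq c (query n (Suc n))) (conf w blank_tape s) (conf w blank_tape s') \<and>
     (\<forall>r<n. s' r = s r) \<and> s' n = B (f B (\<lambda>v. s (\<rho> v)))" for B w s
  proof -
    obtain s' where s': "exec B c (conf w blank_tape s) (conf w blank_tape s')" "\<And>r. r < n \<Longrightarrow> s' r = s r"
      "s' n = f B (\<lambda>v. s (\<rho> v))" using evaluatesD[OF c, of B w "s"] by blast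
    show ?thesis
      by (rule exI[of _ "s'(n := B (s' n), Suc n := 0)"], intro conjI,
          rule exec_Seq[OF s'(1) exec_query]) (use s'(2,3) n in simp_all)
  qed
  have m: "modest (Seq c (query n (Suc n)))" using c by (simp add: evaluates_def)
  show "\<exists>c. evaluates c n \<rho> (\<lambda>B e. B (f B e))"
    by (rule evaluatesI) (rule m *)+
qed

lemma computable_rename:
  assumes "computable f"
  shows "computable (\<lambda>B e. f B (\<lambda>v. e (g v)))"
proof (rule computableI)
  fix \<rho> :: "nat \<Rightarrow> nat" and n :: nat
  assume \<rho>: "\<And>v. 2 \<le> \<rho> v \<and> \<rho> v < n" and n: "2 < n"
  obtain c where c: "evaluates c n (\<lambda>v. \<rho> (g v)) f"
    using computableD[OF assms, of "\<lambda>v. \<rho> (g v)"] \<rho> by metis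
  then show "\<exists>c. evaluates c n \<rho> (\<lambda>B e. f B (\<lambda>v. e (g v)))"
    by (auto simp: evaluates_def)
qed

lemma case_nat_regs: "(\<lambda>v. s (case_nat a \<rho> v)) = case_nat (s a) (\<lambda>v. s (\<rho> v))"
  by (auto simp: fun_eq_iff split: nat.splits)

text \<open>Local definition in de Bruijn style: the value of \<open>f\<close> becomes variable 0
  and the old variables move up by one. Composition is derived from it in
  \<open>computable_lift1\<close> and \<open>computable_lift2\<close>.\<close>

lemma computable_let:
  assumes "computable f" "computable h"
  shows "computable (\<lambda>B e. h B (case_nat (f B e) e))"
proof (rule computableI)
  fix \<rho> :: "nat \<Rightarrow> nat" and n :: nat
  assume \<rho>: "\<And>v. 2 \<le> \<rho> v \<and> \<rho> v < n" and n: "2 < n"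
  obtain c where c: "evaluates c n \<rho> f" using computableD[OF assms(1), OF \<rho>] by (rule exE)
  have \<rho>': "2 \<le> case_nat n \<rho> v \<and> case_nat n \<rho> v < Suc n" for v
    using \<rho> n by (auto split: nat.splits intro: less_SucI)
  obtain d where d: "evaluates d (Suc n) (case_nat n \<rho>) h"
    using computableD[OF assms(2), OF \<rho>'] by (rule exE)
  let ?p = "Seq c (Seq d (Seq (clear n) (transfer (Suc n) n)))"
  have *: "\<exists>s'. exec B ?p (conf w blank_tape s) (conf w blank_tape s') \<and>
     (\<forall>r<n. s' r = s r) \<and> s' n = h B (case_nat (f B (\<lambda>v. s (\<rho> v))) (\<lambda>v. s (\<rho> v)))" for B w s
  proof -
    obtain s1 where s1: "exec B c (conf w blank_tape s) (conf w blank_tape s1)" "\<And>r. r < n \<Longrightarrow> s1 r = s r"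
      "s1 n = f B (\<lambda>v. s (\<rho> v))" using evaluatesD[OF c, of B w "s"] by blast
    obtain s2 where s2: "exec B d (conf w blank_tape s1) (conf w blank_tape s2)" "\<And>r. r < Suc n \<Longrightarrow> s2 r = s1 r"
      "s2 (Suc n) = h B (\<lambda>v. s1 (case_nat n \<rho> v))" using evaluatesD[OF d, of B w "s1"] by blast
    have s1\<rho>: "(\<lambda>v. s1 (\<rho> v)) = (\<lambda>v. s (\<rho> v))" using s1 \<rho> by auto
    have "exec B (clear n) (conf w blank_tape s2) (conf w blank_tape (s2(n := 0)))"
      using exec_clear n by simp
    moreover have "exec B (transfer (Suc n) n) (conf w blank_tape (s2(n := 0)))
        (conf w blank_tape (s2(n := s2 (Suc n), Suc n := 0)))"
      using exec_transfer[of "Suc n" n B w blank_tape "s2(n := 0)"] n by simp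
    ultimately have "exec B ?p (conf w blank_tape s) (conf w blank_tape (s2(n := s2 (Suc n), Suc n := 0)))"
      using s1(1) s2(1) by (intro exec_Seq)
    then show ?thesis
      by (rule_tac exI, rule_tac conjI, assumption)
        (use s1(2,3) s2(2,3) s1\<rho> case_nat_regs[of s1 n \<rho>] in auto)
  qed
  have m: "modest ?p" using c d by (simp add: evaluates_def)
  show "\<exists>c. evaluates c n \<rho> (\<lambda>B e. h B (case_nat (f B e) e))"
    by (rule evaluatesI) (rule m *)+
qed

text \<open>Primitive recursion; \<open>h\<close> finds the previous value in variable 0 and the
  index in variable 1. Register \<open>n\<close> counts the remaining rounds down, so a second
  register counts up to supply the index.\<close>

lemma computable_rec:
  assumes "computable a" "computable h" "computable t"
  shows "computable (\<lambda>B e. rec_nat (a B e) (\<lambda>i x. h B (case_nat x (case_nat i e))) (t B e))"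
proof (rule computableI)
  fix \<rho> :: "nat \<Rightarrow> nat" and n :: nat
  assume \<rho>: "\<And>v. 2 \<le> \<rho> v \<and> \<rho> v < n" and n: "2 < n"
  have \<rho>': "2 \<le> \<rho> v \<and> \<rho> v < Suc n" for v using \<rho>[of v] by auto
  obtain ct where ct: "evaluates ct n \<rho> t" using computableD[OF assms(3), OF \<rho>] by (rule exE)
  obtain ca where ca: "evaluates ca (Suc n) \<rho> a" using computableD[OF assms(1), OF \<rho>'] by (rule exE)
  let ?x = "Suc n" and ?i = "Suc (Suc n)" and ?z = "Suc (Suc (Suc n))"
  let ?\<rho> = "case_nat ?x (case_nat ?i \<rho>)"
  have \<rho>'': "2 \<le> ?\<rho> v \<and> ?\<rho> v < ?z" for v
    using \<rho> n by (auto split: nat.splits intro: less_SucI)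
  obtain ch where ch: "evaluates ch ?z ?\<rho> h" using computableD[OF assms(2), OF \<rho>''] by (rule exE)
  let ?b = "Seq ch (Seq (clear ?x) (Seq (transfer ?z ?x) (inc ?i)))"
  let ?p = "Seq ct (Seq ca (Seq (clear ?i) (Seq (Loop n ?b) (transfer ?x n))))"
  have *: "\<exists>s'. exec B ?p (conf w blank_tape s) (conf w blank_tape s') \<and> (\<forall>r<n. s' r = s r) \<and>
      s' n = (\<lambda>e. rec_nat (a B e) (\<lambda>i x. h B (case_nat x (case_nat i e))) (t B e)) (\<lambda>v. s (\<rho> v))" for B w s
  proof -
    let ?e = "\<lambda>v. s (\<rho> v)"
    let ?r = "rec_nat (a B ?e) (\<lambda>i x. h B (case_nat x (case_nat i ?e)))"
    obtain s1 where s1: "exec B ct (conf w blank_tape s) (conf w blank_tape s1)" "\<And>r. r < n \<Longrightarrow> s1 r = s r"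
      "s1 n = t B ?e" using evaluatesD[OF ct, of B w "s"] by blast
    obtain s2 where s2: "exec B ca (conf w blank_tape s1) (conf w blank_tape s2)" "\<And>r. r < ?x \<Longrightarrow> s2 r = s1 r"
      "s2 ?x = a B (\<lambda>v. s1 (\<rho> v))" using evaluatesD[OF ca, of B w "s1"] by blast
    have \<rho>_eq: "(\<lambda>v. s' (\<rho> v)) = ?e" if "\<forall>r<n. s' r = s r" for s' :: "nat \<Rightarrow> nat" using that \<rho> by auto
    define s3 where "s3 = s2(?i := 0)"
    have e3: "exec B (clear ?i) (conf w blank_tape s2) (conf w blank_tape s3)"
      unfolding s3_def using exec_clear n by simp
    let ?t = "t B ?e"
    let ?J = "\<lambda>i u s'. u = blank_tape \<and> (\<forall>r<n. s' r = s r) \<and> s' n = ?t - i \<and> s' ?x = ?r i \<and> s' ?i = i"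
    have "\<exists>u' s'. exec B (Loop n ?b) (conf w blank_tape s3) (conf w u' s') \<and> ?J ?t u' s'"
    proof (rule exec_Loop[where J = ?J and n = ?t])
      show "?J 0 blank_tape s3" using s1 s2 \<rho>_eq[of s1] n by (simp add: s3_def)
    next
      fix i u s' assume "i < ?t" and J: "?J i u s'"
      let ?s = "s'(n := ?t - Suc i)"
      obtain s4 where s4: "exec B ch (conf w blank_tape ?s) (conf w blank_tape s4)" "\<And>r. r < ?z \<Longrightarrow> s4 r = ?s r"
        "s4 ?z = h B (\<lambda>v. ?s (?\<rho> v))" using evaluatesD[OF ch, of B w "?s"] by blast
      have "(\<lambda>v. ?s (?\<rho> v)) = case_nat (?r i) (case_nat i ?e)"
        unfolding case_nat_regs[of ?s ?x "case_nat ?i \<rho>"] case_nat_regs[of ?s ?i \<rho>]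
        using J \<rho>_eq[of ?s] by simp
      then have z: "s4 ?z = ?r (Suc i)" using s4 by simp
      let ?s5 = "s4(?x := ?r (Suc i), ?z := 0)"
      have "exec B (clear ?x) (conf w blank_tape s4) (conf w blank_tape (s4(?x := 0)))"
        using exec_clear n by simp
      moreover have "exec B (transfer ?z ?x) (conf w blank_tape (s4(?x := 0))) (conf w blank_tape ?s5)"
        using exec_transfer[of ?z ?x B w blank_tape "s4(?x := 0)"] n z by simp
      moreover have "exec B (inc ?i) (conf w blank_tape ?s5) (conf w blank_tape (?s5(?i := Suc i)))"
        using exec_inc[of ?i B w blank_tape ?s5] n s4(2)[of ?i] J by simp
      ultimately have "exec B ?b (conf w blank_tape ?s) (conf w blank_tape (?s5(?i := Suc i)))"
        using s4(1) by (intro exec_Seq)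
      then show "\<exists>u' s''. exec B ?b (conf w u ?s) (conf w u' s'') \<and> ?J (Suc i) u' s''"
        using J s4(2) by (intro exI[of _ blank_tape] exI[of _ "?s5(?i := Suc i)"] conjI) simp_all
    qed (use n in auto)
    then obtain s6 where s6: "exec B (Loop n ?b) (conf w blank_tape s3) (conf w blank_tape s6)"
      "\<forall>r<n. s6 r = s r" "s6 n = 0" "s6 ?x = ?r ?t" by (elim exE conjE) simp
    have "exec B (transfer ?x n) (conf w blank_tape s6) (conf w blank_tape (s6(n := ?r ?t, ?x := 0)))"
      using exec_transfer[of ?x n B w blank_tape s6] n s6 by simp
    then have "exec B ?p (conf w blank_tape s) (conf w blank_tape (s6(n := ?r ?t, ?x := 0)))"
      using s1(1) s2(1) e3 s6(1) by (intro exec_Seq)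
    then show ?thesis by (rule_tac exI, rule_tac conjI, assumption) (use s6(2-4) in auto)
  qed
  have m: "modest ?p" using ct ca ch by (simp add: evaluates_def)
  show "\<exists>c. evaluates c n \<rho>
      (\<lambda>B e. rec_nat (a B e) (\<lambda>i x. h B (case_nat x (case_nat i e))) (t B e))"
    by (rule evaluatesI) (rule m *)+
qed

section \<open>Computable functions of an oracle\<close>

lemma computable_lift1:
  assumes "computable (\<lambda>B e. F (e 0))" "computable f"
  shows "computable (\<lambda>B e. F (f B e))"
  using computable_let[OF assms(2,1)] by simp

lemma computable_lift2:
  assumes "computable (\<lambda>B e. F (e 0) (e (Suc 0)))" "computable f" "computable g"
  shows "computable (\<lambda>B e. F (f B e) (g B e))"
proof -
  \<comment> \<open>With \<open>f\<close> bound first and \<open>g\<close> second, the value of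
    \<open>g\<close> is variable 0 and that of \<open>f\<close> is variable 1, hence the
    swap.\<close>
  have "computable (\<lambda>B e. F (e (Suc 0)) (e 0))"
    using computable_rename[OF assms(1), of "\<lambda>v. if v = 0 then Suc 0 else 0"] by simp
  from computable_let[OF computable_rename[OF assms(3), of Suc] this]
  have "computable (\<lambda>B e. F (e 0) (g B (\<lambda>v. e (Suc v))))" by simp
  from computable_let[OF assms(2) this] show ?thesis by simp
qed

lemma computable_const: "computable (\<lambda>B e. n)"
  by (induction n) (auto intro: computable_zero computable_Suc)

lemma computable_add:
  assumes "computable f" "computable g"
  shows "computable (\<lambda>B e. f B e + g B e)"
proof (rule computable_lift2[OF _ assms, where F = "(+)"])
  have *: "rec_nat a (\<lambda>i x. Suc x) n = a + n" for a n by (induction n) auto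
  show "computable (\<lambda>B e. e 0 + e (Suc 0))"
    using computable_rec[OF computable_var[of 0] computable_Suc[OF computable_var[of 0]] computable_var[of "Suc 0"]]
    by (simp add: *)
qed

lemma computable_mult:
  assumes "computable f" "computable g"
  shows "computable (\<lambda>B e. f B e * g B e)"
proof (rule computable_lift2[OF _ assms, where F = "(*)"])
  have *: "rec_nat 0 (\<lambda>i x. x + a) n = a * n" for a n :: nat by (induction n) auto
  show "computable (\<lambda>B e. e 0 * e (Suc 0))"
    using computable_rec[OF computable_zero
        computable_add[OF computable_var[of 0] computable_var[of "Suc (Suc 0)"]] computable_var[of "Suc 0"]]
    by (simp add: *)
qed

lemma computable_diff:
  assumes "computable f" "computable g"
  shows "computable (\<lambda>B e. f B e - g B e)"
proof (rule computable_lift2[OF _ assms, where F = "(-)"])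
  \<comment> \<open>The predecessor, as the index of the last round of a recursion.\<close>
  have *: "rec_nat 0 (\<lambda>i x. i) n = n - 1" for n by (cases n) auto
  have "computable (\<lambda>B e. e 0 - 1)"
    using computable_rec[OF computable_zero computable_var[of "Suc 0"] computable_var[of 0]] by (simp add: *)
  moreover have **: "rec_nat a (\<lambda>i x. x - 1) n = a - n" for a n :: nat by (induction n) auto
  ultimately show "computable (\<lambda>B e. e 0 - e (Suc 0))"
    using computable_rec[OF computable_var[of 0] _ computable_var[of "Suc 0"], of "\<lambda>B e. e 0 - 1"]
    by (simp add: **[simplified])
qed

section \<open>Decidable predicates and bounded quantifiers\<close>

definition decidable :: "((nat \<Rightarrow> nat) \<Rightarrow> (nat \<Rightarrow> nat) \<Rightarrow> bool) \<Rightarrow> bool" where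
  "decidable P \<longleftrightarrow> computable (\<lambda>B e. of_bool (P B e))"

lemma decidable_not:
  assumes "decidable P"
  shows "decidable (\<lambda>B e. \<not> P B e)"
proof -
  have *: "of_bool (\<not> p) = 1 - (of_bool p :: nat)" for p by simp
  show ?thesis
    using assms unfolding decidable_def * by (rule computable_diff[OF computable_const])
qed

lemma decidable_conj: "decidable P \<Longrightarrow> decidable Q \<Longrightarrow> decidable (\<lambda>B e. P B e \<and> Q B e)"
  unfolding decidable_def of_bool_conj by (rule computable_mult)

lemma decidable_disj: "decidable P \<Longrightarrow> decidable Q \<Longrightarrow> decidable (\<lambda>B e. P B e \<or> Q B e)"
  using decidable_not[OF decidable_conj[OF decidable_not[of P] decidable_not[of Q]]] by simp

lemma decidable_less:
  assumes "computable f" "computable g"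
  shows "decidable (\<lambda>B e. f B e < g B e)"
proof -
  have *: "of_bool (a < b) = 1 - (1 - (b - a))" for a b :: nat by (auto simp: of_bool_def)
  show ?thesis unfolding decidable_def * by (intro computable_diff computable_const assms)
qed

lemma decidable_eq:
  assumes "computable f" "computable g"
  shows "decidable (\<lambda>B e. f B e = g B e)"
proof -
  have *: "a = b \<longleftrightarrow> \<not> a < b \<and> \<not> b < a" for a b :: nat by auto
  show ?thesis unfolding * by (intro decidable_conj decidable_not decidable_less assms)
qed

lemma decidable_ball:
  assumes "computable t" "decidable P"
  shows "decidable (\<lambda>B e. \<forall>i<t B e. P B (e(x := i)))"
proof -
  \<comment> \<open>Formulas bind named variables, while recursion is positional: \<open>g\<close>
    sends \<open>x\<close> to the index of the recursion (variable 1) and skips the two new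
    variables for all others. The truth value is then computed as a product.\<close>
  define g where "g v = (if v = x then Suc 0 else Suc (Suc v))" for v
  define h where "h B e = of_bool (P B (\<lambda>v. e (g v))) * e 0" for B e
  have h: "computable h"
    unfolding h_def using assms(2)[unfolded decidable_def, THEN computable_rename, of g]
    by (rule computable_mult[OF _ computable_var])
  have g: "(\<lambda>v. case_nat y (case_nat i e) (g v)) = e(x := i)" for y i e
    by (auto simp: g_def fun_eq_iff)
  have "rec_nat 1 (\<lambda>i y. of_bool (Q i) * y) n = (of_bool (\<forall>i<n. Q i) :: nat)" for Q n
    by (induction n) (auto simp: less_Suc_eq)
  then show ?thesis
    using computable_rec[OF computable_const[of 1] h assms(1)] unfolding decidable_def h_def g by simp
qed

lemma decidable_bex:
  assumes "computable t" "decidable P"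
  shows "decidable (\<lambda>B e. \<exists>i<t B e. P B (e(x := i)))"
  using decidable_not[OF decidable_ball[OF assms(1) decidable_not[OF assms(2)], of x]] by simp

lemma computable_sum:
  "finite I \<Longrightarrow> (\<And>i. i \<in> I \<Longrightarrow> computable (f i)) \<Longrightarrow> computable (\<lambda>B e. \<Sum>i\<in>I. f i B e)"
  by (induction I rule: finite_induct) (auto intro: computable_zero computable_add)

section \<open>Bit tests, powers of two and pairing\<close>

lemma decidable_odd:
  assumes "computable f"
  shows "decidable (\<lambda>B e. odd (f B e))"
proof -
  have *: "rec_nat 0 (\<lambda>i x. 1 - x) n = (of_bool (odd n) :: nat)" for n :: nat by (induction n) auto
  have "computable (\<lambda>B e. of_bool (odd (e 0)))"
    using computable_rec[OF computable_zero computable_diff[OF computable_const[of 1] computable_var[of 0]]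
        computable_var[of 0]] *[simplified] by simp
  from computable_lift1[OF this assms] show ?thesis by (simp add: decidable_def)
qed

lemma computable_half:
  assumes "computable f"
  shows "computable (\<lambda>B e. f B e div 2)"
proof -
  have *: "rec_nat 0 (\<lambda>i x. x + of_bool (odd i)) n = n div 2" for n :: nat by (induction n) auto
  have "computable (\<lambda>B e. e 0 div 2)"
    using computable_rec[OF computable_zero computable_add[OF computable_var[of 0]
          decidable_odd[OF computable_var[of "Suc 0"], unfolded decidable_def]] computable_var[of 0]] * by simp
  from computable_lift1[OF this assms] show ?thesis by simp
qed

lemma computable_shift:
  assumes "computable f" "computable g"
  shows "computable (\<lambda>B e. f B e div 2 ^ g B e)"
proof (rule computable_lift2[OF _ assms, where F = "\<lambda>a n. a div 2 ^ n"])
  have *: "rec_nat a (\<lambda>i x. x div 2) n = a div 2 ^ n" for a n :: nat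
    by (induction n) (auto simp: mult.commute simp flip: div_mult2_eq)
  show "computable (\<lambda>B e. e 0 div 2 ^ e (Suc 0))"
    using computable_rec[OF computable_var[of 0] computable_half[OF computable_var[of 0]] computable_var[of "Suc 0"]] *
    by simp
qed

lemma computable_power2:
  assumes "computable f"
  shows "computable (\<lambda>B e. 2 ^ f B e)"
proof -
  have *: "rec_nat 1 (\<lambda>i x. x + x) n = (2 ^ n :: nat)" for n by (induction n) auto
  have "computable (\<lambda>B e. 2 ^ e 0)"
    using computable_rec[OF computable_const[of 1] computable_add[OF computable_var[of 0] computable_var[of 0]]
        computable_var[of 0]] *[simplified] by simp
  from computable_lift1[OF this assms] show ?thesis by simp
qed

lemma decidable_set_decode:
  assumes "computable f" "computable g"
  shows "decidable (\<lambda>B e. f B e \<in> set_decode (g B e))"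
  unfolding set_decode_def mem_Collect_eq by (intro decidable_odd computable_shift assms)

lemma computable_prod_encode:
  assumes "computable f" "computable g"
  shows "computable (\<lambda>B e. prod_encode (f B e, g B e))"
proof -
  have *: "rec_nat 0 (\<lambda>i x. x + Suc i) n = triangle n" for n by (induction n) auto
  have "computable (\<lambda>B e. triangle (e 0))"
    using computable_rec[OF computable_zero computable_add[OF computable_var[of 0]
        computable_Suc[OF computable_var[of "Suc 0"]]] computable_var[of 0]] *[simplified] by simp
  from computable_lift1[OF this computable_add[OF assms]]
  show ?thesis unfolding prod_encode_def by (auto intro: computable_add assms)
qed

lemma computable_eval_term:
  "(\<And>v. computable (\<lambda>B e. e (g v))) \<Longrightarrow> computable (\<lambda>B e. eval_term (\<lambda>v. e (g v)) t)"
  by (induction t) (auto intro: computable_add computable_mult computable_zero computable_const[of 1, simplified])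

section \<open>Finite approximations of formulas\<close>

lemma finite_term_vars: "finite (term_vars t)"
  by (induction t) auto

lemma finite_free_num: "finite (free_num \<phi>)"
  by (induction \<phi>) (auto simp: finite_term_vars)

lemma eval_term_cong: "(\<And>i. i \<in> term_vars t \<Longrightarrow> e i = e' i) \<Longrightarrow> eval_term e t = eval_term e' t"
  by (induction t) auto

lemma sat_cong: "\<forall>i\<in>free_num \<phi>. e i = e' i \<Longrightarrow> sat e V \<phi> \<longleftrightarrow> sat e' V \<phi>"
proof (induction \<phi> arbitrary: e e' V)
  case (Eq s t)
  then have "eval_term e s = eval_term e' s" "eval_term e t = eval_term e' t"
    by (auto intro: eval_term_cong)
  then show ?case by simp
next
  case (Less s t)
  then have "eval_term e s = eval_term e' s" "eval_term e t = eval_term e' t"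
    by (auto intro: eval_term_cong)
  then show ?case by simp
next
  case (Mem t X)
  then have "eval_term e t = eval_term e' t" by (auto intro: eval_term_cong)
  then show ?case by simp
next
  case (Neg \<phi>)
  have "sat e V \<phi> \<longleftrightarrow> sat e' V \<phi>" by (rule Neg.IH) (use Neg.prems in simp)
  then show ?case by simp
next
  case (Conj \<phi> \<psi>)
  have "sat e V \<phi> \<longleftrightarrow> sat e' V \<phi>" by (rule Conj.IH(1)) (use Conj.prems in simp)
  moreover have "sat e V \<psi> \<longleftrightarrow> sat e' V \<psi>" by (rule Conj.IH(2)) (use Conj.prems in simp)
  ultimately show ?case by simp
next
  case (All_num x \<phi>)
  have "sat (e(x := n)) V \<phi> \<longleftrightarrow> sat (e'(x := n)) V \<phi>" for n
    by (rule All_num.IH) (use All_num.prems in simp)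
  then show ?case by simp
next
  case (All_set X \<phi>)
  have "sat e (V(X := Y)) \<phi> \<longleftrightarrow> sat e' (V(X := Y)) \<phi>" for Y
    by (rule All_set.IH) (use All_set.prems in simp)
  then show ?case by simp
qed

text \<open>
  The formula holds (for \<open>p = True\<close>) or fails (for \<open>p = False\<close>) as far as can be seen at stage \<open>d\<close>:
  numbers from \<open>d\<close> on are not considered as elements of the sets nor as counterexamples, while
  witnesses are sought below the oracle value at the number \<open>s\<close> plus the current values of the
  free variables. All set variables are packed into the single set \<open>X\<close>.
\<close>

fun approx :: "(nat \<Rightarrow> nat) \<Rightarrow> nat \<Rightarrow> nat \<Rightarrow> nat set \<Rightarrow> bool \<Rightarrow> (nat \<Rightarrow> nat) \<Rightarrow> form \<Rightarrow> bool" where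
  "approx B s d X p e (Eq a b) \<longleftrightarrow> (eval_term e a = eval_term e b) = p"
| "approx B s d X p e (Less a b) \<longleftrightarrow> (eval_term e a < eval_term e b) = p"
| "approx B s d X p e (Mem t j) \<longleftrightarrow>
     \<not> prod_encode (eval_term e t, j) < d \<or> (prod_encode (eval_term e t, j) \<in> X) = p"
| "approx B s d X p e (Neg \<phi>) \<longleftrightarrow> approx B s d X (\<not> p) e \<phi>"
| "approx B s d X p e (Conj \<phi> \<psi>) \<longleftrightarrow>
     (if p then approx B s d X p e \<phi> \<and> approx B s d X p e \<psi>
      else approx B s d X p e \<phi> \<or> approx B s d X p e \<psi>)"
| "approx B s d X p e (All_num x \<phi>) \<longleftrightarrow>
     (if p then \<forall>n<d. approx B s d X p (e(x := n)) \<phi>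
      else \<exists>n<Suc (B (s + (\<Sum>i\<in>free_num (All_num x \<phi>). e i))). approx B s d X p (e(x := n)) \<phi>)"
| "approx B s d X p e (All_set Y \<phi>) \<longleftrightarrow> True"

text \<open>Variables 0, 1 and 2 hold the number, the stage and the code of a finite set, so those
  of the formula are moved up by 3.\<close>

lemma decidable_approx:
  "arithmetical \<phi> \<Longrightarrow> decidable (\<lambda>B E. approx B (E 0) (E 1) (set_decode (E 2)) p (\<lambda>v. E (v + 3)) \<phi>)"
proof (induction \<phi> arbitrary: p)
  have eqp: "decidable P \<Longrightarrow> decidable (\<lambda>B E. P B E = q)" for P q
    by (cases q) (auto intro: decidable_not)
  {
    case (Eq s t)
    show ?case unfolding approx.simps
      by (intro eqp decidable_eq computable_eval_term computable_var)
  next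
    case (Less s t)
    show ?case unfolding approx.simps
      by (intro eqp decidable_less computable_eval_term computable_var)
  next
    case (Mem t j)
    show ?case unfolding approx.simps
      by (intro eqp decidable_disj decidable_not decidable_less decidable_set_decode
          computable_prod_encode computable_const computable_eval_term computable_var)
  next
    case (Neg \<phi>)
    then show ?case by simp
  next
    case (Conj \<phi> \<psi>)
    then show ?case by (cases p) (auto intro: decidable_conj decidable_disj)
  next
    case (All_num x \<phi>)
    have upd: "(\<lambda>v. (E(x + 3 := i)) (v + 3)) = (\<lambda>v. E (v + 3))(x := i)" for E :: "nat \<Rightarrow> nat" and i
      by auto
    have fix_upd: "(E(x + 3 := i)) 0 = E 0" "(E(x + 3 := i)) 1 = E 1" "(E(x + 3 := i)) 2 = E 2"
      for E :: "nat \<Rightarrow> nat" and i by auto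
    let ?P = "\<lambda>p B E. approx B (E 0) (E 1) (set_decode (E 2)) p (\<lambda>v. E (v + 3)) \<phi>"
    have P: "decidable (?P p)" for p using All_num by simp
    \<comment> \<open>The bound on witnesses is the one place where the oracle is consulted.\<close>
    let ?b = "\<lambda>B E. Suc (B (E 0 + (\<Sum>i\<in>free_num (All_num x \<phi>). E (i + 3))))"
    have b: "computable ?b"
      by (intro computable_Suc computable_query computable_add computable_sum computable_var finite_free_num)
    show ?case
    proof (cases p)
      case True
      show ?thesis
        using decidable_ball[OF computable_var[of 1] P[of True], of "x + 3"] True
        unfolding upd fix_upd by simp
    next
      case False
      show ?thesis
        using decidable_bex[OF b P[of False], of "x + 3"] False
        unfolding upd fix_upd by simp
    qed
  next
    case (All_set X \<phi>)
    then show ?case by simp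
  }
qed

text \<open>A later stage demands more: \<open>d\<close> only limits the universal ranges and
  excuses membership facts not yet inspected, and the range of witnesses does not depend on
  it.\<close>

lemma approx_mono:
  "approx B s d' X p e \<phi> \<Longrightarrow> d \<le> d' \<Longrightarrow> approx B s d X p e \<phi>"
proof (induction \<phi> arbitrary: p e)
  case (Conj \<phi> \<psi>)
  then show ?case by (auto split: if_splits)
next
  case (All_num x \<phi>)
  show ?case
  proof (cases p)
    case True
    then show ?thesis using All_num by (auto dest: order.strict_trans2)
  next
    case False
    then show ?thesis using All_num by auto
  qed
qed auto

lemma approx_local:
  "X \<inter> {..<d} = Y \<inter> {..<d} \<Longrightarrow> approx B s d X p e \<phi> \<longleftrightarrow> approx B s d Y p e \<phi>"
proof (induction \<phi> arbitrary: p e)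
  case (Mem t j)
  then show ?case by auto
next
  case (Conj \<phi> \<psi>)
  then show ?case by simp
next
  case (All_num x \<phi>)
  then show ?case by simp
qed auto

text \<open>A disjunction or a bounded existential offers finitely many alternatives that are the
  same at all stages. By monotonicity an alternative refuted once stays refuted, so one of them
  survives every stage. This works for any oracle \<open>B\<close>, because bounding the witnesses
  only makes the condition stronger.\<close>

lemma approx_sound:
  assumes "arithmetical \<phi>" "\<forall>d. approx B s d X p e \<phi>"
  shows "sat e (\<lambda>j. {n. prod_encode (n, j) \<in> X}) \<phi> = p"
  using assms
proof (induction \<phi> arbitrary: p e)
  case (Mem t j)
  from Mem.prems(2)[rule_format, of "Suc (prod_encode (eval_term e t, j))"] show ?case by simp
next
  case (Neg \<phi>)
  have "sat e (\<lambda>j. {n. prod_encode (n, j) \<in> X}) \<phi> = (\<not> p)"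
    by (rule Neg.IH) (use Neg.prems in simp_all)
  then show ?case by auto
next
  case (Conj \<phi> \<psi>)
  show ?case
  proof (cases p)
    case True
    then show ?thesis using Conj.IH(1)[of True e] Conj.IH(2)[of True e] Conj.prems by auto
  next
    case False
    show ?thesis
    proof (cases "\<forall>d. approx B s d X p e \<phi>")
      case True
      then show ?thesis using Conj.IH(1)[of p e] Conj.prems(1) \<open>\<not> p\<close> by auto
    next
      case d0: False
      then obtain d0 where "\<not> approx B s d0 X p e \<phi>" by blast
      then have "\<not> approx B s (max d d0) X p e \<phi>" for d using approx_mono by (meson max.cobounded2)
      then have "approx B s (max d d0) X p e \<psi>" for d
        using Conj.prems(2)[rule_format, of "max d d0"] \<open>\<not> p\<close> by simp
      then have "\<forall>d. approx B s d X p e \<psi>" using approx_mono by (meson max.cobounded1)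
      then show ?thesis using Conj.IH(2)[of p e] Conj.prems(1) \<open>\<not> p\<close> by auto
    qed
  qed
next
  case (All_num x \<phi>)
  show ?case
  proof (cases p)
    case True
    have "approx B s d X True (e(x := n)) \<phi>" for n d
    proof -
      have "approx B s (max d (Suc n)) X True (e(x := n)) \<phi>"
        using All_num.prems(2)[rule_format, of "max d (Suc n)"] True by auto
      then show ?thesis by (rule approx_mono) simp
    qed
    then have *: "\<forall>d. approx B s d X True (e(x := n)) \<phi>" for n by blast
    have "sat (e(x := n)) (\<lambda>j. {n. prod_encode (n, j) \<in> X}) \<phi> = True" for n
      by (rule All_num.IH) (use All_num.prems(1) in simp, rule *)
    then show ?thesis using True by simp
  next
    case False
    let ?b = "Suc (B (s + (\<Sum>i\<in>free_num (All_num x \<phi>). e i)))"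
    have ex: "\<exists>n<?b. approx B s d X False (e(x := n)) \<phi>" for d
      using All_num.prems(2)[rule_format, of d] False by simp
    have "\<exists>n. \<forall>d. approx B s d X False (e(x := n)) \<phi>"
    proof (rule ccontr)
      assume "\<not> ?thesis"
      then obtain f where f: "\<And>n. \<not> approx B s (f n) X False (e(x := n)) \<phi>" by metis
      obtain n where n: "n < ?b" "approx B s (Max (f ` {..<?b})) X False (e(x := n)) \<phi>" using ex by blast
      have "f n \<le> Max (f ` {..<?b})" using n(1) by (intro Max_ge) auto
      then show False using n(2) f approx_mono by blast
    qed
    then obtain n where *: "\<forall>d. approx B s d X False (e(x := n)) \<phi>" by blast
    have "sat (e(x := n)) (\<lambda>j. {n. prod_encode (n, j) \<in> X}) \<phi> = False"
      by (rule All_num.IH) (use All_num.prems(1) in simp, rule *)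
    then show ?thesis using False by auto
  qed
qed auto

section \<open>Domination of the least counterexamples\<close>

definition dominated :: "(nat \<Rightarrow> nat \<Rightarrow> nat set) \<Rightarrow> (nat \<Rightarrow> nat) \<Rightarrow> form \<Rightarrow> bool" where
  "dominated W A \<phi> \<longleftrightarrow> (\<forall>B s e d. (\<forall>n. A n \<le> B n) \<longrightarrow>
     approx B s d {prod_encode (n, j) |n j. n \<in> W s j} (sat e (W s) \<phi>) e \<phi>)"

text \<open>Once \<open>W s\<close> is fixed, a false universal statement has a least counterexample
  depending only on \<open>s\<close> and its free variables. Any \<open>B\<close> above these
  numbers finds it, at every level of the formula; bounds for several subformulas are combined by
  \<open>max\<close>.\<close>

lemma approx_complete: "arithmetical \<phi> \<Longrightarrow> \<exists>A. dominated W A \<phi>"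
proof (induction \<phi>)
  case (Neg \<phi>)
  then obtain A where A: "dominated W A \<phi>" by auto
  show ?case by (rule exI[of _ A]) (use A in \<open>simp add: dominated_def\<close>)
next
  case (Conj \<phi> \<psi>)
  then obtain A1 A2 where A: "dominated W A1 \<phi>" "dominated W A2 \<psi>" by auto
  show ?case
  proof (intro exI[of _ "\<lambda>n. max (A1 n) (A2 n)"], unfold dominated_def, intro allI impI)
    fix B s e d
    assume B: "\<forall>n. max (A1 n) (A2 n) \<le> B n"
    let ?X = "{prod_encode (n, j) |n j. n \<in> W s j}"
    have "approx B s d ?X (sat e (W s) \<phi>) e \<phi>" "approx B s d ?X (sat e (W s) \<psi>) e \<psi>"
      using A B unfolding dominated_def by (simp_all del: split_paired_Ex)
    then show "approx B s d ?X (sat e (W s) (Conj \<phi> \<psi>)) e (Conj \<phi> \<psi>)"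
      by (cases "sat e (W s) \<phi>"; cases "sat e (W s) \<psi>") simp_all
  qed
next
  case (All_num x \<phi>)
  then obtain A1 where A1: "dominated W A1 \<phi>" by auto
  define F where "F = free_num (All_num x \<phi>)"
  have finF: "finite F" unfolding F_def by (rule finite_free_num)
  \<comment> \<open>Where no counterexample exists, \<open>LEAST\<close> is some unspecified number,
    which can only raise the bound.\<close>
  define wit where "wit s e = (LEAST n. \<not> sat (e(x := n)) (W s) \<phi>)" for s e
  define E where "E m = {e. \<forall>i. (i \<in> F \<longrightarrow> e i \<in> {..m}) \<and> (i \<notin> F \<longrightarrow> e i = 0)}" for m :: nat
  have finE: "finite (E m)" for m
    unfolding E_def by (rule finite_set_of_finite_funs) (use finF in auto)
  \<comment> \<open>The oracle is asked at \<open>s\<close> plus the sum of the free variables. That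
    argument \<open>m\<close> bounds \<open>s\<close> and each of these values, so finitely many
    cases have to be exceeded at \<open>m\<close>: environments with entries at most
    \<open>m\<close>, set to 0 off the free variables.\<close>
  define A2 where "A2 m = (\<Sum>s\<le>m. \<Sum>e\<in>E m. wit s e)" for m
  have "wit s e \<le> A2 (s + (\<Sum>i\<in>F. e i))" for s e
  proof -
    define m where "m = s + (\<Sum>i\<in>F. e i)"
    define e' where "e' i = (if i \<in> F then e i else 0)" for i
    have "sat (e(x := n)) (W s) \<phi> = sat (e'(x := n)) (W s) \<phi>" for n
      by (rule sat_cong) (auto simp: e'_def F_def)
    then have "wit s e = wit s e'" by (simp add: wit_def)
    also have "e i \<le> m" if "i \<in> F" for i
      unfolding m_def using member_le_sum[OF that _ finF, of e] by simp
    then have "e' \<in> E m" unfolding E_def e'_def by auto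
    then have "wit s e' \<le> (\<Sum>e\<in>E m. wit s e)" by (intro member_le_sum finE) auto
    also have "\<dots> \<le> A2 m" unfolding A2_def
      by (rule member_le_sum[of s "{..m}" "\<lambda>s. \<Sum>e\<in>E m. wit s e"]) (auto simp: m_def)
    finally show ?thesis by (simp add: m_def)
  qed
  note A2 = this
  show ?case
  proof (intro exI[of _ "\<lambda>n. max (A1 n) (A2 n)"], unfold dominated_def, intro allI impI)
    fix B s e d
    assume B: "\<forall>n. max (A1 n) (A2 n) \<le> B n"
    then have B2: "A2 m \<le> B m" for m by auto
    have IH: "approx B s d {prod_encode (n, j) |n j. n \<in> W s j} (sat e (W s) \<phi>) e \<phi>" for e
      using A1 B unfolding dominated_def by auto
    show "approx B s d {prod_encode (n, j) |n j. n \<in> W s j} (sat e (W s) (All_num x \<phi>)) e (All_num x \<phi>)"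
    proof (cases "sat e (W s) (All_num x \<phi>)")
      case True
      then have "sat (e(x := n)) (W s) \<phi>" for n by simp
      then have "approx B s d {prod_encode (n, j) |n j. n \<in> W s j} True (e(x := n)) \<phi>" for n
        using IH[of "e(x := n)"] by simp
      then show ?thesis using True by simp
    next
      case False
      then have "\<exists>n. \<not> sat (e(x := n)) (W s) \<phi>" by simp
      then have "\<not> sat (e(x := wit s e)) (W s) \<phi>" unfolding wit_def by (rule LeastI_ex)
      then have "approx B s d {prod_encode (n, j) |n j. n \<in> W s j} False (e(x := wit s e)) \<phi>"
        using IH[of "e(x := wit s e)"] by simp
      moreover have "wit s e < Suc (B (s + (\<Sum>i\<in>F. e i)))"
        using A2[of s e] B2[of "s + (\<Sum>i\<in>F. e i)"] by simp
      moreover have "sat e (W s) (All_num x \<phi>) = False" using False by blast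
      ultimately show ?thesis unfolding approx.simps F_def by (simp only: if_False) blast
    qed
  qed
qed (auto simp: dominated_def)

text \<open>Koenig's lemma for the binary tree of initial segments of sets.\<close>

lemma binary_compactness:
  fixes T :: "nat \<Rightarrow> nat set \<Rightarrow> bool"
  assumes mono: "\<And>d d' X. T d' X \<Longrightarrow> d \<le> d' \<Longrightarrow> T d X"
    and loc: "\<And>d X Y. X \<inter> {..<d} = Y \<inter> {..<d} \<Longrightarrow> T d X \<Longrightarrow> T d Y"
    and ex: "\<And>d. \<exists>X. T d X"
  shows "\<exists>X. \<forall>d. T d X"
proof -
  \<comment> \<open>A good segment begins some accepted set at every stage. If both of its one-step
    extensions failed, at stages \<open>d1\<close> and \<open>d2\<close>, then no accepted set at
    stage \<open>max d1 d2\<close> could begin with it.\<close>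
  define good where "good n C \<longleftrightarrow> (\<forall>d. \<exists>X. T d X \<and> X \<inter> {..<n} = C)" for n C
  have g0: "good 0 {}" using ex by (simp add: good_def)
  have gS: "\<exists>C'. good (Suc n) C' \<and> C' \<inter> {..<n} = C" if "good n C" for n C
  proof (rule ccontr)
    assume no: "\<not> ?thesis"
    have "C \<subseteq> {..<n}" using that unfolding good_def by blast
    then have "C \<inter> {..<n} = C" "insert n C \<inter> {..<n} = C" by auto
    then have "\<not> good (Suc n) C" "\<not> good (Suc n) (insert n C)" using no by blast+
    then obtain d1 d2 where d: "\<forall>X. \<not> (T d1 X \<and> X \<inter> {..<Suc n} = C)"
      "\<forall>X. \<not> (T d2 X \<and> X \<inter> {..<Suc n} = insert n C)" unfolding good_def by metis
    obtain X where X: "T (max d1 d2) X" "X \<inter> {..<n} = C" using \<open>good n C\<close> unfolding good_def by blast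
    have "T d1 X" "T d2 X" by (rule mono[OF X(1)], simp)+
    moreover have "X \<inter> {..<Suc n} = C \<or> X \<inter> {..<Suc n} = insert n C"
      unfolding lessThan_Suc X(2)[symmetric] by (cases "n \<in> X") auto
    ultimately show False using d by blast
  qed
  have "\<exists>f. \<forall>n. good n (f n) \<and> f (Suc n) \<inter> {..<n} = f n"
    by (rule dependent_nat_choice) (use g0 gS in blast)+
  then obtain f where f: "\<And>n. good n (f n) \<and> f (Suc n) \<inter> {..<n} = f n" by blast
  have sub: "f n \<subseteq> {..<n}" for n using f[of n] by (metis inf_le2)
  have ext: "n \<le> m \<Longrightarrow> f m \<inter> {..<n} = f n" for n m
  proof (induction m rule: dec_induct)
    case base
    show ?case using sub by (rule inf_absorb1)
  next
    case (step m)
    have "f (Suc m) \<inter> {..<n} = f (Suc m) \<inter> ({..<m} \<inter> {..<n})"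
      using step(1) by (simp add: inf_absorb2)
    also have "\<dots> = f m \<inter> {..<n}" using f[of m] by (simp add: Int_assoc[symmetric])
    finally show ?case using step(3) by simp
  qed
  have X: "(\<Union>n. f n) \<inter> {..<n} = f n" for n
  proof -
    have "f m \<inter> {..<n} \<subseteq> f n" for m
      using ext[of n m] ext[of m n] by (cases "n \<le> m") auto
    then have "(\<Union>n. f n) \<inter> {..<n} \<subseteq> f n" by blast
    moreover have "f n \<subseteq> (\<Union>n. f n) \<inter> {..<n}" using sub by blast
    ultimately show ?thesis by (rule equalityI)
  qed
  have "T n (\<Union>n. f n)" for n
  proof -
    obtain Y where Y: "T n Y" "Y \<inter> {..<n} = f n" using f[of n] unfolding good_def by blast
    show ?thesis by (rule loc[OF _ Y(1)]) (use X Y in simp)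
  qed
  then show ?thesis by blast
qed

text \<open>By \<open>approx_local\<close> the numbers \<open>c < 2 ^ d\<close>, read as bit
  patterns, represent all sets at stage \<open>d\<close>; hence the inner quantifier is a finite
  search.\<close>

lemma Pi11_approx:
  assumes "arithmetical \<phi>" and N: "N = {s. \<forall>V. sat (\<lambda>_. s) V \<phi>}"
  shows "\<exists>A. \<forall>B. (\<forall>n. A n \<le> B n) \<longrightarrow> (\<forall>s. s \<in> N \<longleftrightarrow>
    (\<exists>d. \<forall>c<2 ^ d. \<not> approx B s d (set_decode c) False (\<lambda>_. s) \<phi>))"
proof -
  define W where "W s = (SOME V. \<not> sat (\<lambda>_. s) V \<phi>)" for s
  obtain A where A: "dominated W A \<phi>" using approx_complete[OF assms(1)] by blast
  have "s \<in> N \<longleftrightarrow> (\<exists>d. \<forall>c<2 ^ d. \<not> approx B s d (set_decode c) False (\<lambda>_. s) \<phi>)"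
    if B: "\<forall>n. A n \<le> B n" for B s
  proof
    assume "s \<in> N"
    show "\<exists>d. \<forall>c<2 ^ d. \<not> approx B s d (set_decode c) False (\<lambda>_. s) \<phi>"
    proof (rule ccontr)
      assume "\<not> ?thesis"
      then have "\<exists>X. approx B s d X False (\<lambda>_. s) \<phi>" for d by blast
      \<comment> \<open>If no stage refuted all sets, a single set would pass every stage, and by
        soundness it would falsify the formula. No lower bound on \<open>B\<close> enters
        here.\<close>
      then have "\<exists>X. \<forall>d. approx B s d X False (\<lambda>_. s) \<phi>"
        using binary_compactness[of "\<lambda>d X. approx B s d X False (\<lambda>_. s) \<phi>"] approx_mono
          iffD1[OF approx_local] by metis
      then obtain X where "\<forall>d. approx B s d X False (\<lambda>_. s) \<phi>" by blast
      from approx_sound[OF assms(1) this] show False using \<open>s \<in> N\<close> N by blast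
    qed
  next
    assume "\<exists>d. \<forall>c<2 ^ d. \<not> approx B s d (set_decode c) False (\<lambda>_. s) \<phi>"
    then obtain d where d: "\<And>c. c < 2 ^ d \<Longrightarrow> \<not> approx B s d (set_decode c) False (\<lambda>_. s) \<phi>" by blast
    show "s \<in> N"
    proof (rule ccontr)
      assume "s \<notin> N"
      then have "\<exists>V. \<not> sat (\<lambda>_. s) V \<phi>" using N by blast
      then have "\<not> sat (\<lambda>_. s) (W s) \<phi>" unfolding W_def by (rule someI_ex)
      moreover let ?X = "{prod_encode (n, j) |n j. n \<in> W s j}"
      have "approx B s d ?X (sat (\<lambda>_. s) (W s) \<phi>) (\<lambda>_. s) \<phi>"
        by (rule A[unfolded dominated_def, rule_format]) (use B in blast)
      ultimately have ap: "approx B s d ?X False (\<lambda>_. s) \<phi>" by (simp only:)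
      \<comment> \<open>The part of the fixed counterexample below \<open>d\<close> is one of the
        sets searched, and it is never refuted.\<close>
      define c where "c = set_encode (?X \<inter> {..<d})"
      have dec: "set_decode c = ?X \<inter> {..<d}" unfolding c_def by (rule set_encode_inverse) simp
      have "c \<le> (\<Sum>i<d. 2 ^ i)" unfolding c_def set_encode_def by (rule sum_mono2) auto
      also have "\<dots> < 2 ^ d" by (induction d) auto
      finally have "\<not> approx B s d (set_decode c) False (\<lambda>_. s) \<phi>" by (rule d)
      then have nap: "\<not> approx B s d (?X \<inter> {..<d}) False (\<lambda>_. s) \<phi>" unfolding dec .
      have "?X \<inter> {..<d} \<inter> {..<d} = ?X \<inter> {..<d}" by blast
      from iffD2[OF approx_local[OF this] ap] nap show False by contradiction
    qed
  qed
  then show ?thesis by (intro exI[of _ A] allI impI)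
qed

text \<open>Membership in \<open>N\<close> does not depend on the set assignment, so one may
  quantify over whole assignments; then each set quantifier of the prefix is absorbed. Membership
  depends on variable 0 only, which permits the constant environment.\<close>

lemma Pi11_normal_form:
  assumes "Pi11 N"
  obtains \<phi> where "arithmetical \<phi>" "N = {s. \<forall>V. sat (\<lambda>_. s) V \<phi>}"
proof -
  obtain \<phi> where \<phi>: "Pi11_form \<phi>" "\<And>e V. e 0 \<in> N \<longleftrightarrow> sat e V \<phi>" using assms unfolding Pi11_def by blast
  from \<phi>(1) have "\<exists>\<psi>. arithmetical \<psi> \<and> (\<forall>e. (\<forall>V. sat e V \<phi>) \<longleftrightarrow> (\<forall>V. sat e V \<psi>))"
  proof induction
    case (matrix \<phi>)
    then show ?case by blast
  next
    case (prefix \<phi> X)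
    have "(\<forall>V. sat e V (All_set X \<phi>)) \<longleftrightarrow> (\<forall>V. sat e V \<phi>)" for e
      by (auto dest: spec[of _ "_ X"]) (metis fun_upd_triv)
    then show ?case using prefix by simp
  qed
  then obtain \<psi> where \<psi>: "arithmetical \<psi>" "\<And>e. (\<forall>V. sat e V \<phi>) \<longleftrightarrow> (\<forall>V. sat e V \<psi>)" by blast
  have "s \<in> N \<longleftrightarrow> (\<forall>V. sat (\<lambda>_. s) V \<psi>)" for s
    using \<phi>(2)[of "\<lambda>_. s"] \<psi>(2)[of "\<lambda>_. s"] by blast
  then show thesis using that \<psi>(1) by blast
qed

section \<open>A machine for unbounded search\<close>

fun marks :: "nat \<Rightarrow> prog" where
  "marks 0 = skip"
| "marks (Suc n) = Seq (marks n) (Act (n + 2) (\<lambda>a. (1, Stay)))"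

text \<open>The tapes start out blank, whereas a counter of value 0 has its cell 0 marked.\<close>

lemma exec_marks:
  "exec B (marks n) T (\<lambda>k. if 2 \<le> k \<and> k < n + 2 then act (1, Stay) (T k) else T k)"
proof (induction n)
  case 0
  have "(\<lambda>k. if 2 \<le> k \<and> k < 0 + 2 then act (1, Stay) (T k) else T k) = T" by (auto simp: fun_eq_iff)
  then show ?case using exec_skip by (metis marks.simps(1))
next
  case (Suc n)
  show ?case unfolding marks.simps
    by (rule exec_Seq[OF Suc], rule exec_Act) (auto simp: fun_eq_iff less_Suc_eq)
qed

lemma modest_marks: "modest (marks n)"
  by (induction n) auto

lemma within_marks: "within (n + 2) (marks n)"
  by (induction n) (auto simp: skip_def intro: within_mono)

text \<open>Input letters are written as successors, so the first 0 marks the end; counter 3 learns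
  the length of the word.\<close>

definition find_end :: prog where
  "find_end = While 0 (\<lambda>a. a \<noteq> 0) (Seq (inc 0) (inc 3))"

lemma exec_find_end:
  assumes "\<forall>i<n. w i \<noteq> 0" "w n = 0" "s 0 \<le> n"
  shows "exec B find_end (conf w u s) (conf w u (s(0 := n, 3 := s 3 + (n - s 0))))"
  using assms(3)
proof (induction "n - s 0" arbitrary: s)
  case 0
  then have "s 0 = n" by simp
  then have "s(0 := n, 3 := s 3 + (n - s 0)) = s" by auto
  moreover have "exec B find_end (conf w u s) (conf w u s)"
    unfolding find_end_def by (rule exec_While_done) (use assms(2) \<open>s 0 = n\<close> in simp)
  ultimately show ?case by (simp only:)
next
  case (Suc m)
  let ?s = "s(0 := Suc (s 0), 3 := Suc (s 3))"
  have "exec B (inc 0) (conf w u s) (conf w u (s(0 := Suc (s 0))))"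
    by (rule exec_inc) simp
  moreover have "exec B (inc 3) (conf w u (s(0 := Suc (s 0)))) (conf w u ?s)"
    using exec_inc[of 3 B w u "s(0 := Suc (s 0))"] by simp
  ultimately have body: "exec B (Seq (inc 0) (inc 3)) (conf w u s) (conf w u ?s)"
    by (rule exec_Seq)
  have "exec B find_end (conf w u ?s) (conf w u (?s(0 := n, 3 := ?s 3 + (n - ?s 0))))"
    by (rule Suc.hyps(1)) (use Suc in simp_all)
  moreover have "?s(0 := n, 3 := ?s 3 + (n - ?s 0)) = s(0 := n, 3 := s 3 + (n - s 0))"
    using Suc by (auto simp: fun_eq_iff)
  ultimately have loop: "exec B find_end (conf w u ?s) (conf w u (s(0 := n, 3 := s 3 + (n - s 0))))"
    by (simp only:)
  show ?case unfolding find_end_def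
    by (rule exec_While_step[OF _ body loop[unfolded find_end_def]]) (use assms(1) Suc.hyps(2) in simp)
qed

text \<open>Lowering the symbol in place down to 1, while counting, reads it in a way that works for
  any alphabet.\<close>

definition read_letter :: prog where
  "read_letter = While 0 (\<lambda>a. 1 < a) (Seq (Act 0 (\<lambda>a. (a - 1, Stay))) (inc 4))"

lemma exec_read_letter:
  assumes "w (s 0) = Suc a"
  shows "exec B read_letter (conf w u s) (conf (w(s 0 := 1)) u (s(4 := s 4 + a)))"
  using assms
proof (induction a arbitrary: w s)
  case 0
  then have "w(s 0 := 1) = w" "s(4 := s 4 + 0) = s" by auto
  moreover have "exec B read_letter (conf w u s) (conf w u s)"
    unfolding read_letter_def by (rule exec_While_done) (use 0 in simp)
  ultimately show ?case by (simp only:)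
next
  case (Suc a)
  let ?w = "w(s 0 := Suc a)" and ?s = "s(4 := Suc (s 4))"
  have "exec B (Act 0 (\<lambda>a. (a - 1, Stay))) (conf w u s) (conf ?w u s)"
    by (rule exec_Act) (use Suc.prems in \<open>auto simp: conf_def fun_eq_iff\<close>)
  moreover have "exec B (inc 4) (conf ?w u s) (conf ?w u ?s)"
    by (rule exec_inc) simp
  ultimately have body: "exec B (Seq (Act 0 (\<lambda>a. (a - 1, Stay))) (inc 4)) (conf w u s) (conf ?w u ?s)"
    by (rule exec_Seq)
  have "exec B read_letter (conf ?w u ?s) (conf (?w(?s 0 := 1)) u (?s(4 := ?s 4 + a)))"
    by (rule Suc.IH) simp
  moreover have "?w(?s 0 := 1) = w(s 0 := 1)" "?s(4 := ?s 4 + a) = s(4 := s 4 + Suc a)" by auto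
  ultimately have loop: "exec B read_letter (conf ?w u ?s) (conf (w(s 0 := 1)) u (s(4 := s 4 + Suc a)))"
    by (simp only:)
  show ?case unfolding read_letter_def
    by (rule exec_While_step[OF _ body loop[unfolded read_letter_def]]) (use Suc.prems in simp)
qed

text \<open>\<open>list_encode\<close> puts the head of a list outermost, so the word is read from
  right to left. Counter 2 holds the code of the suffix read so far, 3 the number of letters left, 4
  the current letter and 5 the new code.\<close>

lemma exec_decode_input:
  obtains p where "modest p" "\<And>B w. \<exists>w' s. exec B p (conf (fst (input_tape w)) blank_tape (\<lambda>_. 0))
    (conf w' blank_tape s) \<and> s 2 = list_encode w"
proof -
  let ?F = "\<lambda>B e. Suc (prod_encode (e 0, e (Suc 0)))"
  have "computable ?F" by (intro computable_Suc computable_prod_encode computable_var)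
  then have "\<exists>c. evaluates c 5 (\<lambda>v. if v = 0 then 4 else 2) ?F" by (rule computableD) simp
  then obtain c where c: "evaluates c 5 (\<lambda>v. if v = 0 then 4 else 2) ?F" by blast
  define body where "body = Seq (dec 0) (Seq (clear 4) (Seq read_letter (Seq c (Seq (clear 2) (transfer 5 2)))))"
  have loop: "\<exists>w' s'. exec B (Loop 3 body) (conf w blank_tape s) (conf w' blank_tape s') \<and>
      s' 2 = list_encode (xs @ ys)"
    if "\<forall>i<length xs. w i = Suc (xs ! i)" "s 0 = length xs" "s 3 = length xs" "s 2 = list_encode ys"
    for B w s xs ys
    using that
  proof (induction xs arbitrary: w s ys rule: rev_induct)
    case Nil
    have "exec B (Loop 3 body) (conf w blank_tape s) (conf w blank_tape s)"
      unfolding Loop_def by (rule exec_While_done) (use Nil in simp)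
    then show ?case using Nil.prems by auto
  next
    case (snoc x xs)
    let ?n = "length xs"
    let ?s1 = "s(3 := ?n)" let ?s2 = "?s1(0 := ?n)" let ?s3 = "?s2(4 := 0)" let ?s4 = "?s2(4 := x)"
    have 1: "exec B (dec 3) (conf w blank_tape s) (conf w blank_tape ?s1)"
      using exec_dec[of 3 B w blank_tape s] snoc.prems by simp
    have 2: "exec B (dec 0) (conf w blank_tape ?s1) (conf w blank_tape ?s2)"
      using exec_dec[of 0 B w blank_tape ?s1] snoc.prems by simp
    have 3: "exec B (clear 4) (conf w blank_tape ?s2) (conf w blank_tape ?s3)"
      by (rule exec_clear) simp
    have "w ?n = Suc x" using snoc.prems(1)[rule_format, of ?n] by simp
    then have 4: "exec B read_letter (conf w blank_tape ?s3) (conf (w(?n := 1)) blank_tape ?s4)"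
      using exec_read_letter[of w ?s3 x B blank_tape] by simp
    obtain s5 where s5: "exec B c (conf (w(?n := 1)) blank_tape ?s4) (conf (w(?n := 1)) blank_tape s5)"
      "\<forall>r<5. s5 r = ?s4 r" "s5 5 = Suc (prod_encode (?s4 4, ?s4 2))"
      using evaluatesD[OF c, of B "w(?n := 1)" ?s4] by auto
    have s5': "s5 0 = ?n" "s5 3 = ?n" "s5 5 = list_encode (x # ys)"
      using s5(2,3) snoc.prems by auto
    have 6: "exec B (clear 2) (conf (w(?n := 1)) blank_tape s5) (conf (w(?n := 1)) blank_tape (s5(2 := 0)))"
      by (rule exec_clear) simp
    let ?s6 = "s5(2 := list_encode (x # ys), 5 := 0)"
    have 7: "exec B (transfer 5 2) (conf (w(?n := 1)) blank_tape (s5(2 := 0))) (conf (w(?n := 1)) blank_tape ?s6)"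
      using exec_transfer[of 5 2 B "w(?n := 1)" blank_tape "s5(2 := 0)"] s5'(3) by simp
    have "exec B body (conf w blank_tape ?s1) (conf (w(?n := 1)) blank_tape ?s6)"
      unfolding body_def
      by (rule exec_Seq[OF 2 exec_Seq[OF 3 exec_Seq[OF 4 exec_Seq[OF s5(1) exec_Seq[OF 6 7]]]]])
    note b = exec_Seq[OF 1 this]
    have "\<exists>w' s'. exec B (Loop 3 body) (conf (w(?n := 1)) blank_tape ?s6) (conf w' blank_tape s') \<and>
      s' 2 = list_encode (xs @ (x # ys))"
    proof (rule snoc.IH)
      show "\<forall>i<length xs. (w(?n := 1)) i = Suc (xs ! i)"
        using snoc.prems(1) by (auto simp: nth_append)
    qed (use s5' in simp_all)
    then obtain w' s' where l: "exec B (Loop 3 body) (conf (w(?n := 1)) blank_tape ?s6) (conf w' blank_tape s')"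
      "s' 2 = list_encode ((xs @ [x]) @ ys)" by auto
    have "exec B (Loop 3 body) (conf w blank_tape s) (conf w' blank_tape s')"
      unfolding Loop_def
      by (rule exec_While_step[OF _ b l(1)[unfolded Loop_def]]) (use snoc.prems in simp)
    then show ?case using l(2) by blast
  qed
  show thesis
  proof (rule that[of "Seq find_end (Loop 3 body)"])
    show "modest (Seq find_end (Loop 3 body))"
      using c by (auto simp: body_def find_end_def read_letter_def evaluates_def)
    fix B and w :: "nat list"
    let ?w = "fst (input_tape w)"
    have w: "\<forall>i<length w. ?w i \<noteq> 0" "?w (length w) = 0" "\<forall>i<length w. ?w i = Suc (w ! i)"
      by (auto simp: input_tape_def)
    let ?s = "(\<lambda>_. 0)(0 := length w, 3 := length w)"
    have 1: "exec B find_end (conf ?w blank_tape (\<lambda>_. 0)) (conf ?w blank_tape ?s)"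
      using exec_find_end[OF w(1,2), of "\<lambda>_. 0" B blank_tape] by simp
    have "\<exists>w' s'. exec B (Loop 3 body) (conf ?w blank_tape ?s) (conf w' blank_tape s') \<and>
      s' 2 = list_encode (w @ [])" by (rule loop) (use w(3) in simp_all)
    then obtain w' s' where 2: "exec B (Loop 3 body) (conf ?w blank_tape ?s) (conf w' blank_tape s')"
      "s' 2 = list_encode w" by auto
    show "\<exists>w' s. exec B (Seq find_end (Loop 3 body)) (conf ?w blank_tape (\<lambda>_. 0))
        (conf w' blank_tape s) \<and> s 2 = list_encode w"
      using exec_Seq[OF 1 2(1)] 2(2) by blast
  qed
qed

text \<open>The stages are tried in turn: counter 2 holds the input code, 3 the stage
  \<open>d\<close>, and 4 a flag that stays 1 until \<open>P\<close> holds.\<close>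

theorem search_machine:
  assumes "decidable P" "finite \<Sigma>"
  shows "\<exists>M. oracle_TM \<Sigma> M \<and> (\<forall>B S. halts_on M B S \<longleftrightarrow>
    (\<exists>d. P B (\<lambda>v. if v = 1 then d else list_encode S)))"
proof -
  let ?\<rho> = "\<lambda>v :: nat. if v = 1 then 3 else 2 :: nat"
  let ?E = "\<lambda>d S v. if v = (1 :: nat) then d else list_encode S"
  have "\<exists>c. evaluates c 5 ?\<rho> (\<lambda>B e. of_bool (P B e))"
    by (rule computableD[OF assms(1)[unfolded decidable_def]]) simp
  then obtain c where c: "evaluates c 5 ?\<rho> (\<lambda>B e. of_bool (P B e))" by blast
  obtain p where p: "modest p" "\<And>B w. \<exists>w' s. exec B p (conf (fst (input_tape w)) blank_tape (\<lambda>_. 0))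
    (conf w' blank_tape s) \<and> s 2 = list_encode w" using exec_decode_input by metis
  \<comment> \<open>Counter 5 holds a truth value, 0 or 1, so \<open>Loop 5\<close> acts as a
    conditional.\<close>
  define body where "body = Seq c (Seq (Loop 5 (clear 4)) (inc 3))"
  define pre where "pre = Seq p (Seq (clear 3) (Seq (clear 4) (inc 4)))"
  define loop where "loop = While 4 (\<lambda>a. a \<noteq> 1) body"
  have mod: "modest pre" "modest loop" using c p by (auto simp: pre_def loop_def body_def evaluates_def)

  have pre: "\<exists>w' s. exec B pre (conf (fst (input_tape S)) blank_tape (\<lambda>_. 0)) (conf w' blank_tape s) \<and>
    s 2 = list_encode S \<and> s 3 = 0 \<and> s 4 = 1" for B S
  proof -
    obtain w' s where 1: "exec B p (conf (fst (input_tape S)) blank_tape (\<lambda>_. 0)) (conf w' blank_tape s)"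
      "s 2 = list_encode S" using p(2) by blast
    have 2: "exec B (clear 3) (conf w' blank_tape s) (conf w' blank_tape (s(3 := 0)))"
      by (rule exec_clear) simp
    have 3: "exec B (clear 4) (conf w' blank_tape (s(3 := 0))) (conf w' blank_tape (s(3 := 0, 4 := 0)))"
      by (rule exec_clear) simp
    have 4: "exec B (inc 4) (conf w' blank_tape (s(3 := 0, 4 := 0))) (conf w' blank_tape (s(3 := 0, 4 := 1)))"
      using exec_inc[of 4 B w' blank_tape "s(3 := 0, 4 := 0)"] by simp
    show ?thesis
      by (rule exI[of _ w'], rule exI[of _ "s(3 := 0, 4 := 1)"])
        (use exec_Seq[OF 1(1) exec_Seq[OF 2 exec_Seq[OF 3 4]]] 1(2) in \<open>simp add: pre_def\<close>)
  qed

  have body: "\<exists>s'. exec B body (conf w blank_tape s) (conf w blank_tape s') \<and> s' 2 = list_encode S \<and>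
      s' 3 = Suc d \<and> s' 4 = (if P B (?E d S) then 0 else 1)"
    if "s 2 = list_encode S" "s 3 = d" "s 4 = 1" for B w s S d
  proof -
    obtain s1 where s1: "exec B c (conf w blank_tape s) (conf w blank_tape s1)"
      "\<forall>r<5. s1 r = s r" "s1 5 = of_bool (P B (\<lambda>v. s (?\<rho> v)))"
      using evaluatesD[OF c, of B w s] by blast
    have "(\<lambda>v. s (?\<rho> v)) = ?E d S" using that by (auto simp: fun_eq_iff)
    then have s15: "s1 5 = of_bool (P B (?E d S))" using s1(3) by (simp only:)
    have s1': "s1 2 = list_encode S" "s1 3 = d" "s1 4 = 1" using s1(2) that by auto
    have "\<exists>s2. exec B (Loop 5 (clear 4)) (conf w blank_tape s1) (conf w blank_tape s2) \<and>
      s2 2 = list_encode S \<and> s2 3 = d \<and> s2 4 = (if P B (?E d S) then 0 else 1)"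
    proof (cases "P B (?E d S)")
      case False
      then have "exec B (Loop 5 (clear 4)) (conf w blank_tape s1) (conf w blank_tape s1)"
        unfolding Loop_def by (intro exec_While_done) (use s15 in simp)
      then show ?thesis using False s1' by auto
    next
      case True
      have 1: "exec B (dec 5) (conf w blank_tape s1) (conf w blank_tape (s1(5 := 0)))"
        using exec_dec[of 5 B w blank_tape s1] s15 True by simp
      have 2: "exec B (clear 4) (conf w blank_tape (s1(5 := 0))) (conf w blank_tape (s1(5 := 0, 4 := 0)))"
        by (rule exec_clear) simp
      have 3: "exec B (Loop 5 (clear 4)) (conf w blank_tape (s1(5 := 0, 4 := 0))) (conf w blank_tape (s1(5 := 0, 4 := 0)))"
        unfolding Loop_def by (rule exec_While_done) simp
      have "exec B (Loop 5 (clear 4)) (conf w blank_tape s1) (conf w blank_tape (s1(5 := 0, 4 := 0)))"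
        unfolding Loop_def
        by (rule exec_While_step[OF _ exec_Seq[OF 1 2] 3[unfolded Loop_def]]) (use s15 True in simp)
      then show ?thesis using True s1' by (intro exI[of _ "s1(5 := 0, 4 := 0)"]) simp
    qed
    then obtain s2 where s2: "exec B (Loop 5 (clear 4)) (conf w blank_tape s1) (conf w blank_tape s2)"
      "s2 2 = list_encode S" "s2 3 = d" "s2 4 = (if P B (?E d S) then 0 else 1)" by blast
    have 3: "exec B (inc 3) (conf w blank_tape s2) (conf w blank_tape (s2(3 := Suc d)))"
      using exec_inc[of 3 B w blank_tape s2] s2(3) by simp
    show ?thesis
      by (rule exI[of _ "s2(3 := Suc d)"])
        (use exec_Seq[OF s1(1) exec_Seq[OF s2(1) 3]] s2 in \<open>simp add: body_def\<close>)
  qed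

  have loop_halts: "\<exists>T. exec B loop (conf w blank_tape s) T"
    if "s 2 = list_encode S" "s 3 = d" "s 4 = 1" "P B (?E (d + n) S)" for B w s S d n
    using that
  proof (induction n arbitrary: d s)
    case 0
    obtain s' where s': "exec B body (conf w blank_tape s) (conf w blank_tape s')" "s' 4 = 0"
      using body[OF 0(1-3), where B = B and w = w] 0(4)[unfolded add_0_right] by auto
    have "exec B loop (conf w blank_tape s') (conf w blank_tape s')"
      unfolding loop_def by (rule exec_While_done) (use s'(2) in simp)
    then have "exec B loop (conf w blank_tape s) (conf w blank_tape s')"
      unfolding loop_def by (intro exec_While_step[OF _ s'(1)]) (use 0 in simp)
    then show ?case by blast
  next
    case (Suc n)
    obtain s' where s': "exec B body (conf w blank_tape s) (conf w blank_tape s')" "s' 2 = list_encode S"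
      "s' 3 = Suc d" "s' 4 = (if P B (?E d S) then 0 else 1)"
      using body[OF Suc.prems(1-3), where B = B and w = w] by blast
    have "\<exists>T. exec B loop (conf w blank_tape s') T"
    proof (cases "P B (?E d S)")
      case True
      have "exec B loop (conf w blank_tape s') (conf w blank_tape s')"
        unfolding loop_def by (rule exec_While_done) (use s'(4) True in simp)
      then show ?thesis by blast
    next
      case False
      show ?thesis by (rule Suc.IH) (use s' False Suc.prems(4)[folded add_Suc_shift] in simp_all)
    qed
    then obtain T where "exec B loop (conf w blank_tape s') T" by blast
    then have "exec B loop (conf w blank_tape s) T"
      unfolding loop_def by (intro exec_While_step[OF _ s'(1)]) (use Suc.prems in simp)
    then show ?case by blast
  qed

  obtain K0 where K0: "within K0 (Seq pre loop)" using within_exists by blast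
  \<comment> \<open>Tapes 0 and 1, and the \<open>K0\<close> counters that \<open>marks K0\<close>
    prepares.\<close>
  define K where "K = K0 + 2"
  have K: "within K pre" "within K loop" "within K (marks K0)" "2 \<le> K"
    using K0 within_mono[of K0 _ K] within_marks[of K0] by (auto simp: K_def)
  obtain N0 where N0: "\<forall>a\<in>\<Sigma>. a < N0" using assms(2) finite_nat_set_iff_bounded by blast
  \<comment> \<open>Room for the symbols \<open>Suc a\<close> with \<open>a < N0\<close>, and for 0
    and 1 even if the alphabet is empty.\<close>
  define N where "N = N0 + 2"
  define all where "all = Seq (marks K0) (Seq pre loop)"
  define C where "C = code 0 all"
  define M where "M = machine K N C"
  define q where "q = plen (marks K0) + plen pre"
  define us where "us = code 0 (marks K0) @ code (plen (marks K0)) pre"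
  have us: "length us = q" "C = us @ code q loop @ []" by (auto simp: us_def q_def C_def all_def)
  have lenC: "length C = plen all" by (simp add: C_def)
  have "oracle_TM \<Sigma> M"
    unfolding M_def
  proof (rule oracle_TM_machine)
    show "\<forall>i\<in>set C. good_instr (length C) i"
      using good_instr_code[of all 0 "plen all"] mod modest_marks by (auto simp: C_def all_def)
    show "\<forall>i\<in>set C. \<forall>k f. i = Ins k f \<longrightarrow> k < K"
      using within_code[of K all _ _ 0] K by (auto simp: C_def all_def)
  qed (use K N0 in \<open>auto simp: N_def\<close>)
  moreover have "halts_on M B S \<longleftrightarrow> (\<exists>d. P B (?E d S))" for B S
  proof -
    \<comment> \<open>Beyond the tapes of the machine the family is marked already, so that after
      \<open>marks K0\<close> it equals the counter state \<open>T1\<close> everywhere.\<close>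
    define T0 where "T0 k = (if k = 0 then input_tape S else if k < K then blank_tape else (mark, 0))" for k
    define T1 where "T1 = conf (fst (input_tape S)) blank_tape (\<lambda>_. 0)"
    have init: "initial_config M S = (0, map T0 [0..<K])"
      unfolding initial_config_def M_def using K(4)
      by (auto simp: T0_def nth_Cons split: nat.splits intro!: nth_equalityI)
    have "(\<lambda>k. if 2 \<le> k \<and> k < K0 + 2 then act (1, Stay) (T0 k) else T0 k) = T1"
      by (auto simp: fun_eq_iff T0_def T1_def conf_def K_def blank_tape_def mark_def input_tape_def)
    then have marks: "exec B (marks K0) T0 T1" using exec_marks[of B K0 T0] by (simp only:)
    obtain w s where pre': "exec B pre T1 (conf w blank_tape s)" and s: "s 2 = list_encode S" "s 3 = 0" "s 4 = 1"
      using pre[of B S] unfolding T1_def by blast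
    have start: "reaches M B (0, map T0 [0..<K]) (q, map (conf w blank_tape s) [0..<K])"
      using compile_correct[OF exec_Seq[OF marks pre'], of K C "[]" "code q loop" N] K
      by (simp add: M_def C_def all_def q_def)
    show ?thesis
    proof
      assume "\<exists>d. P B (?E d S)"
      then obtain d where "P B (?E (0 + d) S)" unfolding add_0 by blast
      then obtain T where T: "exec B loop (conf w blank_tape s) T" using loop_halts s by blast
      have "reaches M B (q, map (conf w blank_tape s) [0..<K]) (plen all, map T [0..<K])"
        using compile_correct[OF T K(2), of C us "[]" N] us by (simp add: M_def all_def q_def add.assoc)
      with start have "reaches M B (initial_config M S) (plen all, map T [0..<K])"
        unfolding init by (rule reaches_trans)
      moreover have "halt_state M = plen all" by (simp add: M_def lenC)
      ultimately show "halts_on M B S" unfolding halts_on_def reaches_def by (metis fst_conv)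
    next
      assume "halts_on M B S"
      show "\<exists>d. P B (?E d S)"
      proof (rule ccontr)
        assume no: "\<not> ?thesis"
        \<comment> \<open>The head of the search loop with the flag still up, for any stage: each
          unsuccessful round leads back here.\<close>
        let ?G = "{(q, map (conf w blank_tape s) [0..<K]) |w s. \<exists>d. s 2 = list_encode S \<and> s 3 = d \<and> s 4 = 1}"
        have "fst c \<noteq> halt_state M \<and> (\<exists>t. (step M B ^^ Suc t) c \<in> ?G)" if "c \<in> ?G" for c
        proof -
          obtain w s where c: "c = (q, map (conf w blank_tape s) [0..<K])"
            and s: "s 2 = list_encode S" "s 4 = 1" using \<open>c \<in> ?G\<close> by blast
          obtain s' where s': "exec B body (conf w blank_tape s) (conf w blank_tape s')"
            "s' 2 = list_encode S" "s' 4 = 1"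
            using body[OF s(1) refl s(2), of B w] no by auto
          let ?hd = "Ins 4 (\<lambda>a. (if a \<noteq> 1 then q + 1 else q + plen body + 2, a, Stay))"
          have "reaches M B (q + 1, map (conf w blank_tape s) [0..<K]) (q + 1 + plen body, map (conf w blank_tape s') [0..<K])"
            unfolding M_def
            using compile_correct[OF s'(1), of K C "us @ [?hd]" "[Ins 0 (\<lambda>a. (q, a, Stay))]" N] K us
            by (simp add: loop_def)
          then have "\<exists>t. (step M B ^^ Suc t) c = (q, map (conf w blank_tape s') [0..<K])"
            using compile_iteration[of C us 4 "\<lambda>a. a \<noteq> 1" body "[]" K "conf w blank_tape s" N B "conf w blank_tape s'"]
              us K(2) s(2) unfolding M_def c by (simp add: loop_def)
          then have "\<exists>t. (step M B ^^ Suc t) c \<in> ?G" using s'(2,3) by fastforce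
          moreover have "fst c \<noteq> halt_state M" using c lenC
            by (simp add: M_def all_def q_def loop_def)
          ultimately show ?thesis by blast
        qed
        moreover have "(q, map (conf w blank_tape s) [0..<K]) \<in> ?G" using s by blast
        ultimately have never: "fst ((step M B ^^ t) (q, map (conf w blank_tape s) [0..<K])) \<noteq> halt_state M" for t
          by (rule recurrent_never_halts)
        obtain t0 where t0: "(step M B ^^ t0) (initial_config M S) = (q, map (conf w blank_tape s) [0..<K])"
          using start unfolding init reaches_def by blast
        obtain t where "fst ((step M B ^^ t) (initial_config M S)) = halt_state M"
          using \<open>halts_on M B S\<close> unfolding halts_on_def by blast
        then have "fst ((step M B ^^ (t + t0)) (initial_config M S)) = halt_state M"
          by (rule halted_stays) simp
        then show False using never[of t] t0 by (simp add: funpow_add)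
      qed
    qed
  qed
  ultimately show ?thesis by blast
qed

lemma recognized_Pi11:
  assumes "finite \<Sigma>" "Pi11_language L"
  shows "\<exists>M. oracle_TM \<Sigma> M \<and> recognizes_with_fast_growing_oracle \<Sigma> M L"
proof -
  obtain \<phi> where \<phi>: "arithmetical \<phi>" "list_encode ` L = {s. \<forall>V. sat (\<lambda>_. s) V \<phi>}"
    using Pi11_normal_form assms(2) unfolding Pi11_language_def by blast
  obtain A where A: "\<And>B s. (\<forall>n. A n \<le> B n) \<Longrightarrow> s \<in> list_encode ` L \<longleftrightarrow>
    (\<exists>d. \<forall>c<2 ^ d. \<not> approx B s d (set_decode c) False (\<lambda>_. s) \<phi>)"
    using Pi11_approx[OF \<phi>] by metis
  let ?Q = "\<lambda>B E. \<not> approx B (E 0) (E 1) (set_decode (E 2)) False (\<lambda>v. E (v + 3)) \<phi>"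
  \<comment> \<open>Variable 1 is the stage and variable 2 is overwritten by the code of a set.
    Variable 0 and those from 3 on keep the input, which gives the formula its constant
    environment.\<close>
  define P where "P B E \<longleftrightarrow> (\<forall>c<2 ^ E 1. ?Q B (E(2 := c)))" for B and E :: "nat \<Rightarrow> nat"
  have "decidable P"
    unfolding P_def
    by (intro decidable_ball decidable_not decidable_approx \<phi>(1) computable_power2 computable_var)
  from search_machine[OF this assms(1)] obtain M where M: "oracle_TM \<Sigma> M"
    "\<And>B S. halts_on M B S \<longleftrightarrow> (\<exists>d. P B (\<lambda>v. if v = 1 then d else list_encode S))" by blast
  have "P B (\<lambda>v. if v = 1 then d else s) \<longleftrightarrow> (\<forall>c<2 ^ d. \<not> approx B s d (set_decode c) False (\<lambda>_. s) \<phi>)"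
    for B d s by (simp add: P_def)
  then have "halts_on M B S \<longleftrightarrow> S \<in> L" if "\<forall>n. A n \<le> B n" for B S
    using A[OF that, of "list_encode S"] M(2) by (auto simp: list_encode_eq)
  then show ?thesis using M(1) unfolding recognizes_with_fast_growing_oracle_def by blast
qed

section \<open>A formula for halting runs\<close>

definition pr :: "nat \<Rightarrow> nat \<Rightarrow> nat" where
  "pr a b = (a + b) * (a + b) + a"

text \<open>\<open>pr\<close> is a polynomial, hence a term of the language. With
  \<open>k = a + b\<close> its value lies between \<open>k * k\<close> and
  \<open>(k + 1) * (k + 1) - 1\<close>; this determines \<open>k\<close>, and then
  \<open>a\<close>.\<close>

lemma pr_inject [simp]: "pr a b = pr c d \<longleftrightarrow> a = c \<and> b = d"
proof
  assume eq: "pr a b = pr c d"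
  have "x + y < x' + y' \<Longrightarrow> pr x y < pr x' y'" for x y x' y'
  proof -
    assume "x + y < x' + y'"
    then have "Suc (x + y) * Suc (x + y) \<le> (x' + y') * (x' + y')" by (intro mult_le_mono) auto
    then show ?thesis by (simp add: pr_def)
  qed
  then have "a + b = c + d" using eq by (metis linorder_neqE_nat nat_neq_iff)
  then show "a = c \<and> b = d" using eq by (simp add: pr_def)
qed simp

text \<open>Trailing zeros are lost (\<open>enc [0] = enc []\<close>), so lists of different length
  may collide. Facts do not, because the tag at the front determines the length.\<close>

fun enc :: "nat list \<Rightarrow> nat" where
  "enc [] = 0"
| "enc (x # xs) = pr x (enc xs)"

fun num :: "nat \<Rightarrow> nterm" where
  "num 0 = Zero"
| "num (Suc n) = Plus (num n) One"

fun tenc :: "nterm list \<Rightarrow> nterm" where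
  "tenc [] = Zero"
| "tenc (t # ts) = Plus (Times (Plus t (tenc ts)) (Plus t (tenc ts))) t"

definition Fact where "Fact ts = Mem (tenc ts) 0"
definition Imp where "Imp \<phi> \<psi> = Neg (Conj \<phi> (Neg \<psi>))"
definition Disj where "Disj \<phi> \<psi> = Neg (Conj (Neg \<phi>) (Neg \<psi>))"
definition Ex_num where "Ex_num x \<phi> = Neg (All_num x (Neg \<phi>))"
definition conjs where "conjs \<phi>s = foldr Conj \<phi>s (Eq Zero Zero)"
definition disjs where "disjs \<phi>s = foldr Disj \<phi>s (Neg (Eq Zero Zero))"
definition Alls where "Alls xs \<phi> = foldr All_num xs \<phi>"

lemma eval_num [simp]: "eval_term e (num n) = n"
  by (induction n) auto

lemma eval_tenc [simp]: "eval_term e (tenc ts) = enc (map (eval_term e) ts)"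
  by (induction ts) (auto simp: pr_def)

lemma term_vars_num [simp]: "term_vars (num n) = {}"
  by (induction n) auto

lemma term_vars_tenc [simp]: "term_vars (tenc ts) = (\<Union>t\<in>set ts. term_vars t)"
  by (induction ts) auto

lemma sat_simps [simp]:
  "sat e V (Fact ts) \<longleftrightarrow> enc (map (eval_term e) ts) \<in> V 0"
  "sat e V (Imp \<phi> \<psi>) \<longleftrightarrow> (sat e V \<phi> \<longrightarrow> sat e V \<psi>)"
  "sat e V (Disj \<phi> \<psi>) \<longleftrightarrow> sat e V \<phi> \<or> sat e V \<psi>"
  "sat e V (Ex_num x \<phi>) \<longleftrightarrow> (\<exists>n. sat (e(x := n)) V \<phi>)"
  "sat e V (Alls [] \<phi>) \<longleftrightarrow> sat e V \<phi>"
  "sat e V (Alls (x # xs) \<phi>) \<longleftrightarrow> (\<forall>n. sat (e(x := n)) V (Alls xs \<phi>))"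
  by (auto simp: Fact_def Imp_def Disj_def Ex_num_def Alls_def)

lemma sat_conjs [simp]: "sat e V (conjs \<phi>s) \<longleftrightarrow> (\<forall>\<phi>\<in>set \<phi>s. sat e V \<phi>)"
  by (induction \<phi>s) (auto simp: conjs_def)

lemma sat_disjs [simp]: "sat e V (disjs \<phi>s) \<longleftrightarrow> (\<exists>\<phi>\<in>set \<phi>s. sat e V \<phi>)"
  by (induction \<phi>s) (auto simp: disjs_def)

definition matrix :: "form \<Rightarrow> bool" where
  "matrix \<phi> \<longleftrightarrow> arithmetical \<phi> \<and> free_set \<phi> \<subseteq> {0}"

lemma matrix_simps [simp]:
  "matrix (Eq s t)" "matrix (Less s t)" "matrix (Fact ts)"
  "matrix (Neg \<phi>) \<longleftrightarrow> matrix \<phi>"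
  "matrix (Conj \<phi> \<psi>) \<longleftrightarrow> matrix \<phi> \<and> matrix \<psi>"
  "matrix (Imp \<phi> \<psi>) \<longleftrightarrow> matrix \<phi> \<and> matrix \<psi>"
  "matrix (Disj \<phi> \<psi>) \<longleftrightarrow> matrix \<phi> \<and> matrix \<psi>"
  "matrix (All_num x \<phi>) \<longleftrightarrow> matrix \<phi>"
  "matrix (Ex_num x \<phi>) \<longleftrightarrow> matrix \<phi>"
  by (auto simp: matrix_def Fact_def Imp_def Disj_def Ex_num_def)

lemma matrix_lists [simp]:
  "matrix (conjs \<phi>s) \<longleftrightarrow> (\<forall>\<phi>\<in>set \<phi>s. matrix \<phi>)"
  "matrix (disjs \<phi>s) \<longleftrightarrow> (\<forall>\<phi>\<in>set \<phi>s. matrix \<phi>)"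
  "matrix (Alls xs \<phi>) \<longleftrightarrow> matrix \<phi>"
  by (induction \<phi>s, simp_all add: conjs_def disjs_def) (induction xs, simp_all add: Alls_def)

lemma free_num_simps [simp]:
  "free_num (Fact ts) = (\<Union>t\<in>set ts. term_vars t)"
  "free_num (Imp \<phi> \<psi>) = free_num \<phi> \<union> free_num \<psi>"
  "free_num (Disj \<phi> \<psi>) = free_num \<phi> \<union> free_num \<psi>"
  "free_num (Ex_num x \<phi>) = free_num \<phi> - {x}"
  by (auto simp: Fact_def Imp_def Disj_def Ex_num_def)

lemma free_num_lists [simp]:
  "free_num (conjs \<phi>s) = (\<Union>\<phi>\<in>set \<phi>s. free_num \<phi>)"
  "free_num (disjs \<phi>s) = (\<Union>\<phi>\<in>set \<phi>s. free_num \<phi>)"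
  "free_num (Alls xs \<phi>) = free_num \<phi> - set xs"
proof -
  show "free_num (Alls xs \<phi>) = free_num \<phi> - set xs"
    by (induction xs) (auto simp: Alls_def)
qed (induction \<phi>s; auto simp: conjs_def disjs_def)+

section \<open>Closure of a set of facts under the rules of computation\<close>

fun move_code :: "move \<Rightarrow> nat" where
  "move_code Stay = 0"
| "move_code Go_Right = 1"
| "move_code Go_Left = 2"

text \<open>
  Facts carry a tag: 0 for the oracle (run, argument, value), 1 for the state, 2 for a head position,
  3 for the contents of a cell, 4 for a symbol read, 5 for a symbol written, 6 for a head movement,
  each followed by the run and (except for the oracle) the time; 7 for the code of the part of the
  input that starts at a given cell.
\<close>

definition closed :: "oracle_machine \<Rightarrow> nat list \<Rightarrow> nat \<Rightarrow> nat set \<Rightarrow> bool" where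
  "closed M as s Y \<longleftrightarrow>
    (\<forall>r n. \<exists>b0. \<forall>b. \<not> b < b0 \<longrightarrow> (\<exists>r'. enc [0, r', n, b] \<in> Y \<and>
       (\<forall>m a. m < n \<and> enc [0, r, m, a] \<in> Y \<longrightarrow> enc [0, r', m, a] \<in> Y))) \<and>
    enc [7, 0, s] \<in> Y \<and>
    (\<forall>i c a c'. enc [7, i, c] \<in> Y \<and> c + c = 2 + ((a + c') * (a + c' + 1) + (a + a)) \<and> a \<in> set as \<longrightarrow>
       enc [7, i + 1, c'] \<in> Y \<and> (\<forall>r. enc [3, r, 0, 0, i, a + 1] \<in> Y)) \<and>
    (\<forall>i r. enc [7, i, 0] \<in> Y \<longrightarrow>
       enc [1, r, 0, start_state M] \<in> Y \<and>
       (\<forall>k. enc [2, r, 0, k, 0] \<in> Y) \<and>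
       (\<forall>j. \<not> j < i \<longrightarrow> enc [3, r, 0, 0, j, 0] \<in> Y) \<and>
       (\<forall>k j. 0 < k \<longrightarrow> enc [3, r, 0, k, j, 0] \<in> Y)) \<and>
    (\<forall>r t k h a. enc [2, r, t, k, h] \<in> Y \<and> enc [3, r, t, k, h, a] \<in> Y \<longrightarrow> enc [4, r, t, k, a] \<in> Y) \<and>
    (\<forall>r t k a h. enc [5, r, t, k, a] \<in> Y \<and> enc [2, r, t, k, h] \<in> Y \<longrightarrow>
       enc [3, r, t + 1, k, h, a] \<in> Y \<and>
       (\<forall>i b. i \<noteq> h \<and> enc [3, r, t, k, i, b] \<in> Y \<longrightarrow> enc [3, r, t + 1, k, i, b] \<in> Y)) \<and>
    (\<forall>r t k h g. enc [2, r, t, k, h] \<in> Y \<longrightarrow>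
       (enc [6, r, t, k, 0] \<in> Y \<longrightarrow> enc [2, r, t + 1, k, h] \<in> Y) \<and>
       (enc [6, r, t, k, 1] \<in> Y \<longrightarrow> enc [2, r, t + 1, k, h + 1] \<in> Y) \<and>
       (enc [6, r, t, k, 2] \<in> Y \<and> (h = g + 1 \<or> h = 0 \<and> g = 0) \<longrightarrow> enc [2, r, t + 1, k, g] \<in> Y)) \<and>
    (\<forall>q xs. q < num_states M \<and> q \<noteq> halt_state M \<and> q \<notin> query_states M \<and>
         length xs = num_tapes M \<and> set xs \<subseteq> {..<num_symbols M} \<longrightarrow>
       (\<forall>r t. enc [1, r, t, q] \<in> Y \<and> (\<forall>k<num_tapes M. enc [4, r, t, k, xs ! k] \<in> Y) \<longrightarrow>
         enc [1, r, t + 1, fst (delta M q xs)] \<in> Y \<and>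
         (\<forall>k<num_tapes M. enc [5, r, t, k, fst (snd (delta M q xs) ! k)] \<in> Y \<and>
            enc [6, r, t, k, move_code (snd (snd (delta M q xs) ! k))] \<in> Y))) \<and>
    (\<forall>q. q < num_states M \<and> q \<noteq> halt_state M \<and> q \<in> query_states M \<longrightarrow>
       (\<forall>r t n b a. enc [1, r, t, q] \<in> Y \<and> (\<forall>i. i < n \<longrightarrow> enc [3, r, t, 1, i, 1] \<in> Y) \<and>
          enc [3, r, t, 1, n, a] \<in> Y \<and> a \<noteq> 1 \<and> enc [0, r, n, b] \<in> Y \<longrightarrow>
         enc [1, r, t + 1, answer_state M q] \<in> Y \<and>
         enc [2, r, t + 1, 1, 0] \<in> Y \<and>
         (\<forall>i. (i < b \<longrightarrow> enc [3, r, t + 1, 1, i, 1] \<in> Y) \<and> (\<not> i < b \<longrightarrow> enc [3, r, t + 1, 1, i, 0] \<in> Y)) \<and>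
         (\<forall>k. k \<noteq> 1 \<longrightarrow> (\<forall>h. enc [2, r, t, k, h] \<in> Y \<longrightarrow> enc [2, r, t + 1, k, h] \<in> Y) \<and>
            (\<forall>i c. enc [3, r, t, k, i, c] \<in> Y \<longrightarrow> enc [3, r, t + 1, k, i, c] \<in> Y))))"

text \<open>The threshold \<open>b0\<close>, depending on run and argument, stands in for the
  unknown \<open>A n\<close>. Throughout the rules, variable 0 is kept for the input code, and 1 and
  2 stand for the run and the time.\<close>

definition extension_rule :: "form" where
  "extension_rule = Alls [1, 8] (Ex_num 5 (All_num 7 (Imp (Neg (Less (Var 7) (Var 5))) (Ex_num 10 (Conj
        (Fact [num 0, Var 10, Var 8, Var 7])
        (Alls [11, 4] (Imp (Conj (Less (Var 11) (Var 8)) (Fact [num 0, Var 1, Var 11, Var 4]))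
          (Fact [num 0, Var 10, Var 11, Var 4]))))))))"

text \<open>The equation says that \<open>c\<close> codes the list with head \<open>a\<close> and
  tail coded by \<open>c'\<close>. It is doubled because \<open>prod_encode\<close> uses triangle
  numbers, which involve a division by 2.\<close>

definition input_rule :: "nat list \<Rightarrow> form" where
  "input_rule as = Alls [6, 8, 5, 9] (Imp
        (Conj (Fact [num 7, Var 6, Var 8]) (Conj
          (Eq (Plus (Var 8) (Var 8)) (Plus (num 2) (Plus (Times (Plus (Var 5) (Var 9)) (Plus (Plus (Var 5) (Var 9)) One))
             (Plus (Var 5) (Var 5)))))
          (disjs (map (\<lambda>x. Eq (Var 5) (num x)) as))))
        (Conj (Fact [num 7, Plus (Var 6) One, Var 9])
          (All_num 1 (Fact [num 3, Var 1, Zero, Zero, Var 6, Plus (Var 5) One]))))"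

text \<open>The code 0 is that of the empty list, so the machine is started only after every letter
  has passed \<open>input_rule\<close>. A word with a letter outside the alphabet thus forces no
  state fact.\<close>

definition start_rule :: "oracle_machine \<Rightarrow> form" where
  "start_rule M = Alls [6, 1] (Imp (Fact [num 7, Var 6, Zero]) (conjs
        [Fact [num 1, Var 1, Zero, num (start_state M)],
         All_num 3 (Fact [num 2, Var 1, Zero, Var 3, Zero]),
         All_num 4 (Imp (Neg (Less (Var 4) (Var 6))) (Fact [num 3, Var 1, Zero, Zero, Var 4, Zero])),
         Alls [3, 4] (Imp (Less Zero (Var 3)) (Fact [num 3, Var 1, Zero, Var 3, Var 4, Zero]))]))"

definition read_rule :: "form" where
  "read_rule = Alls [1, 2, 3, 4, 5] (Imp
        (Conj (Fact [num 2, Var 1, Var 2, Var 3, Var 4]) (Fact [num 3, Var 1, Var 2, Var 3, Var 4, Var 5]))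
        (Fact [num 4, Var 1, Var 2, Var 3, Var 5]))"

definition write_rule :: "form" where
  "write_rule = Alls [1, 2, 3, 5, 4] (Imp
        (Conj (Fact [num 5, Var 1, Var 2, Var 3, Var 5]) (Fact [num 2, Var 1, Var 2, Var 3, Var 4]))
        (Conj (Fact [num 3, Var 1, (Plus (Var 2) One), Var 3, Var 4, Var 5])
          (Alls [6, 7] (Imp (Conj (Neg (Eq (Var 6) (Var 4))) (Fact [num 3, Var 1, Var 2, Var 3, Var 6, Var 7]))
            (Fact [num 3, Var 1, (Plus (Var 2) One), Var 3, Var 6, Var 7])))))"

definition move_rule :: "form" where
  "move_rule = Alls [1, 2, 3, 4, 9] (Imp (Fact [num 2, Var 1, Var 2, Var 3, Var 4]) (conjs
        [Imp (Fact [num 6, Var 1, Var 2, Var 3, num 0]) (Fact [num 2, Var 1, (Plus (Var 2) One), Var 3, Var 4]),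
         Imp (Fact [num 6, Var 1, Var 2, Var 3, num 1]) (Fact [num 2, Var 1, (Plus (Var 2) One), Var 3, Plus (Var 4) One]),
         Imp (Conj (Fact [num 6, Var 1, Var 2, Var 3, num 2])
             (Disj (Eq (Var 4) (Plus (Var 9) One)) (Conj (Eq (Var 4) Zero) (Eq (Var 9) Zero))))
           (Fact [num 2, Var 1, (Plus (Var 2) One), Var 3, Var 9])]))"

definition delta_rule :: "oracle_machine \<Rightarrow> nat \<Rightarrow> nat list \<Rightarrow> form" where
  "delta_rule M q xs = Alls [1, 2] (Imp
        (Conj (Fact [num 1, Var 1, Var 2, num q])
          (conjs (map (\<lambda>k. Fact [num 4, Var 1, Var 2, num k, num (xs ! k)]) [0..<num_tapes M])))
        (Conj (Fact [num 1, Var 1, (Plus (Var 2) One), num (fst (delta M q xs))])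
          (conjs (map (\<lambda>k. Conj (Fact [num 5, Var 1, Var 2, num k, num (fst (snd (delta M q xs) ! k))])
              (Fact [num 6, Var 1, Var 2, num k, num (move_code (snd (snd (delta M q xs) ! k)))]))
            [0..<num_tapes M]))))"

definition query_rule :: "oracle_machine \<Rightarrow> nat \<Rightarrow> form" where
  "query_rule M q = Alls [1, 2, 8, 7, 5] (Imp
        (conjs [Fact [num 1, Var 1, Var 2, num q],
           All_num 6 (Imp (Less (Var 6) (Var 8)) (Fact [num 3, Var 1, Var 2, num 1, Var 6, num 1])),
           Fact [num 3, Var 1, Var 2, num 1, Var 8, Var 5], Neg (Eq (Var 5) (num 1)), Fact [num 0, Var 1, Var 8, Var 7]])
        (conjs [Fact [num 1, Var 1, (Plus (Var 2) One), num (answer_state M q)],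
           Fact [num 2, Var 1, (Plus (Var 2) One), num 1, num 0],
           All_num 6 (Conj (Imp (Less (Var 6) (Var 7)) (Fact [num 3, Var 1, (Plus (Var 2) One), num 1, Var 6, num 1]))
             (Imp (Neg (Less (Var 6) (Var 7))) (Fact [num 3, Var 1, (Plus (Var 2) One), num 1, Var 6, num 0]))),
           All_num 3 (Imp (Neg (Eq (Var 3) (num 1))) (Conj
             (All_num 4 (Imp (Fact [num 2, Var 1, Var 2, Var 3, Var 4]) (Fact [num 2, Var 1, (Plus (Var 2) One), Var 3, Var 4])))
             (Alls [6, 9] (Imp (Fact [num 3, Var 1, Var 2, Var 3, Var 6, Var 9])
               (Fact [num 3, Var 1, (Plus (Var 2) One), Var 3, Var 6, Var 9])))))]))"

text \<open>\<open>delta\<close> is an arbitrary function, but its table on the legal states and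
  symbols is finite and is written out entry by entry; likewise for the query states.\<close>

definition closed_form :: "oracle_machine \<Rightarrow> nat list \<Rightarrow> form" where
  "closed_form M as = conjs
    ([extension_rule, Fact [num 7, Zero, Var 0], input_rule as, start_rule M, read_rule, write_rule, move_rule] @
     map (\<lambda>(q, xs). delta_rule M q xs)
       (List.product (filter (\<lambda>q. q \<noteq> halt_state M \<and> q \<notin> query_states M) [0..<num_states M])
         (List.n_lists (num_tapes M) [0..<num_symbols M])) @
     map (query_rule M) (filter (\<lambda>q. q \<noteq> halt_state M \<and> q \<in> query_states M) [0..<num_states M]))"

lemmas rule_defs = extension_rule_def input_rule_def start_rule_def read_rule_def write_rule_def
  move_rule_def delta_rule_def query_rule_def

lemma sat_extension_rule:
  "sat e V extension_rule \<longleftrightarrow>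
    (\<forall>r n. \<exists>b0. \<forall>b. \<not> b < b0 \<longrightarrow> (\<exists>r'. enc [0, r', n, b] \<in> V 0 \<and>
       (\<forall>m a. m < n \<and> enc [0, r, m, a] \<in> V 0 \<longrightarrow> enc [0, r', m, a] \<in> V 0)))"
  unfolding extension_rule_def by simp

lemma sat_input_rule:
  "sat e V (input_rule as) \<longleftrightarrow>
    (\<forall>i c a c'. enc [7, i, c] \<in> V 0 \<and> c + c = 2 + ((a + c') * (a + c' + 1) + (a + a)) \<and> a \<in> set as \<longrightarrow>
       enc [7, i + 1, c'] \<in> V 0 \<and> (\<forall>r. enc [3, r, 0, 0, i, a + 1] \<in> V 0))"
  unfolding input_rule_def by simp

lemma sat_start_rule:
  "sat e V (start_rule M) \<longleftrightarrow>
    (\<forall>i r. enc [7, i, 0] \<in> V 0 \<longrightarrow>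
       enc [1, r, 0, start_state M] \<in> V 0 \<and>
       (\<forall>k. enc [2, r, 0, k, 0] \<in> V 0) \<and>
       (\<forall>j. \<not> j < i \<longrightarrow> enc [3, r, 0, 0, j, 0] \<in> V 0) \<and>
       (\<forall>k j. 0 < k \<longrightarrow> enc [3, r, 0, k, j, 0] \<in> V 0))"
  unfolding start_rule_def by simp

lemma sat_read_rule:
  "sat e V read_rule \<longleftrightarrow>
    (\<forall>r t k h a. enc [2, r, t, k, h] \<in> V 0 \<and> enc [3, r, t, k, h, a] \<in> V 0 \<longrightarrow> enc [4, r, t, k, a] \<in> V 0)"
  unfolding read_rule_def by simp

lemma sat_write_rule:
  "sat e V write_rule \<longleftrightarrow>
    (\<forall>r t k a h. enc [5, r, t, k, a] \<in> V 0 \<and> enc [2, r, t, k, h] \<in> V 0 \<longrightarrow>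
       enc [3, r, t + 1, k, h, a] \<in> V 0 \<and>
       (\<forall>i b. i \<noteq> h \<and> enc [3, r, t, k, i, b] \<in> V 0 \<longrightarrow> enc [3, r, t + 1, k, i, b] \<in> V 0))"
  unfolding write_rule_def by simp

lemma sat_move_rule:
  "sat e V move_rule \<longleftrightarrow>
    (\<forall>r t k h g. enc [2, r, t, k, h] \<in> V 0 \<longrightarrow>
       (enc [6, r, t, k, 0] \<in> V 0 \<longrightarrow> enc [2, r, t + 1, k, h] \<in> V 0) \<and>
       (enc [6, r, t, k, 1] \<in> V 0 \<longrightarrow> enc [2, r, t + 1, k, h + 1] \<in> V 0) \<and>
       (enc [6, r, t, k, 2] \<in> V 0 \<and> (h = g + 1 \<or> h = 0 \<and> g = 0) \<longrightarrow> enc [2, r, t + 1, k, g] \<in> V 0))"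
  unfolding move_rule_def by simp

lemma sat_delta_rule:
  "sat e V (delta_rule M q xs) \<longleftrightarrow>
    (\<forall>r t. enc [1, r, t, q] \<in> V 0 \<and> (\<forall>k<num_tapes M. enc [4, r, t, k, xs ! k] \<in> V 0) \<longrightarrow>
         enc [1, r, t + 1, fst (delta M q xs)] \<in> V 0 \<and>
         (\<forall>k<num_tapes M. enc [5, r, t, k, fst (snd (delta M q xs) ! k)] \<in> V 0 \<and>
            enc [6, r, t, k, move_code (snd (snd (delta M q xs) ! k))] \<in> V 0))"
  unfolding delta_rule_def by (simp, simp add: Ball_def)

lemma sat_query_rule:
  "sat e V (query_rule M q) \<longleftrightarrow>
    (\<forall>r t n b a. enc [1, r, t, q] \<in> V 0 \<and> (\<forall>i. i < n \<longrightarrow> enc [3, r, t, 1, i, 1] \<in> V 0) \<and>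
          enc [3, r, t, 1, n, a] \<in> V 0 \<and> a \<noteq> 1 \<and> enc [0, r, n, b] \<in> V 0 \<longrightarrow>
         enc [1, r, t + 1, answer_state M q] \<in> V 0 \<and>
         enc [2, r, t + 1, 1, 0] \<in> V 0 \<and>
         (\<forall>i. (i < b \<longrightarrow> enc [3, r, t + 1, 1, i, 1] \<in> V 0) \<and> (\<not> i < b \<longrightarrow> enc [3, r, t + 1, 1, i, 0] \<in> V 0)) \<and>
         (\<forall>k. k \<noteq> 1 \<longrightarrow> (\<forall>h. enc [2, r, t, k, h] \<in> V 0 \<longrightarrow> enc [2, r, t + 1, k, h] \<in> V 0) \<and>
            (\<forall>i c. enc [3, r, t, k, i, c] \<in> V 0 \<longrightarrow> enc [3, r, t + 1, k, i, c] \<in> V 0)))"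
  unfolding query_rule_def by simp

lemma set_n_lists_upt: "set (List.n_lists n [0..<m]) = {xs. length xs = n \<and> set xs \<subseteq> {..<m}}"
  by (auto simp: set_n_lists)

lemma sat_closed_form: "sat e V (closed_form M as) \<longleftrightarrow> closed M as (e 0) (V 0)"
proof -
  have *: "(\<forall>p\<in>set (List.product (filter P [0..<m]) (List.n_lists n [0..<l])). f p) \<longleftrightarrow>
    (\<forall>q xs. q < m \<and> P q \<and> length xs = n \<and> set xs \<subseteq> {..<l} \<longrightarrow> f (q, xs))" for P m n l f
    by (auto simp: set_n_lists_upt)
  have **: "(\<forall>q\<in>set (filter P [0..<m]). f q) \<longleftrightarrow> (\<forall>q. q < m \<and> P q \<longrightarrow> f q)" for P m f
    by auto
  have ***: "sat e V (Fact [num 7, Zero, Var 0]) \<longleftrightarrow> enc [7, 0, e 0] \<in> V 0" by simp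
  show ?thesis
    unfolding closed_form_def closed_def sat_conjs set_append ball_Un set_map ball_simps list.set
      * ** *** prod.case sat_extension_rule sat_input_rule sat_start_rule sat_read_rule sat_write_rule
      sat_move_rule sat_delta_rule sat_query_rule
    by (simp only: conj_assoc simp_thms)
qed

lemma matrix_closed_form: "matrix (closed_form M as)"
  unfolding closed_form_def rule_defs by auto

lemma free_num_closed_form: "free_num (closed_form M as) \<subseteq> {0}"
  unfolding closed_form_def rule_defs by (auto split: if_splits)

section \<open>True facts in a closed set\<close>

lemmas closed_extension = closed_def[THEN iffD1, THEN conjunct1]
lemmas closed_input0 = closed_def[THEN iffD1, THEN conjunct2, THEN conjunct1]
lemmas closed_input = closed_def[THEN iffD1, THEN conjunct2, THEN conjunct2, THEN conjunct1]
lemmas closed_start = closed_def[THEN iffD1, THEN conjunct2, THEN conjunct2, THEN conjunct2, THEN conjunct1]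
lemmas closed_read = closed_def[THEN iffD1, THEN conjunct2, THEN conjunct2, THEN conjunct2,
    THEN conjunct2, THEN conjunct1]
lemmas closed_write = closed_def[THEN iffD1, THEN conjunct2, THEN conjunct2, THEN conjunct2,
    THEN conjunct2, THEN conjunct2, THEN conjunct1]
lemmas closed_move = closed_def[THEN iffD1, THEN conjunct2, THEN conjunct2, THEN conjunct2,
    THEN conjunct2, THEN conjunct2, THEN conjunct2, THEN conjunct1]
lemmas closed_delta = closed_def[THEN iffD1, THEN conjunct2, THEN conjunct2, THEN conjunct2,
    THEN conjunct2, THEN conjunct2, THEN conjunct2, THEN conjunct2, THEN conjunct1]
lemmas closed_query = closed_def[THEN iffD1, THEN conjunct2, THEN conjunct2, THEN conjunct2,
    THEN conjunct2, THEN conjunct2, THEN conjunct2, THEN conjunct2, THEN conjunct2]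

lemma act_eq: "act p u = ((fst u)(snd u := fst p), move_head (snd p) (snd u))"
  by (cases p; cases u) simp

lemma read_symbol_eq: "read_symbol u = fst u (snd u)"
  by (cases u) simp

lemma step_eq:
  "step M B c =
     (if fst c = halt_state M then c
      else if fst c \<in> query_states M then
        (answer_state M (fst c), (snd c)[1 := unary_tape (B (query_number (snd c ! 1)))])
      else (fst (delta M (fst c) (map read_symbol (snd c))),
        map2 act (snd (delta M (fst c) (map read_symbol (snd c)))) (snd c)))"
  by (cases c) (auto simp: step.simps split: prod.split)

text \<open>Symbols stay in range, so that only the tabulated part of \<open>delta\<close> is used,
  and tapes are blank far out, so that \<open>query_number\<close> is the least element of a
  nonempty set.\<close>

definition regular :: "oracle_machine \<Rightarrow> configuration \<Rightarrow> bool" where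
  "regular M c \<longleftrightarrow> fst c < num_states M \<and> length (snd c) = num_tapes M \<and>
     (\<forall>k<num_tapes M. (\<forall>i. fst (snd c ! k) i < num_symbols M) \<and> (\<exists>m. \<forall>i\<ge>m. fst (snd c ! k) i = 0))"

lemma delta_ok:
  assumes "oracle_TM \<Sigma> M" "regular M c"
  defines "d \<equiv> delta M (fst c) (map read_symbol (snd c))"
  shows "set (map read_symbol (snd c)) \<subseteq> {..<num_symbols M}"
    and "fst d < num_states M" "length (snd d) = num_tapes M"
    and "\<And>k. k < num_tapes M \<Longrightarrow> fst (snd d ! k) < num_symbols M"
proof -
  have len: "length (map read_symbol (snd c)) = num_tapes M" and q: "fst c < num_states M"
    using assms(2) by (auto simp: regular_def)
  show set: "set (map read_symbol (snd c)) \<subseteq> {..<num_symbols M}"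
  proof -
    have "read_symbol (snd c ! i) < num_symbols M" if "i < num_tapes M" for i
      using assms(2) that by (simp add: regular_def read_symbol_eq)
    then have "\<forall>u\<in>set (snd c). read_symbol u < num_symbols M"
      using len by (metis in_set_conv_nth length_map)
    then show ?thesis by (simp add: image_subset_iff)
  qed
  have *: "fst d < num_states M \<and> length (snd d) = num_tapes M \<and> (\<forall>(s, m)\<in>set (snd d). s < num_symbols M)"
    using assms(1) q len set unfolding oracle_TM_def d_def by blast
  then show "fst d < num_states M" "length (snd d) = num_tapes M" by blast+
  show "fst (snd d ! k) < num_symbols M" if "k < num_tapes M" for k
  proof -
    have "snd d ! k \<in> set (snd d)" using * that by simp
    then show ?thesis using * by (simp add: case_prod_beta)
  qed
qed

lemma regular_step:
  assumes "oracle_TM \<Sigma> M" "regular M c"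
  shows "regular M (step M B c)"
proof -
  let ?K = "num_tapes M"
  have N: "2 \<le> num_symbols M" using assms(1) by (simp add: oracle_TM_def)
  have len: "length (snd c) = ?K" using assms(2) by (simp add: regular_def)
  consider "fst c = halt_state M" | "fst c \<noteq> halt_state M" "fst c \<in> query_states M"
    | "fst c \<noteq> halt_state M" "fst c \<notin> query_states M" by blast
  then show ?thesis
  proof cases
    case 1
    then show ?thesis using assms by (simp add: step_eq)
  next
    case 2
    have "answer_state M (fst c) < num_states M" using assms(1) 2 by (auto simp: oracle_TM_def)
    moreover have "fst (unary_tape b) i < num_symbols M" "\<exists>m. \<forall>i\<ge>m. fst (unary_tape b) i = 0" for b i
      using N by (auto simp: unary_tape_def intro!: exI[of _ b])
    moreover have "(snd c)[1 := u] ! k = (if k = 1 then u else snd c ! k)" if "k < ?K" for k u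
      using that len by (simp add: nth_list_update)
    ultimately show ?thesis
      using assms(2) 2 len unfolding regular_def step_eq by auto
  next
    case 3
    note d = delta_ok[OF assms]
    let ?d = "delta M (fst c) (map read_symbol (snd c))"
    have k: "map2 act (snd ?d) (snd c) ! k = act (snd ?d ! k) (snd c ! k)" if "k < ?K" for k
      using that d(3) len by simp
    have "(\<forall>i. fst (act (snd ?d ! k) (snd c ! k)) i < num_symbols M) \<and>
      (\<exists>m. \<forall>i\<ge>m. fst (act (snd ?d ! k) (snd c ! k)) i = 0)" if "k < ?K" for k
    proof -
      have "\<exists>m. \<forall>i\<ge>m. fst (snd c ! k) i = 0" using assms(2) that unfolding regular_def by blast
      then obtain m where m: "\<forall>i\<ge>m. fst (snd c ! k) i = 0" by blast
      have "\<forall>i\<ge>max m (Suc (snd (snd c ! k))). fst (act (snd ?d ! k) (snd c ! k)) i = 0"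
        using m by (auto simp: act_eq)
      moreover have "\<forall>i. fst (act (snd ?d ! k) (snd c ! k)) i < num_symbols M"
        using d(4)[OF that] assms(2) that by (auto simp: act_eq regular_def)
      ultimately show ?thesis by blast
    qed
    then show ?thesis using 3 d k len unfolding regular_def step_eq by simp
  qed
qed

lemma regular_init:
  assumes "oracle_TM \<Sigma> M" "S \<in> lists \<Sigma>"
  shows "regular M (initial_config M S)"
proof -
  have N: "2 \<le> num_symbols M" "2 \<le> num_tapes M" and s: "start_state M < num_states M"
    and \<Sigma>: "\<forall>a\<in>\<Sigma>. Suc a < num_symbols M" using assms(1) by (auto simp: oracle_TM_def)
  have "fst (input_tape S) i < num_symbols M" for i
    using \<Sigma> assms(2) N by (auto simp: input_tape_def in_lists_conv_set)
  moreover have "\<forall>i\<ge>length S. fst (input_tape S) i = 0" by (auto simp: input_tape_def)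
  moreover have "fst blank_tape i = 0" for i by (simp add: blank_tape_def)
  ultimately show ?thesis
    unfolding regular_def initial_config_def using N s by (auto simp: nth_Cons split: nat.splits)
qed

text \<open>Only an inclusion: \<open>Y\<close> may also contain facts that contradict
  \<open>c\<close>.\<close>

definition describes :: "oracle_machine \<Rightarrow> nat set \<Rightarrow> nat \<Rightarrow> nat \<Rightarrow> configuration \<Rightarrow> bool" where
  "describes M Y r t c \<longleftrightarrow> enc [1, r, t, fst c] \<in> Y \<and>
     (\<forall>k<num_tapes M. enc [2, r, t, k, snd (snd c ! k)] \<in> Y \<and>
       (\<forall>i. enc [3, r, t, k, i, fst (snd c ! k) i] \<in> Y))"

lemma query_number_regular:
  assumes "\<exists>m. \<forall>i\<ge>m. fst u i = 0"
  shows "fst u (query_number u) \<noteq> 1" "i < query_number u \<Longrightarrow> fst u i = 1"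
proof -
  have "\<exists>i. fst u i \<noteq> 1" using assms by (metis le_refl zero_neq_one)
  then show "fst u (query_number u) \<noteq> 1" unfolding query_number_def by (rule LeastI_ex)
  show "i < query_number u \<Longrightarrow> fst u i = 1" unfolding query_number_def using not_less_Least by blast
qed

text \<open>The oracle fact is demanded only at the argument now on the oracle tape, so a run that
  agrees with \<open>B\<close> below a bound can be used.\<close>

lemma describes_step:
  assumes cl: "closed M as s Y" and TM: "oracle_TM \<Sigma> M" and reg: "regular M c"
    and "fst c \<noteq> halt_state M" and desc: "describes M Y r t c"
    and orc: "enc [0, r, query_number (snd c ! 1), B (query_number (snd c ! 1))] \<in> Y"
  shows "describes M Y r (t + 1) (step M B c)"
proof -
  let ?K = "num_tapes M"
  have len: "length (snd c) = ?K" and K: "2 \<le> ?K" and q: "fst c < num_states M"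
    using reg TM by (auto simp: regular_def oracle_TM_def)
  have st: "enc [1, r, t, fst c] \<in> Y"
    and hd: "\<And>k. k < ?K \<Longrightarrow> enc [2, r, t, k, snd (snd c ! k)] \<in> Y"
    and ce: "\<And>k i. k < ?K \<Longrightarrow> enc [3, r, t, k, i, fst (snd c ! k) i] \<in> Y"
    using desc unfolding describes_def by blast+
  show ?thesis
  proof (cases "fst c \<in> query_states M")
    case True
    let ?u = "snd c ! 1"
    let ?n = "query_number ?u"
    have "\<exists>m. \<forall>i\<ge>m. fst ?u i = 0" using reg K unfolding regular_def by auto
    note n = query_number_regular[OF this]
    have pre: "\<forall>i. i < ?n \<longrightarrow> enc [3, r, t, 1, i, 1] \<in> Y"
    proof (intro allI impI)
      fix i assume "i < ?n"
      then show "enc [3, r, t, 1, i, 1] \<in> Y" using ce[of 1 i] n(2)[of i] K by (simp del: enc.simps)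
    qed
    have cn: "enc [3, r, t, 1, ?n, fst ?u ?n] \<in> Y" using ce[of 1 ?n] K by (simp del: enc.simps)
    have R: "enc [1, r, t + 1, answer_state M (fst c)] \<in> Y \<and>
         enc [2, r, t + 1, 1, 0] \<in> Y \<and>
         (\<forall>i. (i < B ?n \<longrightarrow> enc [3, r, t + 1, 1, i, 1] \<in> Y) \<and> (\<not> i < B ?n \<longrightarrow> enc [3, r, t + 1, 1, i, 0] \<in> Y)) \<and>
         (\<forall>k. k \<noteq> 1 \<longrightarrow> (\<forall>h. enc [2, r, t, k, h] \<in> Y \<longrightarrow> enc [2, r, t + 1, k, h] \<in> Y) \<and>
            (\<forall>i c. enc [3, r, t, k, i, c] \<in> Y \<longrightarrow> enc [3, r, t + 1, k, i, c] \<in> Y))"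
      by (rule closed_query[OF cl, THEN spec[of _ "fst c"], THEN mp, THEN spec[of _ r], THEN spec[of _ t],
            THEN spec[of _ ?n], THEN spec[of _ "B ?n"], THEN spec[of _ "fst ?u ?n"], THEN mp])
        (use q True \<open>fst c \<noteq> halt_state M\<close> st pre cn n(1) orc in \<open>simp_all only: simp_thms\<close>)
    have stp: "step M B c = (answer_state M (fst c), (snd c)[1 := unary_tape (B ?n)])"
      using True \<open>fst c \<noteq> halt_state M\<close> by (simp add: step_eq)
    show ?thesis unfolding describes_def stp fst_conv snd_conv
    proof (intro conjI allI impI)
      show "enc [1, r, t + 1, answer_state M (fst c)] \<in> Y" using R by blast
    next
      fix k assume k: "k < ?K"
      show "enc [2, r, t + 1, k, snd ((snd c)[1 := unary_tape (B ?n)] ! k)] \<in> Y"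
      proof (cases "k = 1")
        case True
        then show ?thesis using R len k by (simp add: unary_tape_def del: enc.simps)
      next
        case False
        then show ?thesis using R hd[OF k] by (simp del: enc.simps)
      qed
      fix i
      show "enc [3, r, t + 1, k, i, fst ((snd c)[1 := unary_tape (B ?n)] ! k) i] \<in> Y"
      proof (cases "k = 1")
        case True
        then show ?thesis using R len k by (simp add: unary_tape_def del: enc.simps)
      next
        case False
        then show ?thesis using R ce[OF k] by (simp del: enc.simps)
      qed
    qed
  next
    case False
    let ?xs = "map read_symbol (snd c)"
    let ?d = "delta M (fst c) ?xs"
    note d = delta_ok[OF TM reg]
    have rd: "\<forall>k<?K. enc [4, r, t, k, ?xs ! k] \<in> Y"
    proof (intro allI impI)
      fix k assume k: "k < ?K"
      have "?xs ! k = fst (snd c ! k) (snd (snd c ! k))" using k len by (simp add: read_symbol_eq)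
      then show "enc [4, r, t, k, ?xs ! k] \<in> Y"
        using closed_read[OF cl] hd[OF k] ce[OF k, of "snd (snd c ! k)"] by (simp only:)
    qed
    have R: "enc [1, r, t + 1, fst ?d] \<in> Y \<and> (\<forall>k<?K. enc [5, r, t, k, fst (snd ?d ! k)] \<in> Y \<and>
            enc [6, r, t, k, move_code (snd (snd ?d ! k))] \<in> Y)"
      by (rule closed_delta[OF cl, THEN spec, THEN spec, THEN mp, THEN spec, THEN spec, THEN mp])
        (use q False \<open>fst c \<noteq> halt_state M\<close> d(1) len st rd in \<open>simp_all only: simp_thms length_map\<close>)
    have stp: "step M B c = (fst ?d, map2 act (snd ?d) (snd c))"
      using False \<open>fst c \<noteq> halt_state M\<close> by (simp add: step_eq)
    have nth: "map2 act (snd ?d) (snd c) ! k =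
        ((fst (snd c ! k))(snd (snd c ! k) := fst (snd ?d ! k)),
          move_head (snd (snd ?d ! k)) (snd (snd c ! k)))" if "k < ?K" for k
      using that d(3) len by (simp add: act_eq)
    show ?thesis unfolding describes_def stp fst_conv snd_conv
    proof (intro conjI allI impI)
      show "enc [1, r, t + 1, fst ?d] \<in> Y" using R by blast
    next
      fix k assume k: "k < ?K"
      let ?p = "snd ?d ! k" and ?u = "snd c ! k"
      have wr: "enc [5, r, t, k, fst ?p] \<in> Y" and mv: "enc [6, r, t, k, move_code (snd ?p)] \<in> Y"
        using R k by blast+
      note M = closed_move[OF cl, THEN spec, THEN spec, THEN spec, THEN spec, THEN spec, THEN mp, OF hd[OF k]]
      show "enc [2, r, t + 1, k, snd (map2 act (snd ?d) (snd c) ! k)] \<in> Y"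
      proof (cases "snd ?p")
        case Go_Left
        then have "enc [6, r, t, k, 2] \<in> Y" using mv by (simp del: enc.simps)
        moreover have "snd ?u = (snd ?u - 1) + 1 \<or> snd ?u = 0 \<and> snd ?u - 1 = 0" by auto
        ultimately have "enc [2, r, t + 1, k, snd ?u - 1] \<in> Y" using M[of "snd ?u - 1"] by blast
        then show ?thesis unfolding nth[OF k] using Go_Left by (simp del: enc.simps)
      next
        case Stay
        then have "enc [6, r, t, k, 0] \<in> Y" using mv by (simp del: enc.simps)
        then have "enc [2, r, t + 1, k, snd ?u] \<in> Y" using M[of 0] by blast
        then show ?thesis unfolding nth[OF k] using Stay by (simp del: enc.simps)
      next
        case Go_Right
        then have "enc [6, r, t, k, 1] \<in> Y" using mv by (simp del: enc.simps)
        then have "enc [2, r, t + 1, k, snd ?u + 1] \<in> Y" using M[of 0] by blast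
        then show ?thesis unfolding nth[OF k] using Go_Right by (simp del: enc.simps)
      qed
      fix i
      note W = closed_write[OF cl, THEN spec, THEN spec, THEN spec, THEN spec, THEN spec, THEN mp,
          OF conjI[OF wr hd[OF k]]]
      show "enc [3, r, t + 1, k, i, fst (map2 act (snd ?d) (snd c) ! k) i] \<in> Y"
      proof (cases "i = snd ?u")
        case True
        then show ?thesis unfolding nth[OF k] using W by (simp del: enc.simps)
      next
        case False
        then have "enc [3, r, t + 1, k, i, fst ?u i] \<in> Y" using W ce[OF k, of i] by blast
        then show ?thesis unfolding nth[OF k] using False by (simp del: enc.simps)
      qed
    qed
  qed
qed

lemma double_list_encode:
  "list_encode (a # xs) + list_encode (a # xs) =
    2 + ((a + list_encode xs) * (a + list_encode xs + 1) + (a + a))"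
proof -
  have "triangle k + triangle k = k * (k + 1)" for k
    by (induction k) auto
  then show ?thesis by (simp add: prod_encode_def)
qed

lemma describes_init:
  assumes cl: "closed M as (list_encode S) Y" and S: "S \<in> lists (set as)" and K: "2 \<le> num_tapes M"
  shows "describes M Y r 0 (initial_config M S)"
proof -
  have rest: "i \<le> length S \<Longrightarrow> enc [7, i, list_encode (drop i S)] \<in> Y" for i
  proof (induction i)
    case 0
    then show ?case using closed_input0[OF cl] by (simp del: enc.simps)
  next
    case (Suc i)
    then have i: "i < length S" and IH: "enc [7, i, list_encode (drop i S)] \<in> Y" by simp_all
    have d: "drop i S = S ! i # drop (Suc i) S" using i by (rule Cons_nth_drop_Suc[symmetric])
    have "S ! i \<in> set as" using S i by (auto simp: in_lists_conv_set)
    then have "enc [7, i + 1, list_encode (drop (Suc i) S)] \<in> Y"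
      using closed_input[OF cl, THEN spec, THEN spec, THEN spec, THEN spec, THEN mp, THEN conjunct1,
          OF conjI[OF IH[unfolded d] conjI[OF double_list_encode]]] by blast
    then show ?case by (simp del: enc.simps)
  qed
  have letter: "enc [3, r, 0, 0, i, Suc (S ! i)] \<in> Y" if i: "i < length S" for i
  proof -
    have d: "drop i S = S ! i # drop (Suc i) S" using i by (rule Cons_nth_drop_Suc[symmetric])
    have R: "enc [7, i, list_encode (S ! i # drop (Suc i) S)] \<in> Y" using rest[of i] i d by (simp del: enc.simps)
    have "S ! i \<in> set as" using S i by (auto simp: in_lists_conv_set)
    then have "enc [3, r, 0, 0, i, S ! i + 1] \<in> Y"
      using closed_input[OF cl, THEN spec, THEN spec, THEN spec, THEN spec, THEN mp, THEN conjunct2,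
          OF conjI[OF R conjI[OF double_list_encode]]] by blast
    then show ?thesis by (simp del: enc.simps)
  qed
  have "enc [7, length S, 0] \<in> Y" using rest[of "length S"] by (simp del: enc.simps)
  then have st: "enc [1, r, 0, start_state M] \<in> Y \<and>
       (\<forall>k. enc [2, r, 0, k, 0] \<in> Y) \<and>
       (\<forall>j. \<not> j < length S \<longrightarrow> enc [3, r, 0, 0, j, 0] \<in> Y) \<and>
       (\<forall>k j. 0 < k \<longrightarrow> enc [3, r, 0, k, j, 0] \<in> Y)"
    using closed_start[OF cl] by blast
  have tape: "(input_tape S # replicate (num_tapes M - 1) blank_tape) ! k =
      (if k = 0 then input_tape S else blank_tape)" if "k < num_tapes M" for k
    using that by (auto simp: nth_Cons split: nat.splits)
  show ?thesis
    unfolding describes_def initial_config_def fst_conv snd_conv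
  proof (intro conjI allI impI)
    show "enc [1, r, 0, start_state M] \<in> Y" using st by blast
    fix k assume k: "k < num_tapes M"
    show "enc [2, r, 0, k, snd ((input_tape S # replicate (num_tapes M - 1) blank_tape) ! k)] \<in> Y"
      unfolding tape[OF k] using st by (simp add: input_tape_def blank_tape_def del: enc.simps)
    fix i
    show "enc [3, r, 0, k, i, fst ((input_tape S # replicate (num_tapes M - 1) blank_tape) ! k) i] \<in> Y"
    proof (cases "k = 0")
      case True
      then show ?thesis unfolding tape[OF k] using st letter[of i]
        by (simp add: input_tape_def del: enc.simps)
    next
      case False
      then show ?thesis unfolding tape[OF k] using st
        by (simp add: blank_tape_def del: enc.simps)
    qed
  qed
qed

text \<open>Extending run after run, always by a value at least \<open>A n\<close>, defines an
  oracle \<open>B\<close> above \<open>A\<close>. With \<open>B\<close> the machine halts within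
  \<open>t\<close> steps, and a run holding the values of \<open>B\<close> at the finitely many
  arguments involved makes \<open>Y\<close> follow this computation up to its halting fact.\<close>

lemma closed_halts:
  assumes cl: "closed M as (list_encode S) Y" and TM: "oracle_TM (set as) M" and S: "S \<in> lists (set as)"
    and halts: "\<And>B. (\<forall>n. A n \<le> B n) \<Longrightarrow> halts_on M B S"
  shows "\<exists>r t. enc [1, r, t, halt_state M] \<in> Y"
proof -
  define P where "P r n r' b \<longleftrightarrow> A n \<le> b \<and> enc [0, r', n, b] \<in> Y \<and>
    (\<forall>m a. m < n \<and> enc [0, r, m, a] \<in> Y \<longrightarrow> enc [0, r', m, a] \<in> Y)" for r n r' b
  have "\<forall>r n. \<exists>r' b. P r n r' b"
  proof (intro allI)
    fix r n
    obtain b0 where b0: "\<forall>b. \<not> b < b0 \<longrightarrow> (\<exists>r'. enc [0, r', n, b] \<in> Y \<and>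
       (\<forall>m a. m < n \<and> enc [0, r, m, a] \<in> Y \<longrightarrow> enc [0, r', m, a] \<in> Y))"
      using closed_extension[OF cl, THEN spec[of _ r], THEN spec[of _ n]] by (rule exE)
    have "\<not> max b0 (A n) < b0" by simp
    then obtain r' where "enc [0, r', n, max b0 (A n)] \<in> Y \<and>
       (\<forall>m a. m < n \<and> enc [0, r, m, a] \<in> Y \<longrightarrow> enc [0, r', m, a] \<in> Y)" using b0 by blast
    then show "\<exists>r' b. P r n r' b"
      by (intro exI[of _ r'] exI[of _ "max b0 (A n)"]) (simp add: P_def del: enc.simps)
  qed
  then obtain f g where "\<forall>r n. P r n (f r n) (g r n)" by metis
  then have fg: "A n \<le> g r n \<and> enc [0, f r n, n, g r n] \<in> Y \<and>
    (\<forall>m a. m < n \<and> enc [0, r, m, a] \<in> Y \<longrightarrow> enc [0, f r n, m, a] \<in> Y)" for r n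
    unfolding P_def by blast
  \<comment> \<open>The run \<open>R n\<close> has the values of \<open>B\<close> at all arguments
    below \<open>n\<close>; the initial run 0 is an arbitrary choice.\<close>
  define R where "R = rec_nat 0 (\<lambda>n r. f r n)"
  have RS: "R (Suc n) = f (R n) n" for n by (simp add: R_def)
  define B where "B n = g (R n) n" for n
  have AB: "\<forall>n. A n \<le> B n" using fg by (simp add: B_def)
  have orc: "m < n \<Longrightarrow> enc [0, R n, m, B m] \<in> Y" for m n
  proof (induction n)
    case (Suc n)
    show ?case
    proof (cases "m = n")
      case True
      then show ?thesis using fg[where r = "R n" and n = n] unfolding RS B_def by blast
    next
      case False
      then have "m < n" using Suc.prems by simp
      then show ?thesis using Suc.IH fg[where r = "R n" and n = n] unfolding RS by blast
    qed
  qed simp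
  let ?c = "\<lambda>t. (step M B ^^ t) (initial_config M S)"
  obtain t where t: "fst (?c t) = halt_state M" using halts[OF AB] unfolding halts_on_def by blast
  \<comment> \<open>Exceeds what the oracle tape shows at any of the \<open>t\<close> steps, queries
    or not, as \<open>describes_step\<close> speaks of each of them.\<close>
  define n where "n = Suc (\<Sum>i<t. query_number (snd (?c i) ! 1))"
  have n: "query_number (snd (?c i) ! 1) < n" if "i < t" for i
    unfolding n_def less_Suc_eq_le
    by (rule member_le_sum[of i "{..<t}" "\<lambda>i. query_number (snd (?c i) ! 1)"]) (use that in auto)
  have reg: "regular M (?c i)" for i
    by (induction i) (auto intro: regular_init[OF TM S] regular_step[OF TM])
  \<comment> \<open>No rule applies in the halting state, so the description may end before time
    \<open>t\<close>; but then the desired fact is already there.\<close>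
  have "(\<exists>j\<le>i. enc [1, R n, j, halt_state M] \<in> Y) \<or> describes M Y (R n) i (?c i)" if "i \<le> t" for i
    using that
  proof (induction i)
    case 0
    have "2 \<le> num_tapes M" using TM by (simp add: oracle_TM_def)
    from describes_init[OF cl S this] show ?case by simp
  next
    case (Suc i)
    show ?case
    proof (cases "\<exists>j\<le>i. enc [1, R n, j, halt_state M] \<in> Y")
      case True
      then show ?thesis by (meson le_SucI)
    next
      case False
      have "i \<le> t" using Suc.prems by simp
      then have D: "describes M Y (R n) i (?c i)" using Suc.IH False by blast
      then have "enc [1, R n, i, fst (?c i)] \<in> Y" unfolding describes_def by blast
      then have "fst (?c i) \<noteq> halt_state M" using False by (metis le_refl)
      moreover have "enc [0, R n, query_number (snd (?c i) ! 1), B (query_number (snd (?c i) ! 1))] \<in> Y"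
        by (rule orc, rule n) (use Suc.prems in simp)
      ultimately have "describes M Y (R n) (i + 1) (step M B (?c i))"
        by (intro describes_step[OF cl TM reg _ D])
      then show ?thesis by simp
    qed
  qed
  from this[of t] show ?thesis using t unfolding describes_def by auto
qed

section \<open>The set of true facts\<close>

lemma list_encode_eq_iff:
  "c + c = 2 + ((a + c') * (a + c' + 1) + (a + a)) \<longleftrightarrow> c = list_encode (a # list_decode c')"
  using double_list_encode[of a "list_decode c'"] by (auto simp del: list_encode.simps)

text \<open>\<open>start_rule\<close> and \<open>query_rule\<close> speak of all tape numbers, so
  the tapes that the machine lacks are taken to be blank for ever.\<close>

definition tape_at :: "configuration \<Rightarrow> nat \<Rightarrow> tape" where
  "tape_at c k = (if k < length (snd c) then snd c ! k else blank_tape)"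

text \<open>\<open>r\<close> codes a list of increments to initial values of \<open>A\<close>. These
  oracles are countably many, all lie above \<open>A\<close>, and any value from \<open>A n\<close>
  on can be reached at \<open>n\<close>.\<close>

definition finite_change :: "(nat \<Rightarrow> nat) \<Rightarrow> nat \<Rightarrow> nat \<Rightarrow> nat" where
  "finite_change A r n = A n + (if n < length (list_decode r) then list_decode r ! n else 0)"

definition run :: "oracle_machine \<Rightarrow> (nat \<Rightarrow> nat) \<Rightarrow> nat list \<Rightarrow> nat \<Rightarrow> nat \<Rightarrow> configuration" where
  "run M A S r t = (step M (finite_change A r) ^^ t) (initial_config M S)"

definition applies :: "oracle_machine \<Rightarrow> configuration \<Rightarrow> nat \<Rightarrow> bool" where
  "applies M c k \<longleftrightarrow> fst c \<noteq> halt_state M \<and> fst c \<notin> query_states M \<and> k < num_tapes M"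

definition act_at :: "oracle_machine \<Rightarrow> configuration \<Rightarrow> nat \<Rightarrow> nat \<times> move" where
  "act_at M c k = snd (delta M (fst c) (map read_symbol (snd c))) ! k"

text \<open>For a word outside \<open>lists \<Sigma>\<close> the facts on states, writing and moving
  are withheld: no halting fact may arise there, and \<open>delta\<close> could be called outside
  its legal arguments. The set stays closed, as \<open>start_rule\<close> never fires for such a
  word.\<close>

definition run_facts :: "oracle_machine \<Rightarrow> nat set \<Rightarrow> (nat \<Rightarrow> nat) \<Rightarrow> nat list \<Rightarrow> nat set" where
  "run_facts M \<Sigma> A S = {y.
     (\<exists>r n. y = enc [0, r, n, finite_change A r n]) \<or>
     (\<exists>r t. S \<in> lists \<Sigma> \<and> y = enc [1, r, t, fst (run M A S r t)]) \<or>
     (\<exists>r t k. y = enc [2, r, t, k, snd (tape_at (run M A S r t) k)]) \<or>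
     (\<exists>r t k i. y = enc [3, r, t, k, i, fst (tape_at (run M A S r t) k) i]) \<or>
     (\<exists>r t k. y = enc [4, r, t, k, read_symbol (tape_at (run M A S r t) k)]) \<or>
     (\<exists>r t k. S \<in> lists \<Sigma> \<and> applies M (run M A S r t) k \<and> y = enc [5, r, t, k, fst (act_at M (run M A S r t) k)]) \<or>
     (\<exists>r t k. S \<in> lists \<Sigma> \<and> applies M (run M A S r t) k \<and>
        y = enc [6, r, t, k, move_code (snd (act_at M (run M A S r t) k))]) \<or>
     (\<exists>i\<le>length S. set (take i S) \<subseteq> \<Sigma> \<and> y = enc [7, i, list_encode (drop i S)])}"

lemma mem_run_facts:
  "enc [0, r, n, b] \<in> run_facts M \<Sigma> A S \<longleftrightarrow> b = finite_change A r n"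
  "enc [1, r, t, q] \<in> run_facts M \<Sigma> A S \<longleftrightarrow> S \<in> lists \<Sigma> \<and> q = fst (run M A S r t)"
  "enc [2, r, t, k, h] \<in> run_facts M \<Sigma> A S \<longleftrightarrow> h = snd (tape_at (run M A S r t) k)"
  "enc [3, r, t, k, i, a] \<in> run_facts M \<Sigma> A S \<longleftrightarrow> a = fst (tape_at (run M A S r t) k) i"
  "enc [4, r, t, k, a] \<in> run_facts M \<Sigma> A S \<longleftrightarrow> a = read_symbol (tape_at (run M A S r t) k)"
  "enc [5, r, t, k, a] \<in> run_facts M \<Sigma> A S \<longleftrightarrow>
     S \<in> lists \<Sigma> \<and> applies M (run M A S r t) k \<and> a = fst (act_at M (run M A S r t) k)"
  "enc [6, r, t, k, m] \<in> run_facts M \<Sigma> A S \<longleftrightarrow>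
     S \<in> lists \<Sigma> \<and> applies M (run M A S r t) k \<and> m = move_code (snd (act_at M (run M A S r t) k))"
  "enc [7, i, c] \<in> run_facts M \<Sigma> A S \<longleftrightarrow>
     i \<le> length S \<and> set (take i S) \<subseteq> \<Sigma> \<and> c = list_encode (drop i S)"
  unfolding run_facts_def mem_Collect_eq enc.simps pr_inject
  by auto

lemma run_Suc: "run M A S r (t + 1) = step M (finite_change A r) (run M A S r t)"
  by (simp add: run_def)

lemma regular_run:
  assumes "oracle_TM \<Sigma> M" "S \<in> lists \<Sigma>"
  shows "regular M (run M A S r t)"
  unfolding run_def by (induction t) (auto intro: regular_init[OF assms] regular_step[OF assms(1)])

lemma tape_at_init: "tape_at (run M A S r 0) k = (if k = 0 then input_tape S else blank_tape)"
  by (auto simp: tape_at_def run_def initial_config_def nth_Cons split: nat.splits)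

lemma tape_at_delta:
  assumes "oracle_TM \<Sigma> M" "regular M c" "applies M c k"
  shows "tape_at (step M B c) k = act (act_at M c k) (tape_at c k)"
proof -
  have "length (snd c) = num_tapes M" using assms(2) by (simp add: regular_def)
  then show ?thesis using assms(3) delta_ok(3)[OF assms(1,2)]
    by (simp add: tape_at_def applies_def act_at_def step_eq)
qed

lemma tape_at_query:
  assumes "oracle_TM \<Sigma> M" "regular M c" "fst c \<noteq> halt_state M" "fst c \<in> query_states M"
  shows "tape_at (step M B c) k = (if k = 1 then unary_tape (B (query_number (tape_at c 1))) else tape_at c k)"
proof -
  have "length (snd c) = num_tapes M" "2 \<le> num_tapes M"
    using assms(1,2) by (auto simp: regular_def oracle_TM_def)
  then show ?thesis using assms(3,4) by (auto simp: tape_at_def step_eq nth_list_update)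
qed

lemma finite_change_extend:
  assumes "A n \<le> b"
  shows "\<exists>r'. finite_change A r' n = b \<and> (\<forall>m<n. finite_change A r' m = finite_change A r m)"
proof -
  \<comment> \<open>The differences are exact because all values involved are at least those of
    \<open>A\<close>; after \<open>n\<close> the oracle falls back to \<open>A\<close>.\<close>
  define l where "l = map (\<lambda>m. finite_change A r m - A m) [0..<n] @ [b - A n]"
  have "finite_change A (list_encode l) n = b" "m < n \<Longrightarrow> finite_change A (list_encode l) m = finite_change A r m" for m
    using assms by (auto simp: finite_change_def l_def nth_append)
  then show ?thesis by blast
qed

lemma closed_run_facts:
  assumes TM: "oracle_TM (set as) M"
  shows "closed M as (list_encode S) (run_facts M (set as) A S)"
  unfolding closed_def mem_run_facts
proof (intro conjI, goal_cases)
  case 1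
  show ?case
  proof (intro allI)
    fix r n
    show "\<exists>b0. \<forall>b. \<not> b < b0 \<longrightarrow> (\<exists>r'. b = finite_change A r' n \<and>
      (\<forall>m a. m < n \<and> a = finite_change A r m \<longrightarrow> a = finite_change A r' m))"
    proof (rule exI[of _ "A n"], intro allI impI)
      fix b assume "\<not> b < A n"
      then have "A n \<le> b" by simp
      from finite_change_extend[of A n b r, OF this] show "\<exists>r'. b = finite_change A r' n \<and>
        (\<forall>m a. m < n \<and> a = finite_change A r m \<longrightarrow> a = finite_change A r' m)" by metis
    qed
  qed
next
  \<comment> \<open>Cases 2 to 4 are the three parts of the initial input fact.\<close>
  case 2
  show ?case by simp
next
  case 3
  show ?case by simp
next
  case 4
  show ?case by simp
next
  case 5
  show ?case
  proof (intro allI impI, elim conjE)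
    fix i c a c'
    assume i: "set (take i S) \<subseteq> set as" and c: "c = list_encode (drop i S)" and a: "a \<in> set as"
      and "c + c = 2 + ((a + c') * (a + c' + 1) + (a + a))"
    then have "list_encode (drop i S) = list_encode (a # list_decode c')" by (simp only: list_encode_eq_iff)
    then have d: "drop i S = a # list_decode c'" by (simp only: list_encode_eq)
    then have len: "i < length S" by (metis drop_all list.distinct(1) not_less)
    then have Si: "S ! i = a" and dS: "drop (i + 1) S = list_decode c'" using d by (auto simp: Cons_nth_drop_Suc[symmetric])
    have "set (take (i + 1) S) \<subseteq> set as" using i a Si len by (simp add: take_Suc_conv_app_nth)
    moreover have "c' = list_encode (drop (i + 1) S)" unfolding dS by simp
    moreover have "a + 1 = fst (tape_at (run M A S r 0) 0) i" for r
      unfolding tape_at_init using Si len by (simp add: input_tape_def)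
    ultimately show "(i + 1 \<le> length S \<and> set (take (i + 1) S) \<subseteq> set as \<and> c' = list_encode (drop (i + 1) S)) \<and>
      (\<forall>r. a + 1 = fst (tape_at (run M A S r 0) 0) i)" using len by auto
  qed
next
  case 6
  show ?case
  proof (intro allI impI, elim conjE)
    fix i r
    assume i: "i \<le> length S" "set (take i S) \<subseteq> set as" "0 = list_encode (drop i S)"
    \<comment> \<open>Only the empty list has code 0, so by now the whole word is known to be over
      the alphabet.\<close>
    then have "drop i S = []" by (cases "drop i S") auto
    then have iS: "i = length S" using i(1) by simp
    then have "S \<in> lists (set as)" using i(2) by (auto simp: in_lists_conv_set)
    then show "(S \<in> lists (set as) \<and> start_state M = fst (run M A S r 0)) \<and>
      (\<forall>k. 0 = snd (tape_at (run M A S r 0) k)) \<and>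
      (\<forall>j. \<not> j < i \<longrightarrow> 0 = fst (tape_at (run M A S r 0) 0) j) \<and>
      (\<forall>k j. 0 < k \<longrightarrow> 0 = fst (tape_at (run M A S r 0) k) j)"
      unfolding tape_at_init iS
      by (simp add: input_tape_def blank_tape_def) (simp add: run_def initial_config_def)
  qed
next
  case 7
  show ?case by (auto simp: read_symbol_eq)
next
  case 8
  show ?case
  proof (intro allI impI, elim conjE)
    fix r t k a h
    assume S: "S \<in> lists (set as)" and ap: "applies M (run M A S r t) k"
      and "a = fst (act_at M (run M A S r t) k)" "h = snd (tape_at (run M A S r t) k)"
    then show "a = fst (tape_at (run M A S r (t + 1)) k) h \<and>
      (\<forall>i b. i \<noteq> h \<and> b = fst (tape_at (run M A S r t) k) i \<longrightarrow> b = fst (tape_at (run M A S r (t + 1)) k) i)"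
      unfolding run_Suc tape_at_delta[OF TM regular_run[OF TM S] ap] act_eq by simp
  qed
next
  case 9
  show ?case
  proof (intro allI impI)
    fix r t k h g
    assume h: "h = snd (tape_at (run M A S r t) k)"
    have *: "snd (tape_at (run M A S r (t + 1)) k) = move_head (snd (act_at M (run M A S r t) k)) h"
      if "S \<in> lists (set as)" "applies M (run M A S r t) k"
      unfolding run_Suc tape_at_delta[OF TM regular_run[OF TM that(1)] that(2)] act_eq h by simp
    show "(((S \<in> lists (set as) \<and> applies M (run M A S r t) k \<and>
          0 = move_code (snd (act_at M (run M A S r t) k))) \<longrightarrow> h = snd (tape_at (run M A S r (t + 1)) k)) \<and>
        ((S \<in> lists (set as) \<and> applies M (run M A S r t) k \<and>
          1 = move_code (snd (act_at M (run M A S r t) k))) \<longrightarrow> h + 1 = snd (tape_at (run M A S r (t + 1)) k)) \<and>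
        ((S \<in> lists (set as) \<and> applies M (run M A S r t) k \<and>
          2 = move_code (snd (act_at M (run M A S r t) k))) \<and> (h = g + 1 \<or> h = 0 \<and> g = 0) \<longrightarrow>
          g = snd (tape_at (run M A S r (t + 1)) k)))"
      by (cases "snd (act_at M (run M A S r t) k)") (auto simp: *[unfolded Suc_eq_plus1[symmetric]])
  qed
next
  case 10
  show ?case
  proof (intro allI impI, elim conjE)
    fix q xs r t
    assume q: "q \<noteq> halt_state M" "q \<notin> query_states M" "length xs = num_tapes M"
      and S: "S \<in> lists (set as)" and st: "q = fst (run M A S r t)"
      and rd: "\<forall>k<num_tapes M. xs ! k = read_symbol (tape_at (run M A S r t) k)"
    have len: "length (snd (run M A S r t)) = num_tapes M"
      using regular_run[OF TM S] by (simp add: regular_def)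
    then have xs: "xs = map read_symbol (snd (run M A S r t))"
      using q rd by (intro nth_equalityI) (auto simp: tape_at_def)
    have "applies M (run M A S r t) k" if "k < num_tapes M" for k
      using q st that by (simp add: applies_def)
    then show "(S \<in> lists (set as) \<and> fst (delta M q xs) = fst (run M A S r (t + 1))) \<and>
      (\<forall>k<num_tapes M.
        (S \<in> lists (set as) \<and> applies M (run M A S r t) k \<and>
          fst (snd (delta M q xs) ! k) = fst (act_at M (run M A S r t) k)) \<and>
        S \<in> lists (set as) \<and> applies M (run M A S r t) k \<and>
          move_code (snd (snd (delta M q xs) ! k)) = move_code (snd (act_at M (run M A S r t) k)))"
      using S q st unfolding xs run_Suc by (simp add: step_eq act_at_def)
  qed
next
  case 11
  show ?case
  proof (intro allI impI, elim conjE)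
    fix q r t n b a
    let ?c = "run M A S r t" and ?B = "finite_change A r"
    assume q: "q \<noteq> halt_state M" "q \<in> query_states M"
      and S: "S \<in> lists (set as)" and st: "q = fst ?c"
      and n: "\<forall>i<n. 1 = fst (tape_at ?c 1) i" "a = fst (tape_at ?c 1) n" "a \<noteq> 1" and b: "b = ?B n"
    have qn: "query_number (tape_at ?c 1) = n"
      unfolding query_number_def
    proof (rule Least_equality)
      show "fst (tape_at ?c 1) n \<noteq> 1" using n by simp
      show "n \<le> i" if "fst (tape_at ?c 1) i \<noteq> 1" for i using n(1) that by (metis not_less)
    qed
    have tape: "tape_at (run M A S r (t + 1)) k = (if k = 1 then unary_tape b else tape_at ?c k)" for k
      unfolding run_Suc using tape_at_query[OF TM regular_run[OF TM S], of A r t ?B k] q st qn b by simp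
    have "fst (run M A S r (t + 1)) = answer_state M q" using q st unfolding run_Suc by (simp add: step_eq)
    then show "(S \<in> lists (set as) \<and> answer_state M q = fst (run M A S r (t + 1))) \<and>
      0 = snd (tape_at (run M A S r (t + 1)) 1) \<and>
      (\<forall>i. (i < b \<longrightarrow> 1 = fst (tape_at (run M A S r (t + 1)) 1) i) \<and>
        (\<not> i < b \<longrightarrow> 0 = fst (tape_at (run M A S r (t + 1)) 1) i)) \<and>
      (\<forall>k. k \<noteq> 1 \<longrightarrow> (\<forall>h. h = snd (tape_at ?c k) \<longrightarrow> h = snd (tape_at (run M A S r (t + 1)) k)) \<and>
        (\<forall>i c. c = fst (tape_at ?c k) i \<longrightarrow> c = fst (tape_at (run M A S r (t + 1)) k) i))"
      unfolding tape using S by (simp add: unary_tape_def)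
  qed
qed

text \<open>For \<open>S \<in> L\<close> every closed set contains a halting fact by
  \<open>closed_halts\<close>. For \<open>S \<notin> L\<close> the set \<open>run_facts\<close> is
  closed without one: its oracles lie above \<open>A\<close>, so none of its runs on a word over the
  alphabet halts, and for other words it has no state facts.\<close>

lemma Pi11_recognized:
  assumes "finite \<Sigma>" "L \<subseteq> lists \<Sigma>" "oracle_TM \<Sigma> M" "recognizes_with_fast_growing_oracle \<Sigma> M L"
  shows "Pi11_language L"
proof -
  obtain as where as: "set as = \<Sigma>" using finite_list[OF assms(1)] by blast
  obtain A where A: "\<And>B S. (\<forall>n. A n \<le> B n) \<Longrightarrow> S \<in> lists \<Sigma> \<Longrightarrow> halts_on M B S \<longleftrightarrow> S \<in> L"
    using assms(4) unfolding recognizes_with_fast_growing_oracle_def by blast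
  define halt where "halt = Ex_num 1 (Ex_num 2 (Fact [num 1, Var 1, Var 2, num (halt_state M)]))"
  define \<phi> where "\<phi> = All_set 0 (Imp (closed_form M as) halt)"
  have sat: "sat e V \<phi> \<longleftrightarrow> (\<forall>Y. closed M as (e 0) Y \<longrightarrow> (\<exists>r t. enc [1, r, t, halt_state M] \<in> Y))" for e V
    unfolding \<phi>_def by (simp add: sat_closed_form halt_def)
  have m: "matrix (Imp (closed_form M as) halt)" by (simp add: matrix_closed_form halt_def)
  then have "Pi11_form \<phi>" unfolding \<phi>_def matrix_def by (blast intro: Pi11_form.intros)
  moreover have "free_set \<phi> = {}" using m unfolding \<phi>_def matrix_def by auto
  moreover have "free_num \<phi> \<subseteq> {0}"
    using free_num_closed_form unfolding \<phi>_def halt_def by auto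
  moreover have "e 0 \<in> list_encode ` L \<longleftrightarrow> sat e V \<phi>" for e V
  proof -
    define S where "S = list_decode (e 0)"
    have S: "e 0 = list_encode S" by (simp add: S_def)
    have mem: "e 0 \<in> list_encode ` L \<longleftrightarrow> S \<in> L" unfolding S by (auto simp: list_encode_eq)
    show ?thesis
    proof (cases "S \<in> L")
      case True
      then have SL: "S \<in> lists \<Sigma>" using assms(2) by blast
      have "\<exists>r t. enc [1, r, t, halt_state M] \<in> Y" if "closed M as (e 0) Y" for Y
        by (rule closed_halts[OF that[unfolded S], of A]) (use SL A[OF _ SL] True assms(3) as in auto)
      then show ?thesis using mem True sat by simp
    next
      case False
      have "enc [1, r, t, halt_state M] \<notin> run_facts M \<Sigma> A S" for r t
      proof
        assume "enc [1, r, t, halt_state M] \<in> run_facts M \<Sigma> A S"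
        then have "S \<in> lists \<Sigma>" "fst (run M A S r t) = halt_state M" unfolding mem_run_facts by auto
        moreover from this(2) have "halts_on M (finite_change A r) S" unfolding halts_on_def run_def by blast
        moreover have "\<forall>n. A n \<le> finite_change A r n" by (simp add: finite_change_def)
        ultimately show False using A False by blast
      qed
      moreover have "closed M as (e 0) (run_facts M \<Sigma> A S)"
        using closed_run_facts[of as M S A] assms(3) as S by simp
      ultimately show ?thesis using mem False sat by blast
    qed
  qed
  ultimately show ?thesis unfolding Pi11_language_def Pi11_def by blast
qed

theorem theorem2p2:
  fixes \<Sigma> :: "nat set" and L :: "nat list set"
  assumes "finite \<Sigma>" and "L \<subseteq> lists \<Sigma>"
  shows "(\<exists>M. oracle_TM \<Sigma> M \<and> recognizes_with_fast_growing_oracle \<Sigma> M L) \<longleftrightarrow> Pi11_language L"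
  using recognized_Pi11[OF assms(1)] Pi11_recognized[OF assms] by blast

end
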